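(* Suppose that Assumptions (A), (B), (C), (D) hold, that $(T_n)_{n\ge1}$ is the regular sequence of designs generated by some density function, that $T_n\cap\,]x-h,x+h[\,\ne\emptyset$, $nh\ge1$, $h\to0$ and $nh\to\infty$. Moreover assume that $\frac mn=O(1)$ as $n,m\to\infty$, that $\lim_{n,m\to\infty}nh^2=\infty$ and that $\lim_{n,m\to\infty}\sqrt m\,h^2=0$. Then for any $x\in\,]0,1[$, $$\sqrt m\big(\hat g_n^{pro}(x)-g(x)\big)\xrightarrow{\ \mathscr D\ }Z,\qquad Z\sim\mathcal N(0,R(x,x)),\qquad\text{as }n,m\to\infty,$$ where $\xrightarrow{\mathscr D}$ denotes convergence in distribution.
   Context: Model: $Y_j(t_i)=g(t_i)+\varepsilon_j(t_i)$, $1\le i\le n$, $1\le j\le m$, with $g\in C^2([0,1])$ and $\varepsilon_1,\dots,\varepsilon_m$ i.i.d. copies of a centered second-order process $\varepsilon$ on $[0,1]$ with known continuous autocovariance $R$ such that $(R(s,t))_{s,t\in T}$ is non-singular for every finite $T\subset[0,1]$. $\overline Y(t_i)=\frac1m\sum_jY_j(t_i)$. $K$ is a kernel of class $C^1$ with support $[-1,1]$, $\int_{-1}^1K=1$, $\int_{-1}^1tK(t)dt=0$, $\int_{-1}^1t^2K(t)dt<\infty$; $\varphi_{x,h}(s)=\frac1hK(\frac{x-s}h)$, $h\in(0,1)$ the bandwidth. Projection estimator: $f_{x,h}(t)=\int_0^1R(s,t)\varphi_{x,h}(s)ds$, $(m_{x,h}(t_1),\dots,m_{x,h}(t_n))=(f_{x,h}(t_1),\dots,f_{x,h}(t_n))R_{|T_n}^{-1}$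 with $R_{|T_n}=(R(t_i,t_j))_{i,j}$, and $\hat g_n^{pro}(x)=\sum_{i=1}^nm_{x,h}(t_i)\overline Y(t_i)$. Regular designs: $T_n=\{t_{i,n}=F^{-1}(i/n),\ i=1,\dots,n\}$, where $F$ is the distribution function of a density $f\in C^2([0,1])$ with $\inf_{0<t<1}f(t)>0$ and $\sup_{0<t<1}f(t)<\infty$. Notation: $R^{(k,l)}$ is the partial derivative of order $k$ in the first and $l$ in the second variable; $R^{(0,1)}(t,t^-)=\lim_{s\uparrow t}\partial R(t,s)/\partial s$, $R^{(0,1)}(t,t^+)=\lim_{s\downarrow t}\partial R(t,s)/\partial s$, similarly for order 2. $\alpha(t)=R^{(0,1)}(t,t^-)-R^{(0,1)}(t,t^+)$ for $t\in]0,1[$. RKHS($R$) is the reproducing kernel Hilbert space with kernel $R$ and norm $\|\cdot\|$. (A) $R$ is continuous on $[0,1]^2$, $R^{(0,1)}(t,t^\pm)$ and $R^{(0,2)}(t,t^\pm)$ exist and are continuous, and off the diagonal $R$ has continuous derivatives up to order two. (B) $\alpha$ is Lipschitz on $]0,1[$, $\inf_{0<t<1}\alpha(t)>0$, $\sup_{0<t<1}\alpha(t)<\infty$. (C) For each $t\in[0,1]$, $R^{(0,2)}(\cdot,t^+)\in$ RKHS($R$) and $\sup_{0\le t\le1}\|R^{(0,2)}(\cdot,t^+)\|<\infty$. (D) $K$ is even and $K'$ is Lipschitz on $[-1,1]$. *)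

theory Defs
  imports
    "HOL-Probability.Probability"
    "HOL-Library.Landau_Symbols"
    "Jordan_Normal_Form.Gauss_Jordan_Elimination"
begin

subsection \<open>Smoothness\<close>

text \<open>Derivatives at the end points of a closed interval are one-sided.\<close>

definition C2_on :: "real set \<Rightarrow> (real \<Rightarrow> real) \<Rightarrow> bool" where
  "C2_on S f \<longleftrightarrow> (\<exists>f' f''.
     (\<forall>t\<in>S. (f has_real_derivative f' t) (at t within S)) \<and>
     (\<forall>t\<in>S. (f' has_real_derivative f'' t) (at t within S)) \<and>
     continuous_on S f'')"

definition dfst :: "(real \<Rightarrow> real \<Rightarrow> real) \<Rightarrow> real \<Rightarrow> real \<Rightarrow> real" where
  "dfst Q s t = vector_derivative (\<lambda>u. Q u t) (at s within {0..1})"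

definition dsnd :: "(real \<Rightarrow> real \<Rightarrow> real) \<Rightarrow> real \<Rightarrow> real \<Rightarrow> real" where
  "dsnd Q s t = vector_derivative (\<lambda>u. Q s u) (at t within {0..1})"

definition off_diag :: "(real \<times> real) set" where
  "off_diag = {(s, t). s \<in> {0..1} \<and> t \<in> {0..1} \<and> s \<noteq> t}"

text \<open>All partial derivatives up to order \<open>k\<close>, mixed ones in either order, exist and are
  continuous off the diagonal. The values of \<^const>\<open>dfst\<close> and \<^const>\<open>dsnd\<close> on the diagonal
  play no role, as derivatives at a point off the diagonal are local.\<close>

primrec Ck_off_diag :: "nat \<Rightarrow> (real \<Rightarrow> real \<Rightarrow> real) \<Rightarrow> bool" where
  "Ck_off_diag 0 Q \<longleftrightarrow> continuous_on off_diag (\<lambda>(s, t). Q s t)"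
| "Ck_off_diag (Suc k) Q \<longleftrightarrow>
     continuous_on off_diag (\<lambda>(s, t). Q s t) \<and>
     (\<forall>(s, t)\<in>off_diag. (\<lambda>u. Q u t) differentiable (at s within {0..1}) \<and>
                       (\<lambda>u. Q s u) differentiable (at t within {0..1})) \<and>
     Ck_off_diag k (dfst Q) \<and> Ck_off_diag k (dsnd Q)"

text \<open>\<open>dsnd_left l R s t\<close> is \<open>R\<^sup>(\<^sup>0\<^sup>,\<^sup>l\<^sup>)(s, t\<^sup>-)\<close> and \<open>dsnd_right l R s t\<close> is
  \<open>R\<^sup>(\<^sup>0\<^sup>,\<^sup>l\<^sup>)(s, t\<^sup>+)\<close>.\<close>

definition dsnd_left :: "nat \<Rightarrow> (real \<Rightarrow> real \<Rightarrow> real) \<Rightarrow> real \<Rightarrow> real \<Rightarrow> real" where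
  "dsnd_left l R s t = Lim (at_left t) (\<lambda>u. (dsnd ^^ l) R s u)"

definition dsnd_right :: "nat \<Rightarrow> (real \<Rightarrow> real \<Rightarrow> real) \<Rightarrow> real \<Rightarrow> real \<Rightarrow> real" where
  "dsnd_right l R s t = Lim (at_right t) (\<lambda>u. (dsnd ^^ l) R s u)"

definition diag_limits :: "nat \<Rightarrow> (real \<Rightarrow> real \<Rightarrow> real) \<Rightarrow> bool" where
  "diag_limits l R \<longleftrightarrow>
     (\<forall>t\<in>{0<..1}. \<exists>a. ((\<lambda>u. (dsnd ^^ l) R t u) \<longlongrightarrow> a) (at_left t)) \<and>
     (\<forall>t\<in>{0..<1}. \<exists>a. ((\<lambda>u. (dsnd ^^ l) R t u) \<longlongrightarrow> a) (at_right t)) \<and>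
     continuous_on {0<..1} (\<lambda>t. dsnd_left l R t t) \<and>
     continuous_on {0..<1} (\<lambda>t. dsnd_right l R t t)"

definition jump :: "(real \<Rightarrow> real \<Rightarrow> real) \<Rightarrow> real \<Rightarrow> real" where
  "jump R t = dsnd_left 1 R t t - dsnd_right 1 R t t"


subsection \<open>Reproducing kernel Hilbert spaces\<close>

text \<open>Functions on \<open>A\<close> are represented by functions vanishing outside \<open>A\<close>.\<close>

definition ext_zero :: "'s set \<Rightarrow> ('s \<Rightarrow> real) \<Rightarrow> 's \<Rightarrow> real" where
  "ext_zero A f = (\<lambda>s. if s \<in> A then f s else 0)"

definition function_space_on :: "'s set \<Rightarrow> ('s \<Rightarrow> real) set \<Rightarrow> bool" where
  "function_space_on A H \<longleftrightarrow>
     (\<forall>f\<in>H. \<forall>s. s \<notin> A \<longrightarrow> f s = 0) \<and>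
     (\<lambda>s. 0) \<in> H \<and>
     (\<forall>f\<in>H. \<forall>g\<in>H. (\<lambda>s. f s + g s) \<in> H) \<and>
     (\<forall>c. \<forall>f\<in>H. (\<lambda>s. c * f s) \<in> H)"

definition inner_product_on ::
    "('s \<Rightarrow> real) set \<Rightarrow> (('s \<Rightarrow> real) \<Rightarrow> ('s \<Rightarrow> real) \<Rightarrow> real) \<Rightarrow> bool" where
  "inner_product_on H ip \<longleftrightarrow>
     (\<forall>f\<in>H. \<forall>g\<in>H. ip f g = ip g f) \<and>
     (\<forall>f\<in>H. \<forall>g\<in>H. \<forall>k\<in>H. ip (\<lambda>s. f s + g s) k = ip f k + ip g k) \<and>
     (\<forall>c. \<forall>f\<in>H. \<forall>g\<in>H. ip (\<lambda>s. c * f s) g = c * ip f g) \<and>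
     (\<forall>f\<in>H. 0 \<le> ip f f) \<and>
     (\<forall>f\<in>H. ip f f = 0 \<longrightarrow> f = (\<lambda>s. 0))"

definition ip_norm :: "(('s \<Rightarrow> real) \<Rightarrow> ('s \<Rightarrow> real) \<Rightarrow> real) \<Rightarrow> ('s \<Rightarrow> real) \<Rightarrow> real" where
  "ip_norm ip f = sqrt (ip f f)"

definition ip_complete ::
    "('s \<Rightarrow> real) set \<Rightarrow> (('s \<Rightarrow> real) \<Rightarrow> ('s \<Rightarrow> real) \<Rightarrow> real) \<Rightarrow> bool" where
  "ip_complete H ip \<longleftrightarrow> (\<forall>X :: nat \<Rightarrow> 's \<Rightarrow> real.
     (\<forall>n. X n \<in> H) \<and>
     (\<forall>e>0. \<exists>N. \<forall>p\<ge>N. \<forall>q\<ge>N. ip_norm ip (\<lambda>s. X p s - X q s) < e) \<longrightarrow>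
     (\<exists>f\<in>H. (\<lambda>n. ip_norm ip (\<lambda>s. X n s - f s)) \<longlonglongrightarrow> 0))"

definition is_rkhs :: "'s set \<Rightarrow> ('s \<Rightarrow> 's \<Rightarrow> real) \<Rightarrow> ('s \<Rightarrow> real) set \<Rightarrow>
    (('s \<Rightarrow> real) \<Rightarrow> ('s \<Rightarrow> real) \<Rightarrow> real) \<Rightarrow> bool" where
  "is_rkhs A R H ip \<longleftrightarrow>
     function_space_on A H \<and> inner_product_on H ip \<and> ip_complete H ip \<and>
     (\<forall>t\<in>A. ext_zero A (\<lambda>s. R s t) \<in> H) \<and>
     (\<forall>t\<in>A. \<forall>f\<in>H. ip f (ext_zero A (\<lambda>s. R s t)) = f t)"

text \<open>The element \<open>R\<^sup>(\<^sup>0\<^sup>,\<^sup>2\<^sup>)(\<cdot>, t\<^sup>+)\<close>. At \<open>t = 1\<close> there is no limit from the right within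
  \<open>[0,1]\<close>, and the limit from the left is taken instead.\<close>

definition dsnd2_right :: "(real \<Rightarrow> real \<Rightarrow> real) \<Rightarrow> real \<Rightarrow> real \<Rightarrow> real" where
  "dsnd2_right R t = ext_zero {0..1}
     (\<lambda>s. if t < 1 then dsnd_right 2 R s t else dsnd_left 2 R s t)"


subsection \<open>Processes\<close>

abbreviation path_space :: "(real \<Rightarrow> real) measure" where
  "path_space \<equiv> PiM {0..1} (\<lambda>_. borel)"

definition sample_path :: "(real \<Rightarrow> 'a \<Rightarrow> real) \<Rightarrow> 'a \<Rightarrow> real \<Rightarrow> real" where
  "sample_path X \<omega> = (\<lambda>t\<in>{0..1}. X t \<omega>)"

definition second_order_process :: "'a measure \<Rightarrow> (real \<Rightarrow> 'a \<Rightarrow> real) \<Rightarrow> bool" where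
  "second_order_process M X \<longleftrightarrow>
     (\<forall>t\<in>{0..1}. X t \<in> borel_measurable M \<and> integrable M (\<lambda>\<omega>. (X t \<omega>)\<^sup>2))"

definition centered_process :: "'a measure \<Rightarrow> (real \<Rightarrow> 'a \<Rightarrow> real) \<Rightarrow> bool" where
  "centered_process M X \<longleftrightarrow> (\<forall>t\<in>{0..1}. (LINT \<omega>|M. X t \<omega>) = 0)"

definition autocovariance :: "'a measure \<Rightarrow> (real \<Rightarrow> 'a \<Rightarrow> real) \<Rightarrow> real \<Rightarrow> real \<Rightarrow> real" where
  "autocovariance M X s t =
     (LINT \<omega>|M. (X s \<omega> - (LINT \<omega>'|M. X s \<omega>')) * (X t \<omega> - (LINT \<omega>'|M. X t \<omega>')))"

definition iid_copies :: "'a measure \<Rightarrow> (nat \<Rightarrow> real \<Rightarrow> 'a \<Rightarrow> real) \<Rightarrow>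
    'b measure \<Rightarrow> (real \<Rightarrow> 'b \<Rightarrow> real) \<Rightarrow> bool" where
  "iid_copies M E N X \<longleftrightarrow>
     prob_space.indep_vars M (\<lambda>_. path_space) (\<lambda>j. sample_path (E j)) {1..} \<and>
     (\<forall>j\<ge>1. distr M path_space (sample_path (E j)) = distr N path_space (sample_path X))"


subsection \<open>Kernels, designs and the projection estimator\<close>

definition smoothing_kernel :: "(real \<Rightarrow> real) \<Rightarrow> bool" where
  "smoothing_kernel K \<longleftrightarrow>
     K C1_differentiable_on UNIV \<and>
     closure {u. K u \<noteq> 0} = {-1..1} \<and>
     (K has_integral 1) {-1..1} \<and>
     ((\<lambda>u. u * K u) has_integral 0) {-1..1} \<and>
     (\<lambda>u. u\<^sup>2 * K u) integrable_on {-1..1}"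

definition scaled_kernel :: "(real \<Rightarrow> real) \<Rightarrow> real \<Rightarrow> real \<Rightarrow> real \<Rightarrow> real" where
  "scaled_kernel K x h s = 1 / h * K ((x - s) / h)"

definition design_density :: "(real \<Rightarrow> real) \<Rightarrow> bool" where
  "design_density f \<longleftrightarrow>
     C2_on {0..1} f \<and> (\<forall>t\<in>{0..1}. 0 \<le> f t) \<and> (f has_integral 1) {0..1} \<and>
     (\<exists>c>0. \<forall>t\<in>{0<..<1}. c \<le> f t) \<and> bdd_above (f ` {0<..<1})"

definition distribution_fun :: "(real \<Rightarrow> real) \<Rightarrow> real \<Rightarrow> real" where
  "distribution_fun f t = integral {0..t} f"

definition regular_design :: "(real \<Rightarrow> real) \<Rightarrow> nat \<Rightarrow> real list" where
  "regular_design f n =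
     map (\<lambda>i. the_inv_into {0..1} (distribution_fun f) (real i / real n)) [1..<Suc n]"

definition gram :: "(real \<Rightarrow> real \<Rightarrow> real) \<Rightarrow> real list \<Rightarrow> real mat" where
  "gram R ts = Matrix.mat (length ts) (length ts) (\<lambda>(i, j). R (ts ! i) (ts ! j))"

definition smoothed_cov ::
    "(real \<Rightarrow> real \<Rightarrow> real) \<Rightarrow> (real \<Rightarrow> real) \<Rightarrow> real \<Rightarrow> real \<Rightarrow> real \<Rightarrow> real" where
  "smoothed_cov R K x h t = integral {0..1} (\<lambda>s. R s t * scaled_kernel K x h s)"

text \<open>The \<open>i\<close>-th entry of the row vector \<open>(f(t\<^sub>1), \<dots>, f(t\<^sub>n)) R\<^sub>|\<^sub>T\<^sup>-\<^sup>1\<close>, where \<open>f\<close> is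
  \<open>smoothed_cov R K x h\<close> and indices start at \<open>0\<close>.\<close>

definition proj_weight :: "(real \<Rightarrow> real \<Rightarrow> real) \<Rightarrow> (real \<Rightarrow> real) \<Rightarrow> real \<Rightarrow> real \<Rightarrow>
    real list \<Rightarrow> nat \<Rightarrow> real" where
  "proj_weight R K x h ts i =
     (\<Sum>j<length ts. smoothed_cov R K x h (ts ! j) * the (mat_inverse (gram R ts)) $$ (j, i))"

definition sample_mean ::
    "(nat \<Rightarrow> real \<Rightarrow> 'a \<Rightarrow> real) \<Rightarrow> nat \<Rightarrow> real \<Rightarrow> 'a \<Rightarrow> real" where
  "sample_mean Y m t \<omega> = 1 / real m * (\<Sum>j=1..m. Y j t \<omega>)"

definition proj_estimator :: "(real \<Rightarrow> real \<Rightarrow> real) \<Rightarrow> (real \<Rightarrow> real) \<Rightarrow> real \<Rightarrow>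
    real list \<Rightarrow> nat \<Rightarrow> (nat \<Rightarrow> real \<Rightarrow> 'a \<Rightarrow> real) \<Rightarrow> real \<Rightarrow> 'a \<Rightarrow> real" where
  "proj_estimator R K h ts m Y x \<omega> =
     (\<Sum>i<length ts. proj_weight R K x h ts i * sample_mean Y m (ts ! i) \<omega>)"


subsection \<open>Assumptions\<close>

definition assumption_A :: "(real \<Rightarrow> real \<Rightarrow> real) \<Rightarrow> bool" where
  "assumption_A R \<longleftrightarrow>
     continuous_on ({0..1} \<times> {0..1}) (\<lambda>(s, t). R s t) \<and>
     diag_limits 1 R \<and> diag_limits 2 R \<and> Ck_off_diag 2 R"

definition assumption_B :: "(real \<Rightarrow> real \<Rightarrow> real) \<Rightarrow> bool" where
  "assumption_B R \<longleftrightarrow>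
     (\<exists>L. L-lipschitz_on {0<..<1} (jump R)) \<and>
     (\<exists>c>0. \<forall>t\<in>{0<..<1}. c \<le> jump R t) \<and> bdd_above (jump R ` {0<..<1})"

definition assumption_C :: "(real \<Rightarrow> real \<Rightarrow> real) \<Rightarrow> (real \<Rightarrow> real) set \<Rightarrow>
    ((real \<Rightarrow> real) \<Rightarrow> (real \<Rightarrow> real) \<Rightarrow> real) \<Rightarrow> bool" where
  "assumption_C R H ip \<longleftrightarrow>
     (\<forall>t\<in>{0..1}. dsnd2_right R t \<in> H) \<and>
     bdd_above ((\<lambda>t. ip_norm ip (dsnd2_right R t)) ` {0..1})"

definition assumption_D :: "(real \<Rightarrow> real) \<Rightarrow> bool" where
  "assumption_D K \<longleftrightarrow>
     (\<forall>u. K (- u) = K u) \<and> (\<exists>L. L-lipschitz_on {-1..1} (deriv K))"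

end

theory Submission
  imports Defs
begin

text \<open>
  Let \<open>\<lambda>(k) = \<integral> \<phi>\<^bsub>x,h\<^esub> k - \<Sum> m\<^bsub>x,h\<^esub>(t\<^sub>i) k(t\<^sub>i)\<close>. The definition of the weights says that
  \<open>\<lambda>\<close> annihilates every \<open>R(\<cdot>, t\<^sub>i)\<close>; let \<open>u(t) = \<lambda>(R(\<cdot>, t))\<close> and
  \<open>V = \<integral> \<phi>\<^bsub>x,h\<^esub> u\<close>, which is the squared dual norm of \<open>\<lambda>\<close>.

  Since \<open>R(s, \<cdot>)\<close> has a single kink, at \<open>s\<close> and of size \<open>\<alpha>(s)\<close>, the second divided difference
  of \<open>R(s, \<cdot>)\<close> at \<open>a < b < c\<close> is
  \<open>-\<alpha>(s) T(s) + \<integral> R\<^sup>(\<^sup>0\<^sup>,\<^sup>2\<^sup>)(s, t) T(t) dt\<close>, where \<open>T\<close> is the tent function of \<open>a, b, c\<close>. By (C), \<open>\<lambda>\<close> of the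
  integral is \<open>O((c - a) \<surd>V)\<close>. Taking \<open>a, c\<close> adjacent design points and \<open>b = t\<close> between them gives
  \<open>u = O(n\<^sup>-\<^sup>2 (1/h + \<surd>V))\<close>, and integrating against \<open>\<phi>\<^bsub>x,h\<^esub>\<close> yields \<open>V = O(1/(n\<^sup>2 h))\<close>. Taking
  \<open>a, b, c\<close> consecutive design points and summing with coefficients \<open>(g/\<alpha>)(t\<^sub>i)\<close> gives
  \<open>\<lambda>(g) = O(1/n + \<surd>V)\<close> for every smooth \<open>g\<close>, whether or not it lies in the reproducing kernel Hilbert
  space; the boundary terms disappear after subtracting from \<open>g\<close> the combination of \<open>R(\<cdot>, t\<^sub>1)\<close> and
  \<open>R(\<cdot>, t\<^sub>n)\<close> that interpolates it at \<open>t\<^sub>1\<close> and \<open>t\<^sub>n = 1\<close>, on which \<open>\<lambda>\<close> vanishes.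
  Together with \<open>\<integral> \<phi>\<^bsub>x,h\<^esub> g = g(x) + O(h\<^sup>2)\<close> the bias is \<open>o(1/\<surd>m)\<close>.

  The noise satisfies \<open>\<Sum> m\<^bsub>x,h\<^esub>(t\<^sub>i) \<epsilon>(t\<^sub>i) \<rightarrow> \<epsilon>(x)\<close> in mean square, so the estimator differs from the
  classical normalised sum of the \<open>\<epsilon>\<^sub>j(x)\<close> by a term that vanishes in mean square.
\<close>

section \<open>Riemann sums and balls of the reproducing kernel Hilbert space\<close>

lemma continuous_on_slice:
  assumes "continuous_on ({0..1} \<times> {0..1}) (\<lambda>(s, t). k s t)"
  shows "t \<in> {0..1} \<Longrightarrow> continuous_on {0..1} (\<lambda>s. k s t)"
    and "s \<in> {0..1} \<Longrightarrow> continuous_on {0..1} (\<lambda>t. k s t)"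
proof -
  show "continuous_on {0..1} (\<lambda>s. k s t)" if "t \<in> {0..1}"
  proof -
    have "continuous_on {0..1} ((\<lambda>(s, t). k s t) \<circ> (\<lambda>s. (s, t)))"
      using that by (intro continuous_on_compose continuous_intros continuous_on_subset[OF assms]) auto
    then show ?thesis by (simp add: o_def)
  qed
  show "continuous_on {0..1} (\<lambda>t. k s t)" if "s \<in> {0..1}"
  proof -
    have "continuous_on {0..1} ((\<lambda>(s, t). k s t) \<circ> (\<lambda>t. (s, t)))"
      using that by (intro continuous_on_compose continuous_intros continuous_on_subset[OF assms]) auto
    then show ?thesis by (simp add: o_def)
  qed
qed

lemma compact_bound:
  fixes k :: "'z::topological_space \<Rightarrow> real"
  assumes "compact S" "continuous_on S k"
  obtains B where "B > 0" "\<And>s. s \<in> S \<Longrightarrow> \<bar>k s\<bar> \<le> B"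
proof -
  have "bounded (k ` S)" by (intro compact_imp_bounded compact_continuous_image assms)
  then show ?thesis using that by (metis bounded_pos image_eqI real_norm_def)
qed

text \<open>Uniform continuity on the compact square gives one mesh size for all \<open>t\<close>.
  The uniformity is what \<open>riemann_quad_lim\<close> uses, where the inner sum is evaluated at
  grid points that move with \<open>N\<close>.\<close>

lemma riemann_sum_uniform:
  fixes k :: "real \<Rightarrow> real \<Rightarrow> real"
  assumes cont: "continuous_on ({0..1} \<times> {0..1}) (\<lambda>(s, t). k s t)" and e: "e > 0"
  shows "\<exists>N0>0. \<forall>N\<ge>N0. \<forall>t\<in>{0..1}.
    \<bar>(\<Sum>i<N. 1 / real N * k (real i / real N) t) - integral {0..1} (\<lambda>s. k s t)\<bar> \<le> e"
proof -
  have "uniformly_continuous_on ({0..1} \<times> {0..1}) (\<lambda>(s, t). k s t)"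
    using cont by (intro compact_uniformly_continuous compact_Times) auto
  then obtain d where d: "d > 0" and d': "\<And>p p'. p \<in> {0..1} \<times> {0..1} \<Longrightarrow> p' \<in> {0..1} \<times> {0..1} \<Longrightarrow>
      dist p' p < d \<Longrightarrow> dist ((\<lambda>(s, t). k s t) p') ((\<lambda>(s, t). k s t) p) < e"
    unfolding uniformly_continuous_on_def using e by meson
  have dd: "\<bar>k s' t - k s t\<bar> < e"
    if "s \<in> {0..1}" "s' \<in> {0..1}" "t \<in> {0..1}" "dist s' s < d" for s s' t
    using d'[of "(s, t)" "(s', t)"] that by (simp add: dist_Pair_Pair dist_real_def)
  obtain N0 :: nat where N0: "1 / d < real N0" using reals_Archimedean2 by blast
  have "0 < 1 / d" using d by simp
  then have N0p: "N0 > 0" using N0 by (cases N0) auto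
  have "\<bar>(\<Sum>i<N. 1 / real N * k (real i / real N) t) - integral {0..1} (\<lambda>s. k s t)\<bar> \<le> e"
    if N: "N \<ge> N0" and t: "t \<in> {0..1}" for N t
  proof -
    have Np: "N > 0" using N N0p by simp
    have Nd: "1 / real N < d"
    proof -
      have "1 / d < real N" using N0 N by linarith
      then show ?thesis using d Np by (simp add: field_simps)
    qed
    note ck = continuous_on_slice(1)[OF cont t]
    have ik: "(\<lambda>s. k s t) integrable_on {a..b}" if "0 \<le> a" "b \<le> 1" for a b
      using that by (intro integrable_continuous_real continuous_on_subset[OF ck]) auto
    \<comment> \<open>Induction over the cells: each cell of length \<open>1 / N\<close> contributes
      an error of at most \<open>e / N\<close>.\<close>
    have "\<bar>(\<Sum>i<j. 1 / real N * k (real i / real N) t) - integral {0..real j / real N} (\<lambda>s. k s t)\<bar>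
        \<le> real j / real N * e" if "j \<le> N" for j
      using that
    proof (induction j)
      case 0
      then show ?case by simp
    next
      case (Suc j)
      let ?a = "real j / real N" and ?b = "real (Suc j) / real N"
      have ab: "0 \<le> ?a" "?a \<le> ?b" "?b \<le> 1" using Suc.prems Np by (auto simp: field_simps)
      have len: "?b - ?a = 1 / real N" by (simp add: add_divide_distrib)
      have split: "integral {0..?b} (\<lambda>s. k s t) =
          integral {0..?a} (\<lambda>s. k s t) + integral {?a..?b} (\<lambda>s. k s t)"
        using ab by (intro Henstock_Kurzweil_Integration.integral_combine[symmetric] ik) auto
      have "((\<lambda>s. k s t - k ?a t) has_integral
          (integral {?a..?b} (\<lambda>s. k s t) - (?b - ?a) * k ?a t)) {?a..?b}"
        using ab has_integral_const_real[of "k ?a t" ?a ?b]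
        by (intro has_integral_diff integrable_integral ik) auto
      moreover have "norm (k s t - k ?a t) \<le> e" if "s \<in> {?a..?b}" for s
      proof -
        have "dist s ?a < d" using that len Nd by (auto simp: dist_real_def)
        then show ?thesis using dd[of ?a s t] that ab t by (smt (verit) atLeastAtMost_iff real_norm_def)
      qed
      ultimately have "norm (integral {?a..?b} (\<lambda>s. k s t) - (?b - ?a) * k ?a t) \<le> e * measure lborel {?a..?b}"
        using e by (intro has_integral_bound_real[where f = "\<lambda>s. k s t - k ?a t"]) auto
      then have "\<bar>integral {?a..?b} (\<lambda>s. k s t) - 1 / real N * k ?a t\<bar> \<le> e * (1 / real N)"
        using ab len by simp
      moreover have "real (Suc j) / real N * e = ?a * e + e * (1 / real N)"
        by (simp add: add_divide_distrib distrib_right)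
      ultimately show ?case using Suc.IH Suc.prems unfolding split sum.lessThan_Suc by linarith
    qed
    from this[of N] show ?thesis using Np by simp
  qed
  then show ?thesis using N0p by blast
qed

text \<open>For a covariance \<open>R\<close> this is the variance of the combination of the process
  values at the points \<open>s i\<close>, and equally the squared reproducing-kernel norm of the
  same combination of the sections of \<open>R\<close>.\<close>

definition quad_form :: "('i set) \<Rightarrow> ('i \<Rightarrow> real) \<Rightarrow> ('i \<Rightarrow> real) \<Rightarrow> (real \<Rightarrow> real \<Rightarrow> real) \<Rightarrow> real" where
  "quad_form I c s R = (\<Sum>i\<in>I. \<Sum>j\<in>I. c i * c j * R (s i) (s j))"

text \<open>Membership in the ball of radius \<open>B\<close> of the reproducing kernel Hilbert space of \<open>R\<close>, tested on
  finite combinations of evaluations only.\<close>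

definition in_rk_ball :: "(real \<Rightarrow> real \<Rightarrow> real) \<Rightarrow> real \<Rightarrow> (real \<Rightarrow> real) \<Rightarrow> bool" where
  "in_rk_ball R B q \<longleftrightarrow> (\<forall>(I :: (nat + nat) set) c s. finite I \<longrightarrow> s ` I \<subseteq> {0..1} \<longrightarrow>
     \<bar>\<Sum>i\<in>I. c i * q (s i)\<bar> \<le> B * sqrt (quad_form I c s R))"

lemma in_rk_ballD:
  fixes I :: "(nat + nat) set"
  shows "in_rk_ball R B q \<Longrightarrow> finite I \<Longrightarrow> s ` I \<subseteq> {0..1} \<Longrightarrow>
    \<bar>\<Sum>i\<in>I. c i * q (s i)\<bar> \<le> B * sqrt (quad_form I c s R)"
  by (simp add: in_rk_ball_def)

text \<open>Testing on two points with coefficients 1 and -1 bounds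
  \<open>\<bar>q s - q t\<bar>\<close> by \<open>B\<close> times the square root of
  \<open>R s s - R s t - R t s + R t t\<close>, which tends to 0 as \<open>s\<close> approaches
  \<open>t\<close>.\<close>

lemma continuous_on_in_rk_ball:
  assumes R: "continuous_on ({0..1} \<times> {0..1}) (\<lambda>(s, t). R s t)"
    and q: "in_rk_ball R B q"
  shows "continuous_on {0..1} q"
  unfolding continuous_on_def
proof
  fix t :: real assume t: "t \<in> {0..1}"
  define D where "D s = R s s - R s t - R t s + R t t" for s
  have "\<bar>q s - q t\<bar> \<le> B * sqrt (D s)" if s: "s \<in> {0..1}" for s
  proof -
    have "(\<lambda>i. if i = Inl 0 then s else t) ` {Inl 0, Inr 0 :: nat + nat} \<subseteq> {0..1}" using s t by auto
    from in_rk_ballD[OF q _ this, of "\<lambda>i. if i = Inl 0 then 1 else -1"] show ?thesis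
      by (simp add: quad_form_def D_def algebra_simps)
  qed
  then have *: "\<forall>\<^sub>F s in at t within {0..1}. norm (q s - q t) \<le> B * sqrt (D s)"
    by (auto simp: eventually_at_filter)
  have comp: "continuous_on {0..1} (\<lambda>s. R (a s) (b s))"
    if "continuous_on {0..1} a" "continuous_on {0..1} b" "a ` {0..1} \<subseteq> {0..1}" "b ` {0..1} \<subseteq> {0..1}" for a b
  proof -
    have "continuous_on {0..1} ((\<lambda>(s, t). R s t) \<circ> (\<lambda>s. (a s, b s)))"
      using that by (intro continuous_on_compose continuous_on_Pair continuous_on_subset[OF R]) auto
    then show ?thesis by (simp add: o_def)
  qed
  have "continuous_on {0..1} (\<lambda>s. B * sqrt (D s))"
    unfolding D_def using t by (intro continuous_intros comp) auto
  then have "((\<lambda>s. B * sqrt (D s)) \<longlongrightarrow> B * sqrt (D t)) (at t within {0..1})"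
    using t by (simp add: continuous_on_def)
  then have "((\<lambda>s. B * sqrt (D s)) \<longlongrightarrow> 0) (at t within {0..1})" by (simp add: D_def)
  from Lim_null_comparison[OF * this] show "(q \<longlongrightarrow> q t) (at t within {0..1})"
    by (simp add: Lim_null[symmetric])
qed

lemma riemann_sum_single:
  fixes k :: "real \<Rightarrow> real"
  assumes "continuous_on {0..1} k"
  shows "(\<lambda>N. \<Sum>i<N. 1 / real N * k (real i / real N)) \<longlonglongrightarrow> integral {0..1} k"
proof (rule LIMSEQ_I)
  fix e :: real assume e: "e > 0"
  have "continuous_on ({0..1} \<times> {0..1}) (k \<circ> fst)"
    by (intro continuous_on_compose continuous_intros) (simp add: assms)
  then have "continuous_on ({0..1} \<times> {0..1}) (\<lambda>(s, t::real). k s)"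
    by (simp add: o_def case_prod_unfold)
  from riemann_sum_uniform[OF this, of "e/2"] e obtain N0 where "\<forall>N\<ge>N0. \<forall>t\<in>{0..1::real}.
    \<bar>(\<Sum>i<N. 1 / real N * k (real i / real N)) - integral {0..1} k\<bar> \<le> e/2" by auto
  then have "\<bar>(\<Sum>i<N. 1 / real N * k (real i / real N)) - integral {0..1} k\<bar> \<le> e/2" if "N \<ge> N0" for N
    using that by (metis atLeastAtMost_iff order_refl zero_le_one)
  then have "\<forall>N\<ge>N0. norm ((\<Sum>i<N. 1 / real N * k (real i / real N)) - integral {0..1} k) < e"
    using e by fastforce
  then show "\<exists>N0. \<forall>N\<ge>N0. norm ((\<Sum>i<N. 1 / real N * k (real i / real N)) - integral {0..1} k) < e"
    by blast
qed

section \<open>The error functional of the projection quadrature\<close>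

text \<open>\<open>defect\<close> is the signed measure \<open>\<phi> ds - \<Sum> w\<^sub>j \<delta>\<^bsub>p\<^sub>j\<^esub>\<close>, the
  error functional of the projection quadrature; \<open>energy\<close> is its squared norm in the dual of the
  reproducing kernel Hilbert space.\<close>

locale projection_quadrature =
  fixes R :: "real \<Rightarrow> real \<Rightarrow> real" and \<phi> :: "real \<Rightarrow> real"
    and n :: nat and p w :: "nat \<Rightarrow> real"
  assumes R_cont: "continuous_on ({0..1} \<times> {0..1}) (\<lambda>(s, t). R s t)"
    and R_sym: "\<And>s t. s \<in> {0..1} \<Longrightarrow> t \<in> {0..1} \<Longrightarrow> R s t = R t s"
    and \<phi>_cont: "continuous_on {0..1} \<phi>"
    and p_mem: "\<And>i. i < n \<Longrightarrow> p i \<in> {0..1}"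
    and interp: "\<And>i. i < n \<Longrightarrow>
      integral {0..1} (\<lambda>s. \<phi> s * R s (p i)) = (\<Sum>j<n. w j * R (p j) (p i))"
begin

definition defect :: "(real \<Rightarrow> real) \<Rightarrow> real" where
  "defect k = integral {0..1} (\<lambda>s. \<phi> s * k s) - (\<Sum>j<n. w j * k (p j))"

text \<open>By \<open>resid_eq\<close> this is also the error of interpolating \<open>smooth\<close>
  at the nodes by the sections \<open>R (p j)\<close>.\<close>

definition resid :: "real \<Rightarrow> real" where
  "resid t = defect (\<lambda>s. R s t)"

definition smooth :: "real \<Rightarrow> real" where
  "smooth t = integral {0..1} (\<lambda>s. \<phi> s * R s t)"

definition energy :: real where
  "energy = integral {0..1} (\<lambda>s. \<phi> s * resid s)"

lemma resid_node: "i < n \<Longrightarrow> resid (p i) = 0"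
  unfolding resid_def defect_def by (simp add: interp)

lemma integrable_phi_mult: "continuous_on {0..1} k \<Longrightarrow> (\<lambda>s. \<phi> s * k s) integrable_on {0..1}"
  by (intro integrable_continuous_real continuous_intros \<phi>_cont)

lemma defect_add:
  assumes "continuous_on {0..1} k" "continuous_on {0..1} l"
  shows "defect (\<lambda>s. k s + l s) = defect k + defect l"
  unfolding defect_def
  using integrable_phi_mult[OF assms(1)] integrable_phi_mult[OF assms(2)]
  by (simp add: distrib_left Henstock_Kurzweil_Integration.integral_add sum.distrib)

lemma defect_cmult: "defect (\<lambda>s. c * k s) = c * defect k"
proof -
  have "integral {0..1} (\<lambda>s. \<phi> s * (c * k s)) = c * integral {0..1} (\<lambda>s. \<phi> s * k s)"
    by (simp add: mult.left_commute)
  moreover have "(\<Sum>j<n. w j * (c * k (p j))) = c * (\<Sum>j<n. w j * k (p j))"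
    by (simp add: sum_distrib_left mult.left_commute)
  ultimately show ?thesis by (simp add: defect_def algebra_simps)
qed

lemma defect_sum:
  assumes "finite I" "\<And>i. i \<in> I \<Longrightarrow> continuous_on {0..1} (k i)"
  shows "defect (\<lambda>s. \<Sum>i\<in>I. k i s) = (\<Sum>i\<in>I. defect (k i))"
  using assms
proof (induction I rule: finite_induct)
  case empty
  then show ?case by (simp add: defect_def)
next
  case (insert a I)
  then show ?case
    by (simp add: defect_add continuous_on_sum)
qed

lemma defect_cong:
  assumes "\<And>s. s \<in> {0..1} \<Longrightarrow> k s = l s"
  shows "defect k = defect l"
proof -
  have "integral {0..1} (\<lambda>s. \<phi> s * k s) = integral {0..1} (\<lambda>s. \<phi> s * l s)"
    by (intro Henstock_Kurzweil_Integration.integral_cong) (simp add: assms)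
  moreover have "(\<Sum>j<n. w j * k (p j)) = (\<Sum>j<n. w j * l (p j))"
    using p_mem by (intro sum.cong) (auto simp: assms)
  ultimately show ?thesis by (simp add: defect_def)
qed

lemma R_slice: "t \<in> {0..1} \<Longrightarrow> continuous_on {0..1} (\<lambda>s. R s t)"
  by (rule continuous_on_slice[OF R_cont])

lemma phi_R_cont: "continuous_on ({0..1} \<times> {0..1}) (\<lambda>(s, t). \<phi> s * R s t)"
proof -
  have "continuous_on ({0..1} \<times> {0..1}) (\<phi> \<circ> fst)"
    by (intro continuous_on_compose continuous_intros) (simp add: \<phi>_cont)
  then have "continuous_on ({0..1} \<times> {0..1}) (\<lambda>x. (\<phi> \<circ> fst) x * (\<lambda>(s, t). R s t) x)"
    by (rule continuous_on_mult[OF _ R_cont])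
  then show ?thesis by (simp add: o_def case_prod_unfold)
qed

lemma smooth_cont: "continuous_on {0..1} smooth"
proof -
  have "continuous_on ({0..1} \<times> cbox 0 1) (\<lambda>(t, s). \<phi> s * R s t)"
  proof -
    have "continuous_on ({0..1} \<times> {0..1}) ((\<lambda>(s, t). \<phi> s * R s t) \<circ> prod.swap)"
      by (intro continuous_on_compose continuous_on_swap continuous_on_subset[OF phi_R_cont]) auto
    then show ?thesis by (simp add: o_def case_prod_unfold)
  qed
  from integral_continuous_on_param[OF this] show ?thesis by (simp add: smooth_def[abs_def])
qed

lemma resid_eq: "resid t = smooth t - (\<Sum>j<n. w j * R (p j) t)"
  by (simp add: resid_def defect_def smooth_def)

lemma R_slice': "t \<in> {0..1} \<Longrightarrow> continuous_on {0..1} (R t)"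
  using continuous_on_slice(2)[OF R_cont] by simp

lemma resid_cont: "continuous_on {0..1} resid"
  unfolding resid_eq[abs_def]
  using p_mem by (intro continuous_intros smooth_cont R_slice') auto

lemma weights_quad: "quad_form {..<n} w p R = (\<Sum>j<n. w j * smooth (p j))"
proof -
  have "quad_form {..<n} w p R = (\<Sum>j<n. w j * (\<Sum>i<n. w i * R (p i) (p j)))"
    unfolding quad_form_def by (subst sum.swap) (simp add: sum_distrib_left mult_ac)
  then show ?thesis by (simp add: smooth_def interp)
qed

text \<open>Pythagoras: the weights project \<open>\<phi> ds\<close> orthogonally onto the span of
  the point masses at the nodes, so the squared norm of the error is the squared norm of
  \<open>\<phi> ds\<close> minus that of the projection.\<close>

lemma energy_eq: "energy = integral {0..1} (\<lambda>s. \<phi> s * smooth s) - quad_form {..<n} w p R"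
proof -
  have "energy = integral {0..1} (\<lambda>s. \<phi> s * smooth s - (\<Sum>j<n. w j * (\<phi> s * R (p j) s)))"
    unfolding energy_def resid_eq by (simp add: algebra_simps sum_distrib_left)
  also have "\<dots> = integral {0..1} (\<lambda>s. \<phi> s * smooth s) -
      integral {0..1} (\<lambda>s. \<Sum>j<n. w j * (\<phi> s * R (p j) s))"
    using p_mem by (intro Henstock_Kurzweil_Integration.integral_diff integrable_phi_mult smooth_cont integrable_sum
      integrable_on_mult_right R_slice') auto
  also have "integral {0..1} (\<lambda>s. \<Sum>j<n. w j * (\<phi> s * R (p j) s)) =
      (\<Sum>j<n. w j * integral {0..1} (\<lambda>s. \<phi> s * R (p j) s))"
    using p_mem by (subst Henstock_Kurzweil_Integration.integral_sum)
      (auto intro!: integrable_on_mult_right integrable_phi_mult R_slice')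
  also have "\<dots> = (\<Sum>j<n. w j * smooth (p j))"
    unfolding smooth_def using p_mem R_sym
    by (intro sum.cong refl arg_cong2[where f = "(*)"] Henstock_Kurzweil_Integration.integral_cong) auto
  finally show ?thesis by (simp add: weights_quad)
qed

text \<open>The inner sum is replaced by \<open>smooth\<close> with an error that is uniform over
  the grid; as \<open>\<phi>\<close> is bounded, what remains is an ordinary Riemann sum of
  \<open>\<phi>\<close> times \<open>smooth\<close>.\<close>

lemma riemann_quad_lim:
  defines "c \<equiv> \<lambda>N i. 1 / real N * \<phi> (real i / real N)"
  shows "(\<lambda>N. \<Sum>i<N. \<Sum>j<N. c N i * c N j * R (real i / real N) (real j / real N))
    \<longlonglongrightarrow> integral {0..1} (\<lambda>s. \<phi> s * smooth s)"
proof -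
  obtain B where B: "B > 0" "\<And>s. s \<in> {0..1} \<Longrightarrow> \<bar>\<phi> s\<bar> \<le> B"
    using compact_bound[OF compact_Icc \<phi>_cont] by blast
  define S1 where "S1 N = (\<Sum>j<N. c N j * (\<Sum>i<N. c N i * R (real i / real N) (real j / real N)))" for N
  define S2 where "S2 N = (\<Sum>j<N. 1 / real N * (\<phi> (real j / real N) * smooth (real j / real N)))" for N
  have lim2: "S2 \<longlonglongrightarrow> integral {0..1} (\<lambda>s. \<phi> s * smooth s)"
    unfolding S2_def by (intro riemann_sum_single continuous_intros \<phi>_cont smooth_cont)
  have "(\<lambda>N. S1 N - S2 N) \<longlonglongrightarrow> 0"
  proof (rule LIMSEQ_I)
    fix e :: real assume e: "e > 0"
    obtain N0 where N0: "N0 > 0" "\<And>N t. N \<ge> N0 \<Longrightarrow> t \<in> {0..1} \<Longrightarrow>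
      \<bar>(\<Sum>i<N. 1 / real N * (\<phi> (real i / real N) * R (real i / real N) t)) - smooth t\<bar> \<le> e / (2 * B)"
      using riemann_sum_uniform[OF phi_R_cont, of "e / (2 * B)"] e B(1) unfolding smooth_def by auto
    have "norm (S1 N - S2 N - 0) < e" if N: "N \<ge> N0" for N
    proof -
      have mem: "real j / real N \<in> {0..1}" if "j < N" for j using that by (auto simp: field_simps)
      have "\<bar>S1 N - S2 N\<bar> = \<bar>\<Sum>j<N. c N j *
        ((\<Sum>i<N. 1 / real N * (\<phi> (real i / real N) * R (real i / real N) (real j / real N))) - smooth (real j / real N))\<bar>"
        unfolding S1_def S2_def c_def
        by (simp add: sum_subtractf[symmetric] right_diff_distrib mult.assoc)
      also have "\<dots> \<le> (\<Sum>j<N. \<bar>c N j\<bar> * (e / (2 * B)))"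
        by (intro order_trans[OF sum_abs] sum_mono, unfold abs_mult)
          (intro mult_left_mono N0(2) N mem abs_ge_zero, auto)
      also have "\<dots> \<le> (\<Sum>j<N. (1 / real N * B) * (e / (2 * B)))"
        using e B mem by (intro sum_mono mult_right_mono) (auto simp: c_def abs_mult intro!: divide_right_mono)
      also have "\<dots> = e / 2" using N N0(1) B(1) by (simp add: field_simps)
      finally show ?thesis using e by simp
    qed
    then show "\<exists>N0. \<forall>N\<ge>N0. norm (S1 N - S2 N - 0) < e" by blast
  qed
  from tendsto_add[OF this lim2] have "S1 \<longlonglongrightarrow> integral {0..1} (\<lambda>s. \<phi> s * smooth s)" by simp
  moreover have "(\<Sum>i<N. \<Sum>j<N. c N i * c N j * R (real i / real N) (real j / real N)) = S1 N" for N
    unfolding S1_def by (subst sum.swap) (simp add: sum_distrib_left mult_ac)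
  ultimately show ?thesis by simp
qed

text \<open>Replacing \<open>\<phi> ds\<close> by point masses on a grid turns the defect into a
  finite combination of evaluations, to which the ball inequality applies. The combinations and
  their quadratic forms both converge, so the inequality survives in the limit.\<close>

lemma defect_in_rk_ball:
  assumes q: "in_rk_ball R B q"
  shows "\<bar>defect q\<bar> \<le> B * sqrt energy"
proof -
  note qc = continuous_on_in_rk_ball[OF R_cont q]
  define c where "c = (\<lambda>N i. 1 / real N * \<phi> (real i / real N))"
  \<comment> \<open>Left indices carry the grid points, right indices the nodes; this is why
    \<open>in_rk_ball\<close> is tested over subsets of \<open>nat + nat\<close>.\<close>
  define I :: "nat \<Rightarrow> (nat + nat) set" where "I N = {..<N} <+> {..<n}" for N
  define C where "C N = case_sum (c N) (\<lambda>j. - w j)" for N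
  define S where "S N = case_sum (\<lambda>i. real i / real N) p" for N :: nat
  have fin: "finite (I N)" for N by (simp add: I_def)
  have sum_I: "(\<Sum>i\<in>I N. f i) = (\<Sum>i<N. f (Inl i)) + (\<Sum>j<n. f (Inr j))" for N and f :: "nat + nat \<Rightarrow> real"
    unfolding I_def by (subst sum.Plus) (auto simp: o_def)
  have SI: "S N ` I N \<subseteq> {0..1}" for N
    using p_mem by (auto simp: I_def S_def field_simps)
  have "(\<lambda>N. \<Sum>i\<in>I N. C N i * q (S N i)) \<longlonglongrightarrow> defect q"
  proof -
    have "(\<lambda>N. (\<Sum>i<N. 1 / real N * (\<phi> (real i / real N) * q (real i / real N))) - (\<Sum>j<n. w j * q (p j)))
      \<longlonglongrightarrow> defect q"
      unfolding defect_def by (intro tendsto_intros riemann_sum_single continuous_intros \<phi>_cont qc)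
    then show ?thesis by (simp add: sum_I C_def S_def c_def sum_negf mult.assoc)
  qed
  then have 1: "(\<lambda>N. \<bar>\<Sum>i\<in>I N. C N i * q (S N i)\<bar>) \<longlonglongrightarrow> \<bar>defect q\<bar>"
    by (rule tendsto_rabs)
  have "(\<lambda>N. quad_form (I N) (C N) (S N) R) \<longlonglongrightarrow> energy"
  proof -
    \<comment> \<open>The square of grid part minus node part is expanded; the two mixed sums
      coincide by symmetry of \<open>R\<close>.\<close>
    have eq: "quad_form (I N) (C N) (S N) R =
      (\<Sum>i<N. \<Sum>j<N. c N i * c N j * R (real i / real N) (real j / real N))
      - 2 * (\<Sum>j<n. w j * (\<Sum>i<N. 1 / real N * (\<phi> (real i / real N) * R (real i / real N) (p j))))
      + quad_form {..<n} w p R" for N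
    proof -
      have mem: "real j / real N \<in> {0..1}" if "j < N" for j using that by (auto simp: field_simps)
      have a: "(\<Sum>i<N. \<Sum>j<n. c N i * w j * R (real i / real N) (p j)) =
          (\<Sum>j<n. w j * (\<Sum>i<N. c N i * R (real i / real N) (p j)))"
        by (subst sum.swap) (simp add: sum_distrib_left mult_ac)
      have "(\<Sum>i<n. \<Sum>j<N. w i * c N j * R (p i) (real j / real N)) =
          (\<Sum>i<n. \<Sum>j<N. w i * c N j * R (real j / real N) (p i))"
        using mem p_mem by (intro sum.cong refl arg_cong2[where f = "(*)"] R_sym) auto
      also have "\<dots> = (\<Sum>j<n. w j * (\<Sum>i<N. c N i * R (real i / real N) (p j)))"
        by (simp add: sum_distrib_left mult_ac)
      finally have b: "(\<Sum>i<n. \<Sum>j<N. w i * c N j * R (p i) (real j / real N)) =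
          (\<Sum>j<n. w j * (\<Sum>i<N. c N i * R (real i / real N) (p j)))" .
      have "quad_form (I N) (C N) (S N) R =
         (\<Sum>i<N. \<Sum>j<N. c N i * c N j * R (real i / real N) (real j / real N))
         - (\<Sum>i<N. \<Sum>j<n. c N i * w j * R (real i / real N) (p j))
         - (\<Sum>i<n. \<Sum>j<N. w i * c N j * R (p i) (real j / real N)) + quad_form {..<n} w p R"
        unfolding quad_form_def by (simp add: sum_I C_def S_def sum.distrib sum_negf sum_subtractf)
      then show ?thesis unfolding a b by (simp add: c_def mult.assoc)
    qed
    have sm: "(\<lambda>N. \<Sum>i<N. 1 / real N * (\<phi> (real i / real N) * R (real i / real N) (p j)))
        \<longlonglongrightarrow> smooth (p j)" if "j < n" for j
      unfolding smooth_def
      by (intro riemann_sum_single continuous_intros \<phi>_cont R_slice p_mem that)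
    have "(\<lambda>N. quad_form (I N) (C N) (S N) R) \<longlonglongrightarrow> integral {0..1} (\<lambda>s. \<phi> s * smooth s)
       - 2 * (\<Sum>j<n. w j * smooth (p j)) + quad_form {..<n} w p R"
      unfolding eq unfolding c_def
      by (intro tendsto_intros riemann_quad_lim sm) auto
    \<comment> \<open>By \<open>weights_quad\<close> the mixed limit is twice the node form, which
      leaves the integral minus one node form, hence the energy.\<close>
    then show ?thesis by (simp add: energy_eq weights_quad)
  qed
  then have 2: "(\<lambda>N. B * sqrt (quad_form (I N) (C N) (S N) R)) \<longlonglongrightarrow> B * sqrt energy"
    by (intro tendsto_intros)
  show ?thesis
    by (rule LIMSEQ_le[OF 1 2]) (use in_rk_ballD[OF q fin SI] in blast)
qed

end

section \<open>Tent functions and kinked kernels\<close>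

definition tent :: "real \<Rightarrow> real \<Rightarrow> real \<Rightarrow> real \<Rightarrow> real" where
  "tent a b c t = (if t \<le> a \<or> c \<le> t then 0 else if t \<le> b then (t - a) / (b - a) else (c - t) / (c - b))"

text \<open>The difference of the slopes on the two sides of \<open>b\<close>. It is
  \<open>c - a\<close> times the usual second divided difference, a scaling for which the Peano
  kernel is the tent of height 1.\<close>

definition second_diff :: "(real \<Rightarrow> real) \<Rightarrow> real \<Rightarrow> real \<Rightarrow> real \<Rightarrow> real" where
  "second_diff r a b c = (r c - r b) / (c - b) - (r b - r a) / (b - a)"

lemma tent_bounds:
  assumes "a < b" "b < c"
  shows "0 \<le> tent a b c t" "tent a b c t \<le> 1"
  using assms by (auto simp: tent_def field_simps)

text \<open>The second derivative of the ramp is a unit mass at \<open>s\<close>, so its second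
  difference is the Peano kernel evaluated at \<open>s\<close>.\<close>

lemma second_diff_ramp:
  assumes "a < b" "b < c"
  shows "second_diff (\<lambda>t. max 0 (t - s)) a b c = tent a b c s"
proof -
  have nz: "b - a \<noteq> 0" "c - b \<noteq> 0" using assms by auto
  consider "s \<le> a" | "a < s" "s \<le> b" | "b < s" "s < c" | "c \<le> s" by linarith
  then show ?thesis
  proof cases
    case 1
    then show ?thesis using assms by (simp add: second_diff_def tent_def max_def)
  next
    case 2
    then have "second_diff (\<lambda>t. max 0 (t - s)) a b c = (c - b) / (c - b) - (b - s) / (b - a)"
      using assms by (simp add: second_diff_def max_def)
    also have "\<dots> = ((b - a) - (b - s)) / (b - a)"
      using nz diff_divide_distrib[of "b - a" "b - s" "b - a"] by simp
    finally show ?thesis using 2 assms by (simp add: tent_def)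
  next
    case 3
    then show ?thesis using assms by (simp add: second_diff_def tent_def max_def)
  next
    case 4
    then show ?thesis using assms by (simp add: second_diff_def tent_def max_def)
  qed
qed

lemma second_diff_add_cmult:
  "second_diff (\<lambda>t. r t + k * l t) a b c = second_diff r a b c + k * second_diff l a b c"
  by (simp add: second_diff_def diff_divide_distrib add_divide_distrib algebra_simps)

text \<open>Integration by parts on each side of \<open>b\<close>. Finitely many exceptional points
  are harmless because \<open>r\<close> and \<open>r1\<close> are continuous across them.\<close>

lemma tent_integral_smooth:
  fixes r r1 r2 :: "real \<Rightarrow> real"
  assumes abc: "a < b" "b < c" and S: "finite S"
    and r: "continuous_on {a..c} r" and r1: "continuous_on {a..c} r1"
    and dr: "\<And>t. t \<in> {a<..<c} - S \<Longrightarrow> (r has_real_derivative r1 t) (at t)"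
    and dr1: "\<And>t. t \<in> {a<..<c} - S \<Longrightarrow> (r1 has_real_derivative r2 t) (at t)"
  shows "((\<lambda>t. r2 t * tent a b c t) has_integral second_diff r a b c) {a..c}"
proof -
  \<comment> \<open>\<open>F1\<close> and \<open>F2\<close> are primitives of \<open>r2\<close>
    times the rising and the falling edge of the tent. In the sum of their increments the terms with
    \<open>r1 b\<close> cancel, while \<open>r1 a\<close> and \<open>r1 c\<close> carry the factor
    0.\<close>
  define F1 where "F1 t = ((t - a) * r1 t - r t) / (b - a)" for t
  define F2 where "F2 t = ((c - t) * r1 t + r t) / (c - b)" for t
  have "((\<lambda>t. r2 t * ((t - a) / (b - a))) has_integral (F1 b - F1 a)) {a..b}"
  proof (rule fundamental_theorem_of_calculus_interior_strong[OF S])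
    show "continuous_on {a..b} F1" unfolding F1_def
      using abc by (intro continuous_intros continuous_on_subset[OF r] continuous_on_subset[OF r1]) auto
    fix t assume t: "t \<in> {a<..<b} - S"
    then have t': "t \<in> {a<..<c} - S" using abc by auto
    have "((\<lambda>t. (t - a) * r1 t - r t) has_real_derivative (r2 t * (t - a))) (at t)"
      by (auto intro!: derivative_eq_intros dr[OF t'] dr1[OF t'] simp: algebra_simps)
    from DERIV_cdivide[OF this, of "b - a"] have "(F1 has_real_derivative (r2 t * ((t - a) / (b - a)))) (at t)"
      by (simp add: F1_def[abs_def])
    then show "(F1 has_vector_derivative (r2 t * ((t - a) / (b - a)))) (at t)"
      by (simp add: has_real_derivative_iff_has_vector_derivative)
  qed (use abc in auto)
  then have 1: "((\<lambda>t. r2 t * tent a b c t) has_integral (F1 b - F1 a)) {a..b}"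
    using abc by (elim has_integral_eq[rotated]) (auto simp: tent_def)
  have "((\<lambda>t. r2 t * ((c - t) / (c - b))) has_integral (F2 c - F2 b)) {b..c}"
  proof (rule fundamental_theorem_of_calculus_interior_strong[OF S])
    show "continuous_on {b..c} F2" unfolding F2_def
      using abc by (intro continuous_intros continuous_on_subset[OF r] continuous_on_subset[OF r1]) auto
    fix t assume t: "t \<in> {b<..<c} - S"
    then have t': "t \<in> {a<..<c} - S" using abc by auto
    have "((\<lambda>t. (c - t) * r1 t + r t) has_real_derivative (r2 t * (c - t))) (at t)"
      by (auto intro!: derivative_eq_intros dr[OF t'] dr1[OF t'] simp: algebra_simps)
    from DERIV_cdivide[OF this, of "c - b"] have "(F2 has_real_derivative (r2 t * ((c - t) / (c - b)))) (at t)"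
      by (simp add: F2_def[abs_def])
    then show "(F2 has_vector_derivative (r2 t * ((c - t) / (c - b)))) (at t)"
      by (simp add: has_real_derivative_iff_has_vector_derivative)
  qed (use abc in auto)
  then have 2: "((\<lambda>t. r2 t * tent a b c t) has_integral (F2 c - F2 b)) {b..c}"
    using abc by (elim has_integral_eq[rotated]) (auto simp: tent_def)
  have "((\<lambda>t. r2 t * tent a b c t) has_integral ((F1 b - F1 a) + (F2 c - F2 b))) {a..c}"
    using abc by (intro has_integral_combine[OF _ _ 1 2]) auto
  moreover have "(F1 b - F1 a) + (F2 c - F2 b) = second_diff r a b c"
    using abc unfolding F1_def F2_def second_diff_def
    by (simp add: diff_divide_distrib add_divide_distrib)
  ultimately show ?thesis by simp
qed

text \<open>Adding the ramp \<open>\<kappa> (t - s)\<^sup>+\<close> removes the kink of \<open>r\<close> at \<open>s\<close>. If \<open>s\<close> is an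
  end point there is no kink and \<open>\<kappa>\<close> is arbitrary.\<close>

lemma tent_integral_kink:
  fixes r d r2 :: "real \<Rightarrow> real"
  assumes abc: "0 \<le> a" "a < b" "b < c" "c \<le> 1" and s: "s \<in> {0..1}"
    and r: "continuous_on {0..1} r"
    and d: "\<And>t. t \<in> {0..1} \<Longrightarrow> t \<noteq> s \<Longrightarrow> (d \<longlongrightarrow> d t) (at t within {0..1})"
    and dr: "\<And>t. t \<in> {0<..<1} \<Longrightarrow> t \<noteq> s \<Longrightarrow> (r has_real_derivative d t) (at t)"
    and dd: "\<And>t. t \<in> {0<..<1} \<Longrightarrow> t \<noteq> s \<Longrightarrow> (d has_real_derivative r2 t) (at t)"
    and left: "s > 0 \<Longrightarrow> (d \<longlongrightarrow> dl) (at_left s)"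
    and right: "s < 1 \<Longrightarrow> (d \<longlongrightarrow> dr) (at_right s)"
    and kink: "s \<in> {0<..<1} \<Longrightarrow> \<kappa> = dl - dr"
  shows "((\<lambda>t. r2 t * tent a b c t) has_integral (second_diff r a b c + \<kappa> * tent a b c s)) {a..c}"
proof -
  define r' where "r' t = r t + \<kappa> * max 0 (t - s)" for t
  \<comment> \<open>\<open>d'\<close> is the derivative of \<open>r'\<close> extended continuously
    to \<open>s\<close>: by the left limit if \<open>s\<close> has points on its left, otherwise by
    the corrected right limit. At an interior \<open>s\<close> the two agree because of the choice
    of \<open>\<kappa>\<close>.\<close>
  define d' where "d' t = (if t < s then d t else if t > s then d t + \<kappa> else if s > 0 then dl else dr + \<kappa>)" for t
  have ev_l: "\<forall>\<^sub>F u in nhds t. u < s" if "t < s" for t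
    using that by (intro eventually_nhds_in_open[of "{..<s}", simplified]) auto
  have ev_r: "\<forall>\<^sub>F u in nhds t. u > s" if "t > s" for t
    using that by (intro eventually_nhds_in_open[of "{s<..}", simplified]) auto
  have left': "(d' \<longlongrightarrow> d' s) (at_left s)" if "s > 0"
  proof (rule Lim_transform_eventually)
    show "(d \<longlongrightarrow> d' s) (at_left s)" using left that by (simp add: d'_def)
    show "\<forall>\<^sub>F x in at_left s. d x = d' x" by (auto simp: eventually_at_filter d'_def)
  qed
  have right': "(d' \<longlongrightarrow> d' s) (at_right s)" if "s < 1"
  proof (rule Lim_transform_eventually)
    have "d' s = dr + \<kappa>" using that s kink by (auto simp: d'_def)
    then show "((\<lambda>x. d x + \<kappa>) \<longlongrightarrow> d' s) (at_right s)"
      using tendsto_add[OF right[OF that] tendsto_const[of \<kappa>]] by simp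
    show "\<forall>\<^sub>F x in at_right s. d x + \<kappa> = d' x" by (auto simp: eventually_at_filter d'_def)
  qed
  have d'_cont: "continuous_on {0..1} d'"
    unfolding continuous_on_def
  proof
    fix t :: real assume t: "t \<in> {0..1}"
    consider "t < s" | "t > s" | "t = s" by linarith
    then show "(d' \<longlongrightarrow> d' t) (at t within {0..1})"
    proof cases
      case 1
      have "\<forall>\<^sub>F u in at t within {0..1}. d u = d' u"
        using ev_l[OF 1] by (auto simp: eventually_at_filter d'_def elim!: eventually_mono)
      then show ?thesis using d[of t] t 1 by (auto simp: d'_def intro: Lim_transform_eventually)
    next
      case 2
      have "\<forall>\<^sub>F u in at t within {0..1}. d u + \<kappa> = d' u"
        using ev_r[OF 2] by (auto simp: eventually_at_filter d'_def elim!: eventually_mono)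
      moreover have "((\<lambda>u. d u + \<kappa>) \<longlongrightarrow> d' t) (at t within {0..1})"
        using tendsto_add[OF d[of t] tendsto_const[of \<kappa>]] t 2 by (simp add: d'_def)
      ultimately show ?thesis by (auto intro: Lim_transform_eventually)
    next
      case 3
      consider "s = 0" | "s = 1" | "0 < s" "s < 1" using s by force
      then show ?thesis
      proof cases
        case 1
        then show ?thesis using right' 3 by (simp add: at_within_Icc_at_right)
      next
        case 2
        then show ?thesis using left' 3 by (simp add: at_within_Icc_at_left)
      next
        case both: 3
        then have "(d' \<longlongrightarrow> d' s) (at s)" using left' right' by (simp add: filterlim_at_split)
        then show ?thesis using 3 by (auto intro: tendsto_within_subset)
      qed
    qed
  qed
  have r'_cont: "continuous_on {0..1} r'"
    unfolding r'_def by (intro continuous_intros r)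
  have "((\<lambda>t. r2 t * tent a b c t) has_integral second_diff r' a b c) {a..c}"
  proof (rule tent_integral_smooth[where S = "{s}"])
    fix t assume "t \<in> {a<..<c} - {s}"
    then have t: "t \<in> {0<..<1}" "t \<noteq> s" using abc by auto
    show "(r' has_real_derivative d' t) (at t)"
    proof (cases "t < s")
      case True
      have "(r' has_real_derivative d t) (at t) \<longleftrightarrow> (r has_real_derivative d t) (at t)"
        by (rule DERIV_cong_ev) (auto simp: r'_def max_def intro!: eventually_mono[OF ev_l[OF True]])
      then show ?thesis using dr t True by (simp add: d'_def)
    next
      case False
      then have ts: "t > s" using t by simp
      have "((\<lambda>u. r u + \<kappa> * (u - s)) has_real_derivative (d t + \<kappa>)) (at t)"
        by (auto intro!: derivative_eq_intros dr t)
      moreover have "(r' has_real_derivative (d t + \<kappa>)) (at t) \<longleftrightarrow>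
          ((\<lambda>u. r u + \<kappa> * (u - s)) has_real_derivative (d t + \<kappa>)) (at t)"
        by (rule DERIV_cong_ev) (auto simp: r'_def max_def intro!: eventually_mono[OF ev_r[OF ts]])
      ultimately show ?thesis using ts by (simp add: d'_def)
    qed
    show "(d' has_real_derivative r2 t) (at t)"
    proof (cases "t < s")
      case True
      have "(d' has_real_derivative r2 t) (at t) \<longleftrightarrow> (d has_real_derivative r2 t) (at t)"
        by (rule DERIV_cong_ev) (auto simp: d'_def intro!: eventually_mono[OF ev_l[OF True]])
      then show ?thesis using dd t by simp
    next
      case False
      then have ts: "t > s" using t by simp
      have "((\<lambda>u. d u + \<kappa>) has_real_derivative r2 t) (at t)"
        by (auto intro!: derivative_eq_intros dd t)
      moreover have "(d' has_real_derivative r2 t) (at t) \<longleftrightarrow>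
          ((\<lambda>u. d u + \<kappa>) has_real_derivative r2 t) (at t)"
        by (rule DERIV_cong_ev) (auto simp: d'_def intro!: eventually_mono[OF ev_r[OF ts]])
      ultimately show ?thesis by simp
    qed
  qed (use abc in \<open>auto intro: continuous_on_subset[OF r'_cont] continuous_on_subset[OF d'_cont]\<close>)
  then show ?thesis
    unfolding r'_def[abs_def] using abc by (simp add: second_diff_add_cmult second_diff_ramp)
qed

section \<open>Kernel sections under assumption (A)\<close>

lemma at_within_Icc_delete: "t \<noteq> s \<Longrightarrow> at t within ({0..1} - {s}) = at t within {0..1::real}"
  by (rule at_within_nhd[of t "- {s}"]) auto

lemma off_diag_slice:
  assumes "continuous_on off_diag (\<lambda>(s, t). Q s t)" "s \<in> {0..1}" "t \<in> {0..1}" "t \<noteq> s"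
  shows "((\<lambda>u. Q s u) \<longlongrightarrow> Q s t) (at t within {0..1})"
proof -
  have "continuous_on ({0..1} - {s}) ((\<lambda>(s, t). Q s t) \<circ> (\<lambda>t. (s, t)))"
    using assms by (intro continuous_on_compose continuous_intros continuous_on_subset[OF assms(1)])
      (auto simp: off_diag_def)
  then have "((\<lambda>u. Q s u) \<longlongrightarrow> Q s t) (at t within ({0..1} - {s}))"
    using assms by (simp add: continuous_on_def o_def)
  then show ?thesis using assms by (simp add: at_within_Icc_delete)
qed

lemma dsnd_has_derivative:
  assumes "(\<lambda>u. Q s u) differentiable (at t within {0..1})"
  shows "((\<lambda>u. Q s u) has_real_derivative dsnd Q s t) (at t within {0..1})"
  using assms unfolding dsnd_def
  by (simp add: vector_derivative_works has_real_derivative_iff_has_vector_derivative)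

lemma dsnd_has_derivative_interior:
  assumes "(\<lambda>u. Q s u) differentiable (at t within {0..1})" "t \<in> {0<..<1}"
  shows "((\<lambda>u. Q s u) has_real_derivative dsnd Q s t) (at t)"
proof -
  have "at t within {0..1} = at t" using assms(2) by (intro at_within_Icc_at) auto
  then show ?thesis using dsnd_has_derivative[of Q s t] assms(1) by simp
qed

lemma dsnd_right_off_diag:
  assumes "continuous_on off_diag (\<lambda>(s, t). (dsnd ^^ l) R s t)" "s \<in> {0..1}" "t \<in> {0..<1}" "t \<noteq> s"
  shows "dsnd_right l R s t = (dsnd ^^ l) R s t"
proof -
  have "((\<lambda>u. (dsnd ^^ l) R s u) \<longlongrightarrow> (dsnd ^^ l) R s t) (at t within {0..1})"
    using assms by (intro off_diag_slice[OF assms(1)]) auto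
  then have "((\<lambda>u. (dsnd ^^ l) R s u) \<longlongrightarrow> (dsnd ^^ l) R s t) (at t within {t..1})"
    by (rule tendsto_within_subset) (use assms in auto)
  then have "((\<lambda>u. (dsnd ^^ l) R s u) \<longlongrightarrow> (dsnd ^^ l) R s t) (at_right t)"
    using assms by (simp add: at_within_Icc_at_right)
  then show ?thesis unfolding dsnd_right_def by (intro tendsto_Lim) auto
qed

text \<open>The first argument \<open>s\<close> is fixed and the second one moves, so the only kink
  is at \<open>s\<close> and the slope drops there by \<open>jump R s\<close>. For fixed
  \<open>t\<close> the integrand is, as a function of \<open>s\<close>, a multiple of the element of
  which (C) speaks. At \<open>s = 0\<close> and \<open>s = 1\<close>, where \<open>jump R s\<close>
  is uncontrolled, the tent vanishes.\<close>

lemma assumption_A_tent_integral: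
  assumes A: "assumption_A R" and s: "s \<in> {0..1}" and abc: "0 \<le> a" "a < b" "b < c" "c \<le> 1"
  shows "((\<lambda>t. dsnd2_right R t s * tent a b c t) has_integral
    (second_diff (R s) a b c + jump R s * tent a b c s)) {a..c}"
proof -
  have RC: "continuous_on ({0..1} \<times> {0..1}) (\<lambda>(s, t). R s t)" and dl: "diag_limits 1 R"
    and ck: "Ck_off_diag 2 R" using A by (auto simp: assumption_A_def)
  have R1: "\<And>t. t \<in> {0..1} \<Longrightarrow> t \<noteq> s \<Longrightarrow> (\<lambda>u. R s u) differentiable (at t within {0..1})"
    and C1: "continuous_on off_diag (\<lambda>(s, t). dsnd R s t)"
    and R2: "\<And>t. t \<in> {0..1} \<Longrightarrow> t \<noteq> s \<Longrightarrow> (\<lambda>u. dsnd R s u) differentiable (at t within {0..1})"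
    and C2: "continuous_on off_diag (\<lambda>(s, t). dsnd (dsnd R) s t)"
    using ck s unfolding numeral_2_eq_2 by (auto simp: off_diag_def)
  have Ll: "\<forall>t\<in>{0<..1}. \<exists>a. ((\<lambda>u. dsnd R t u) \<longlongrightarrow> a) (at_left t)"
    and Lr: "\<forall>t\<in>{0..<1}. \<exists>a. ((\<lambda>u. dsnd R t u) \<longlongrightarrow> a) (at_right t)"
    using dl by (simp_all add: diag_limits_def)
  show ?thesis
  proof (rule tent_integral_kink[OF abc s])
    show "continuous_on {0..1} (R s)" using continuous_on_slice(2)[OF RC s] by simp
    show "(dsnd R s \<longlongrightarrow> dsnd R s t) (at t within {0..1})" if "t \<in> {0..1}" "t \<noteq> s" for t
      using off_diag_slice[OF C1 s] that by simp
    show "(R s has_real_derivative dsnd R s t) (at t)" if "t \<in> {0<..<1}" "t \<noteq> s" for t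
      using dsnd_has_derivative_interior[of R s t] R1[of t] that by simp
    show "(dsnd R s has_real_derivative dsnd2_right R t s) (at t)" if "t \<in> {0<..<1}" "t \<noteq> s" for t
    proof -
      have "dsnd2_right R t s = dsnd (dsnd R) s t"
        using dsnd_right_off_diag[of 2 R s t] C2 s that
        by (simp add: dsnd2_right_def ext_zero_def numeral_2_eq_2)
      then show ?thesis
        using dsnd_has_derivative_interior[of "dsnd R" s t] R2[of t] that by simp
    qed
    show "(dsnd R s \<longlongrightarrow> dsnd_left 1 R s s) (at_left s)" if s0: "s > 0"
    proof -
      obtain l where "((\<lambda>u. dsnd R s u) \<longlongrightarrow> l) (at_left s)"
        using bspec[OF Ll, of s] s s0 by auto
      moreover from this have "dsnd_left 1 R s s = l"
        unfolding dsnd_left_def by (intro tendsto_Lim) auto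
      ultimately show ?thesis by simp
    qed
    show "(dsnd R s \<longlongrightarrow> dsnd_right 1 R s s) (at_right s)" if s1: "s < 1"
    proof -
      obtain l where "((\<lambda>u. dsnd R s u) \<longlongrightarrow> l) (at_right s)"
        using bspec[OF Lr, of s] s s1 by auto
      moreover from this have "dsnd_right 1 R s s = l"
        unfolding dsnd_right_def by (intro tendsto_Lim) auto
      ultimately show ?thesis by simp
    qed
  qed (simp add: jump_def)
qed

section \<open>Norm bounds in the reproducing kernel Hilbert space as bounds on finite combinations
  of evaluations\<close>

lemma inner_product_on_Cauchy_Schwarz:
  assumes H: "function_space_on A H" and ip: "inner_product_on H ip" and k: "k \<in> H" and l: "l \<in> H"
  shows "\<bar>ip k l\<bar> \<le> sqrt (ip k k) * sqrt (ip l l)"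
proof -
  have cl: "(\<lambda>s. c * l s) \<in> H" for c using H l by (auto simp: function_space_on_def)
  have add: "ip (\<lambda>s. f s + g s) m = ip f m + ip g m" if "f \<in> H" "g \<in> H" "m \<in> H" for f g m
    using ip that by (auto simp: inner_product_on_def)
  have sym: "ip f g = ip g f" if "f \<in> H" "g \<in> H" for f g
    using ip that by (auto simp: inner_product_on_def)
  have sc: "ip (\<lambda>s. c * f s) g = c * ip f g" if "f \<in> H" "g \<in> H" for c f g
    using ip that by (auto simp: inner_product_on_def)
  have pos: "0 \<le> ip f f" if "f \<in> H" for f using ip that by (auto simp: inner_product_on_def)
  have quad: "0 \<le> ip k k + 2 * c * ip k l + c\<^sup>2 * ip l l" for c
  proof -
    have m: "(\<lambda>s. k s + c * l s) \<in> H" using H k cl[of c] by (auto simp: function_space_on_def)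
    have "ip (\<lambda>s. k s + c * l s) (\<lambda>s. k s + c * l s) =
        ip (\<lambda>s. k s + c * l s) k + c * ip (\<lambda>s. k s + c * l s) l"
      by (simp add: add[OF k cl m] sc[OF l m] sym[OF k m] sym[OF l m])
    also have "\<dots> = ip k k + 2 * c * ip k l + c\<^sup>2 * ip l l"
      by (simp add: add[OF k cl k] add[OF k cl l] sc[OF l k] sc[OF l l] sym[OF l k] algebra_simps power2_eq_square)
    finally show ?thesis using pos[OF m] by simp
  qed
  have "(ip k l)\<^sup>2 \<le> ip k k * ip l l"
  proof (cases "ip l l = 0")
    case True
    then have "l = (\<lambda>s. 0)" using ip l by (auto simp: inner_product_on_def)
    then have "l = (\<lambda>s. 0 * k s)" by simp
    then have "ip l k = 0" using sc[OF k k, of 0] by simp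
    then show ?thesis using True sym[OF k l] by simp
  next
    case False
    then have p: "ip l l > 0" using pos[OF l] by simp
    have "0 \<le> ip k k - (ip k l)\<^sup>2 / ip l l"
      using quad[of "- ip k l / ip l l"] p by (simp add: power2_eq_square field_simps)
    then show ?thesis using p by (simp add: field_simps)
  qed
  then have "sqrt ((ip k l)\<^sup>2) \<le> sqrt (ip k k * ip l l)" by (rule real_sqrt_le_mono)
  then show ?thesis by (simp add: real_sqrt_mult)
qed

text \<open>By the reproducing property a combination of evaluations of \<open>k\<close> is the
  inner product of \<open>k\<close> with the same combination \<open>v\<close> of kernel sections,
  and the squared norm of \<open>v\<close> is the quadratic form. Cauchy-Schwarz concludes.\<close>

lemma rkhs_in_rk_ball:
  assumes rk: "is_rkhs {0..1} R H ip" and k: "k \<in> H" and B: "ip_norm ip k \<le> B"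
  shows "in_rk_ball R B k"
  unfolding in_rk_ball_def
proof (intro allI impI)
  fix I :: "(nat + nat) set" and c s :: "nat + nat \<Rightarrow> real"
  assume fin: "finite I" and s: "s ` I \<subseteq> {0..1}"
  have H: "function_space_on {0..1} H" and ip: "inner_product_on H ip"
    using rk by (auto simp: is_rkhs_def)
  define e where "e i = ext_zero {0..1} (\<lambda>u. R u (s i))" for i
  have eH: "e i \<in> H" if "i \<in> I" for i using rk s that by (auto simp: is_rkhs_def e_def)
  have rep: "ip f (e i) = f (s i)" if "i \<in> I" "f \<in> H" for i f
    using rk s that by (auto simp: is_rkhs_def e_def)
  have sym: "ip f g = ip g f" if "f \<in> H" "g \<in> H" for f g
    using ip that by (auto simp: inner_product_on_def)
  have addH: "(\<lambda>u. f u + g u) \<in> H" if "f \<in> H" "g \<in> H" for f g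
    using H that by (simp add: function_space_on_def)
  have add: "ip (\<lambda>s. f s + g s) m = ip f m + ip g m" if "f \<in> H" "g \<in> H" "m \<in> H" for f g m
    using ip that by (simp add: inner_product_on_def)
  have sc: "ip (\<lambda>s. c * f s) g = c * ip f g" if "f \<in> H" "g \<in> H" for c f g
    using ip that by (simp add: inner_product_on_def)
  have *: "(\<lambda>u. \<Sum>i\<in>J. c i * e i u) \<in> H \<and>
      (\<forall>f\<in>H. ip (\<lambda>u. \<Sum>i\<in>J. c i * e i u) f = (\<Sum>i\<in>J. c i * f (s i)))" if "J \<subseteq> I" for J
    using finite_subset[OF that fin] that
  proof (induction J rule: finite_induct)
    case empty
    have z: "(\<lambda>u. 0) \<in> H" using H by (auto simp: function_space_on_def)
    have "ip (\<lambda>u. 0) f = 0" if "f \<in> H" for f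
    proof -
      have "ip (\<lambda>s. 0 * f s) f = 0 * ip f f" by (rule sc[OF that that])
      then show ?thesis by simp
    qed
    then show ?case using z by simp
  next
    case (insert a J)
    have aI: "a \<in> I" and J: "J \<subseteq> I" using insert by auto
    let ?v = "\<lambda>u. \<Sum>i\<in>J. c i * e i u"
    have v: "?v \<in> H" "\<And>f. f \<in> H \<Longrightarrow> ip ?v f = (\<Sum>i\<in>J. c i * f (s i))" using insert.IH[OF J] by auto
    have ce: "(\<lambda>u. c a * e a u) \<in> H" using H eH[OF aI] by (auto simp: function_space_on_def)
    have eq: "(\<lambda>u. \<Sum>i\<in>insert a J. c i * e i u) = (\<lambda>u. c a * e a u + ?v u)"
      using insert by simp
    have "(\<lambda>u. c a * e a u + ?v u) \<in> H" by (rule addH[OF ce v(1)])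
    moreover have "ip (\<lambda>u. c a * e a u + ?v u) f = c a * f (s a) + (\<Sum>i\<in>J. c i * f (s i))"
      if f: "f \<in> H" for f
    proof -
      have "ip (\<lambda>u. c a * e a u + ?v u) f = ip (\<lambda>u. c a * e a u) f + ip ?v f"
        by (rule add[OF ce v(1) f])
      moreover have "ip (\<lambda>u. c a * e a u) f = c a * ip (e a) f"
        by (rule sc[OF eH[OF aI] f])
      moreover have "ip (e a) f = f (s a)" using sym[OF f eH[OF aI]] rep[OF aI f] by simp
      ultimately show ?thesis using v(2)[OF f] by simp
    qed
    ultimately show ?case unfolding eq using insert by simp
  qed
  define v where "v = (\<lambda>u. \<Sum>i\<in>I. c i * e i u)"
  have v: "v \<in> H" "\<And>f. f \<in> H \<Longrightarrow> ip v f = (\<Sum>i\<in>I. c i * f (s i))"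
    using *[of I] by (auto simp: v_def)
  have "ip v v = (\<Sum>i\<in>I. c i * (\<Sum>j\<in>I. c j * R (s i) (s j)))"
    unfolding v(2)[OF v(1)] using s
    by (intro sum.cong refl) (auto simp: v_def e_def ext_zero_def image_subset_iff)
  also have "\<dots> = quad_form I c s R"
    unfolding quad_form_def by (simp add: sum_distrib_left mult.assoc)
  finally have vv: "ip v v = quad_form I c s R" .
  have "\<bar>\<Sum>i\<in>I. c i * k (s i)\<bar> = \<bar>ip k v\<bar>" using v(2)[OF k] sym[OF k v(1)] by simp
  also have "\<dots> \<le> sqrt (ip k k) * sqrt (ip v v)"
    by (rule inner_product_on_Cauchy_Schwarz[OF H ip k v(1)])
  also have "\<dots> \<le> B * sqrt (ip v v)"
    using B ip v(1) by (intro mult_right_mono) (auto simp: ip_norm_def inner_product_on_def)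
  finally show "\<bar>\<Sum>i\<in>I. c i * k (s i)\<bar> \<le> B * sqrt (quad_form I c s R)" by (simp add: vv)
qed

section \<open>Error bounds for kernels with a kink\<close>

lemma integral_bound_support:
  fixes k :: "real \<Rightarrow> real"
  assumes k: "k integrable_on {0..1}" and ac: "0 \<le> a" "a \<le> c" "c \<le> 1"
    and zero: "\<And>s. s \<in> {0..1} - {a..c} \<Longrightarrow> k s = 0"
    and bound: "\<And>s. s \<in> {a..c} \<Longrightarrow> \<bar>k s\<bar> \<le> D"
  shows "\<bar>integral {0..1} k\<bar> \<le> D * (c - a)"
proof -
  have "integral {a..c} k = integral {0..1} k"
  proof (rule integral_spike_set)
    have "{s \<in> {a..c} - {0..1}. k s \<noteq> 0} = {}" "{s \<in> {0..1} - {a..c}. k s \<noteq> 0} = {}"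
      using ac zero by auto
    then show "negligible {s \<in> {a..c} - {0..1}. k s \<noteq> 0}" "negligible {s \<in> {0..1} - {a..c}. k s \<noteq> 0}"
      by (simp_all only: negligible_empty)
  qed
  moreover have "k integrable_on {a..c}" using k ac by (auto intro: integrable_subinterval_real)
  moreover have "D \<ge> 0" using bound[of a] ac by force
  ultimately have "norm (integral {0..1} k) \<le> D * measure lborel {a..c}"
    using bound by (intro has_integral_bound_real[where f = k and a = a and b = c and S = "{}"]) (auto dest: integrable_integral)
  then show ?thesis using ac by simp
qed

text \<open>In the application \<open>\<rho> s t\<close> is the second derivative of
  \<open>R\<close> in its second argument at \<open>(s, t)\<close>, \<open>\<alpha>\<close> the jump
  with bounds \<open>a0\<close> and \<open>A\<close>, \<open>C\<close> the norm bound from (C),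
  \<open>M\<close> the supremum of the smoothing kernel and \<open>\<delta>\<close> a bound on the
  mesh. The fixed interval from \<open>lo\<close> to \<open>hi\<close> contains the support of
  \<open>\<phi>\<close> with a margin of one mesh and avoids the first and the last node.\<close>

locale kinked_quadrature = projection_quadrature R \<phi> n p w
  for R :: "real \<Rightarrow> real \<Rightarrow> real" and \<phi> n p w +
  fixes \<rho> :: "real \<Rightarrow> real \<Rightarrow> real" and \<alpha> :: "real \<Rightarrow> real" and a0 A C M h x lo hi \<delta> :: real
  assumes psd: "\<And>(I :: (nat + nat) set) c s. finite I \<Longrightarrow> s ` I \<subseteq> {0..1} \<Longrightarrow> 0 \<le> quad_form I c s R"
    and tent_int: "\<And>s a b c. s \<in> {0..1} \<Longrightarrow> 0 \<le> a \<Longrightarrow> a < b \<Longrightarrow> b < c \<Longrightarrow> c \<le> 1 \<Longrightarrow>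
      ((\<lambda>t. \<rho> s t * tent a b c t) has_integral (second_diff (R s) a b c + \<alpha> s * tent a b c s)) {a..c}"
    and \<rho>_ball: "\<And>t. t \<in> {0..1} \<Longrightarrow> in_rk_ball R C (\<lambda>s. \<rho> s t)"
    and C_nonneg: "C \<ge> 0"
    and a0: "a0 > 0" and \<alpha>_bounds: "\<And>s. s \<in> {0<..<1} \<Longrightarrow> a0 \<le> \<alpha> s \<and> \<alpha> s \<le> A"
    and h_pos: "h > 0"
    and \<phi>_bound: "\<And>s. s \<in> {0..1} \<Longrightarrow> \<bar>\<phi> s\<bar> \<le> M / h"
    and \<phi>_support: "\<And>s. s \<in> {0..1} \<Longrightarrow> s \<notin> {x - h..x + h} \<Longrightarrow> \<phi> s = 0"
    and p_step: "\<And>i. Suc i < n \<Longrightarrow> p i < p (Suc i) \<and> p (Suc i) \<le> p i + \<delta>"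
    and n_pos: "n > 0" and p_first: "0 < p 0" "p 0 < lo" and p_last: "p (n - 1) = 1"
    and window: "0 < lo" "lo \<le> x - h - \<delta>" "x + h + \<delta> \<le> hi" "hi < 1" and \<delta>_nonneg: "\<delta> \<ge> 0"
begin

lemma p_less: "i < j \<Longrightarrow> j < n \<Longrightarrow> p i < p j"
proof (induction j)
  case (Suc j)
  then show ?case using p_step[of j] by (cases "i = j") auto
qed simp

lemma p_le: "i \<le> j \<Longrightarrow> j < n \<Longrightarrow> p i \<le> p j"
  using p_less[of i j] by (cases "i = j") auto

lemma M_nonneg: "M \<ge> 0"
proof -
  have "0 \<le> M / h" using \<phi>_bound[of 0] by force
  then show ?thesis using h_pos by (simp add: zero_le_divide_iff)
qed

lemma A_nonneg: "A \<ge> 0"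
  using \<alpha>_bounds[of "1/2"] a0 by auto

lemma energy_nonneg: "energy \<ge> 0"
proof -
  have "in_rk_ball R 1 (\<lambda>_. 0)" by (simp add: in_rk_ball_def psd)
  from defect_in_rk_ball[OF this] show ?thesis by (auto simp: defect_def)
qed

lemma locate:
  assumes "p 0 \<le> s" "s < 1"
  obtains i where "Suc i < n" "p i \<le> s" "s < p (Suc i)"
proof -
  define P where "P = (\<lambda>i. i < n \<and> s < p i)"
  have "P (n - 1)" using n_pos p_last assms by (simp add: P_def)
  then have L: "P (LEAST i. P i)" by (rule LeastI)
  obtain i where i: "(LEAST i. P i) = Suc i"
    using L assms by (cases "LEAST i. P i") (auto simp: P_def)
  then have "\<not> P i" using not_less_Least[of i P] by simp
  then show ?thesis using that[of i] L i by (auto simp: P_def)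
qed

text \<open>This function of \<open>s\<close> is the integral over \<open>t\<close> of the ball
  elements \<open>\<rho> s t\<close> against a tent with values between 0 and 1, over an interval of
  length \<open>c - a\<close>. Testing with finite combinations reduces everything to scalar
  integrals, so no Hilbert-space-valued integral occurs.\<close>

lemma second_diff_tent_in_rk_ball:
  assumes abc: "0 \<le> a" "a < b" "b < c" "c \<le> 1"
  shows "in_rk_ball R (C * (c - a)) (\<lambda>s. second_diff (R s) a b c + \<alpha> s * tent a b c s)"
  unfolding in_rk_ball_def
proof (intro allI impI)
  fix I :: "(nat + nat) set" and k s :: "nat + nat \<Rightarrow> real"
  assume fin: "finite I" and s: "s ` I \<subseteq> {0..1}"
  let ?q = "\<lambda>s. second_diff (R s) a b c + \<alpha> s * tent a b c s"
  let ?D = "C * sqrt (quad_form I k s R)"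
  have "((\<lambda>t. \<Sum>i\<in>I. k i * (\<rho> (s i) t * tent a b c t)) has_integral (\<Sum>i\<in>I. k i * ?q (s i))) {a..c}"
    using s by (intro has_integral_sum fin has_integral_mult_right tent_int abc) auto
  moreover have "norm (\<Sum>i\<in>I. k i * (\<rho> (s i) t * tent a b c t)) \<le> ?D" if "t \<in> {a..c}" for t
  proof -
    have "(\<Sum>i\<in>I. k i * (\<rho> (s i) t * tent a b c t)) = (\<Sum>i\<in>I. k i * \<rho> (s i) t) * tent a b c t"
      by (simp add: sum_distrib_right mult.assoc)
    then have "norm (\<Sum>i\<in>I. k i * (\<rho> (s i) t * tent a b c t)) = \<bar>\<Sum>i\<in>I. k i * \<rho> (s i) t\<bar> * tent a b c t"
      using tent_bounds[of a b c t] abc by (simp add: abs_mult)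
    also have "\<dots> \<le> \<bar>\<Sum>i\<in>I. k i * \<rho> (s i) t\<bar>"
      using tent_bounds[of a b c t] abc by (simp add: mult_left_le)
    also have "\<dots> \<le> ?D" using abc that by (intro in_rk_ballD[OF \<rho>_ball fin s]) auto
    finally show ?thesis .
  qed
  moreover have "0 \<le> ?D" using C_nonneg psd[OF fin s] by simp
  ultimately have "norm (\<Sum>i\<in>I. k i * ?q (s i)) \<le> ?D * measure lborel {a..c}"
    by (intro has_integral_bound_real) auto
  then show "\<bar>\<Sum>i\<in>I. k i * ?q (s i)\<bar> \<le> C * (c - a) * sqrt (quad_form I k s R)"
    using abc by (simp add: mult_ac)
qed

lemma second_diff_cont:
  assumes "0 \<le> a" "a < b" "b < c" "c \<le> 1"
  shows "continuous_on {0..1} (\<lambda>s. second_diff (R s) a b c)"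
  unfolding second_diff_def using assms by (intro continuous_intros R_slice) auto

text \<open>The locale assumes no continuity of \<open>\<alpha>\<close>. Continuity of the product
  follows because it is a ball element minus a second difference of kernel sections.\<close>

lemma alpha_tent_cont:
  assumes abc: "0 \<le> a" "a < b" "b < c" "c \<le> 1"
  shows "continuous_on {0..1} (\<lambda>s. \<alpha> s * tent a b c s)"
proof -
  have "continuous_on {0..1} (\<lambda>s. (second_diff (R s) a b c + \<alpha> s * tent a b c s) - second_diff (R s) a b c)"
    by (intro continuous_on_diff second_diff_cont
        continuous_on_in_rk_ball[OF R_cont second_diff_tent_in_rk_ball] abc)
  then show ?thesis by simp
qed

lemma defect_second_diff:
  assumes abc: "0 \<le> a" "a < b" "b < c" "c \<le> 1"
  shows "defect (\<lambda>s. second_diff (R s) a b c) = second_diff resid a b c"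
proof -
  have "defect (\<lambda>s. second_diff (R s) a b c) =
      defect (\<lambda>s. 1 / (c - b) * R s c + (- (1 / (c - b)) * R s b + (- (1 / (b - a)) * R s b + 1 / (b - a) * R s a)))"
    by (rule defect_cong) (simp add: second_diff_def diff_divide_distrib)
  also have "\<dots> = 1 / (c - b) * resid c + (- (1 / (c - b)) * resid b + (- (1 / (b - a)) * resid b + 1 / (b - a) * resid a))"
    using abc by (subst defect_add defect_cmult, force intro!: continuous_intros R_slice, force intro!: continuous_intros R_slice)+
      (simp only: defect_cmult resid_def)
  also have "\<dots> = second_diff resid a b c"
    by (simp add: second_diff_def diff_divide_distrib)
  finally show ?thesis .
qed

text \<open>The key inequality, used in two ways: with the peak between adjacent nodes it bounds
  \<open>resid\<close>, and with three consecutive nodes, where \<open>resid\<close> vanishes, it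
  bounds the defect of \<open>\<alpha>\<close> times a tent.\<close>

lemma defect_alpha_tent:
  assumes abc: "0 \<le> a" "a < b" "b < c" "c \<le> 1"
  shows "\<bar>second_diff resid a b c + defect (\<lambda>s. \<alpha> s * tent a b c s)\<bar> \<le> C * (c - a) * sqrt energy"
  using defect_in_rk_ball[OF second_diff_tent_in_rk_ball[OF abc]]
  by (simp add: defect_add[OF second_diff_cont[OF abc] alpha_tent_cont[OF abc]] defect_second_diff[OF abc])

lemma alpha_tent_bound:
  assumes abc: "0 \<le> a" "a < b" "b < c" "c \<le> 1" and s: "s \<in> {0..1}"
  shows "\<bar>\<alpha> s * tent a b c s\<bar> \<le> A"
proof (cases "s \<in> {0<..<1}")
  case True
  have "\<bar>\<alpha> s * tent a b c s\<bar> = \<alpha> s * tent a b c s"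
    using \<alpha>_bounds[OF True] a0 tent_bounds[of a b c s] abc by (simp add: abs_mult)
  also have "\<dots> \<le> A * 1"
    using \<alpha>_bounds[OF True] a0 tent_bounds[of a b c s] abc by (intro mult_mono) auto
  finally show ?thesis by simp
next
  case False
  then have "tent a b c s = 0" using s abc by (auto simp: tent_def)
  then show ?thesis using A_nonneg by simp
qed

text \<open>Between two adjacent nodes the tent with peak \<open>t\<close> lives on a single cell,
  so its defect is only an integral of size \<open>M * A / h\<close> times the cell length, and the
  second difference of \<open>resid\<close> is a multiple of \<open>resid t\<close>.\<close>

lemma resid_bound:
  assumes t: "p 0 \<le> t" "t \<le> 1"
  shows "\<bar>resid t\<bar> \<le> \<delta>\<^sup>2 * (M * A / h + C * sqrt energy)"
proof -
  have rhs: "0 \<le> M * A / h + C * sqrt energy"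
    using M_nonneg A_nonneg h_pos C_nonneg energy_nonneg by simp
  show ?thesis
  proof (cases "\<exists>i<n. p i = t")
    case True
    then show ?thesis using resid_node rhs by auto
  next
    case False
    then have "t \<noteq> 1" using p_last n_pos by force
    then obtain i where i: "Suc i < n" "p i \<le> t" "t < p (Suc i)" using locate[of t] t by force
    define a b where "a = p i" and "b = p (Suc i)"
    have ab: "0 \<le> a" "a < t" "t < b" "b \<le> 1"
    proof -
      have "p i \<noteq> t" using False Suc_lessD[OF i(1)] by blast
      then show "0 \<le> a" "a < t" "t < b" "b \<le> 1"
        using i p_mem[of i] p_mem[of "Suc i"] by (auto simp: a_def b_def)
    qed
    have ba: "b - a \<le> \<delta>" using p_step[OF i(1)] by (simp add: a_def b_def)
    \<comment> \<open>No node lies strictly between two adjacent ones, so the node sum in the defect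
      disappears.\<close>
    have "tent a t b (p j) = 0" if "j < n" for j
    proof -
      have "p j \<le> a \<or> b \<le> p j"
        using p_le[of j i] p_le[of "Suc i" j] that i by (cases "j \<le> i") (auto simp: a_def b_def)
      then show ?thesis by (auto simp: tent_def)
    qed
    then have d: "defect (\<lambda>s. \<alpha> s * tent a t b s) = integral {0..1} (\<lambda>s. \<phi> s * (\<alpha> s * tent a t b s))"
      by (simp add: defect_def)
    have dD: "\<bar>defect (\<lambda>s. \<alpha> s * tent a t b s)\<bar> \<le> (M / h * A) * (b - a)"
      unfolding d
    proof (rule integral_bound_support)
      show "(\<lambda>s. \<phi> s * (\<alpha> s * tent a t b s)) integrable_on {0..1}"
        by (intro integrable_phi_mult alpha_tent_cont ab)
      show "\<bar>\<phi> s * (\<alpha> s * tent a t b s)\<bar> \<le> M / h * A" if "s \<in> {a..b}" for s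
        unfolding abs_mult[of "\<phi> s"] using that ab M_nonneg h_pos
        by (intro mult_mono \<phi>_bound alpha_tent_bound) auto
    qed (use ab in \<open>auto simp: tent_def\<close>)
    have ra: "resid a = 0" "resid b = 0" using resid_node i by (auto simp: a_def b_def)
    \<comment> \<open>The cell length \<open>b - a\<close> occurs here and in the upper bound and
      cancels; what remains is the product \<open>(t - a) * (b - t)\<close>, at most
      \<open>\<delta>\<close> squared.\<close>
    have sd: "second_diff resid a t b = - resid t * ((b - a) / ((t - a) * (b - t)))"
      using ab unfolding second_diff_def ra by (simp add: field_simps)
    have "\<bar>second_diff resid a t b\<bar> \<le> (M / h * A) * (b - a) + C * (b - a) * sqrt energy"
      using defect_alpha_tent[OF ab] dD by linarith
    moreover have "(M / h * A) * (b - a) + C * (b - a) * sqrt energy = (b - a) * (M * A / h + C * sqrt energy)"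
      by (simp add: algebra_simps)
    moreover have "\<bar>second_diff resid a t b\<bar> = (b - a) * (\<bar>resid t\<bar> / ((t - a) * (b - t)))"
      unfolding sd abs_mult abs_divide using ab by simp
    ultimately have "\<bar>resid t\<bar> / ((t - a) * (b - t)) \<le> M * A / h + C * sqrt energy"
      using ab by (simp add: mult_le_cancel_left_pos del: times_divide_eq_right)
    then have "\<bar>resid t\<bar> \<le> ((t - a) * (b - t)) * (M * A / h + C * sqrt energy)"
      using ab by (simp add: divide_le_eq mult.commute)
    also have "\<dots> \<le> (\<delta> * \<delta>) * (M * A / h + C * sqrt energy)"
      using ab ba rhs by (intro mult_right_mono mult_mono) auto
    finally show ?thesis by (simp add: power2_eq_square)
  qed
qed

text \<open>\<open>\<phi>\<close> is at most \<open>M / h\<close> on an interval of length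
  \<open>2 * h\<close>, so the bandwidth cancels.\<close>

lemma phi_integral_bound:
  assumes k: "continuous_on {0..1} k" and D: "\<And>s. s \<in> {x - h..x + h} \<Longrightarrow> \<bar>k s\<bar> \<le> D"
  shows "\<bar>integral {0..1} (\<lambda>s. \<phi> s * k s)\<bar> \<le> 2 * M * D"
proof -
  have "\<bar>integral {0..1} (\<lambda>s. \<phi> s * k s)\<bar> \<le> (M / h * D) * ((x + h) - (x - h))"
  proof (rule integral_bound_support)
    show "\<bar>\<phi> s * k s\<bar> \<le> M / h * D" if "s \<in> {x - h..x + h}" for s
      unfolding abs_mult using that M_nonneg h_pos window \<delta>_nonneg
      by (intro mult_mono \<phi>_bound D) auto
  qed (use window \<delta>_nonneg h_pos \<phi>_support in \<open>auto intro: integrable_phi_mult k\<close>)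
  then show ?thesis using h_pos by simp
qed

text \<open>The energy is the integral of \<open>resid\<close> against \<open>\<phi>\<close>, and
  the bound for \<open>resid\<close> again contains the energy; \<open>energy_le\<close> resolves
  this self-bounding inequality.\<close>

lemma energy_bound: "energy \<le> 2 * M * (\<delta>\<^sup>2 * (M * A / h + C * sqrt energy))"
proof -
  have "\<bar>energy\<bar> \<le> 2 * M * (\<delta>\<^sup>2 * (M * A / h + C * sqrt energy))"
    unfolding energy_def using window \<delta>_nonneg p_first
    by (intro phi_integral_bound resid_cont) (auto simp: energy_def[symmetric] intro!: resid_bound)
  then show ?thesis by simp
qed

end

section \<open>Interpolation by tents at consecutive nodes\<close>

context kinked_quadrature
begin

text \<open>Meant for inner indices \<open>1, ..., n - 2\<close>, for which both neighbouring nodes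
  exist; no tent sits at the two extreme nodes.\<close>

definition node_tent :: "nat \<Rightarrow> real \<Rightarrow> real" where
  "node_tent i = tent (p (i - 1)) (p i) (p (i + 1))"

lemma inner_node:
  assumes "i \<in> {1..<n - 1}"
  shows "0 \<le> p (i - 1)" "p (i - 1) < p i" "p i < p (i + 1)" "p (i + 1) \<le> 1"
  using assms p_less[of "i - 1" i] p_less[of i "i + 1"] p_mem[of "i - 1"] p_mem[of "i + 1"] by auto

lemma node_tent_node:
  assumes i: "i \<in> {1..<n - 1}" and j: "j < n"
  shows "node_tent i (p j) = (if i = j then 1 else 0)"
proof -
  consider "i = j" | "j \<le> i - 1" "i \<noteq> j" | "i + 1 \<le> j" by linarith
  then show ?thesis
  proof cases
    case 1
    then show ?thesis using inner_node[OF i] by (simp add: node_tent_def tent_def)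
  next
    case 2
    then have "p j \<le> p (i - 1)" using i by (intro p_le) auto
    then show ?thesis using 2 by (simp add: node_tent_def tent_def)
  next
    case 3
    then have "p (i + 1) \<le> p j" using j by (intro p_le) auto
    then show ?thesis using 3 by (simp add: node_tent_def tent_def)
  qed
qed

text \<open>Every gap between neighbours is counted at most twice, so the sum telescopes and is
  bounded independently of the number of nodes.\<close>

lemma sum_gaps: "(\<Sum>i\<in>{1..<n - 1}. p (i + 1) - p (i - 1)) \<le> 2"
proof -
  have "(\<Sum>i\<in>{1..<m}. p (i + 1) - p (i - 1)) = p m + p (m - 1) - p 1 - p 0" if "1 \<le> m" for m
    using that
  proof (induction m rule: dec_induct)
    case (step m)
    then show ?case by (simp add: sum.atLeastLessThan_Suc)
  qed simp
  from this[of "n - 1"] show ?thesis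
  proof (cases "1 \<le> n - 1")
    case True
    have "p (n - 1) \<le> 1" "p (n - 1 - 1) \<le> 1" "0 \<le> p 1" "0 \<le> p 0"
      using p_mem[of "n - 1"] p_mem[of "n - 1 - 1"] p_mem[of 1] p_mem[of 0] n_pos True by auto
    then show ?thesis using \<open>1 \<le> n - 1 \<Longrightarrow> _\<close>[OF True] by linarith
  qed simp
qed

text \<open>\<open>S\<close> interpolates \<open>\<gamma>\<close> at every node by multiples of
  \<open>\<alpha>\<close> times tents, whose defects are controlled one by one. The difference has
  no node part and is small on the support of \<open>\<phi>\<close>. Vanishing at the extreme nodes
  is required because no tent sits there.\<close>

lemma defect_bound:
  fixes \<gamma> :: "real \<Rightarrow> real"
  assumes \<gamma>: "continuous_on {0..1} \<gamma>" and \<gamma>0: "\<gamma> (p 0) = 0" and \<gamma>1: "\<gamma> 1 = 0"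
    and B: "\<And>s. s \<in> {0..1} \<Longrightarrow> \<bar>\<gamma> s\<bar> \<le> B"
    and L: "\<And>s t. s \<in> {lo..hi} \<Longrightarrow> t \<in> {lo..hi} \<Longrightarrow> \<bar>\<gamma> s / \<alpha> s - \<gamma> t / \<alpha> t\<bar> \<le> L * \<bar>s - t\<bar>"
    and L_nonneg: "L \<ge> 0"
  shows "\<bar>defect \<gamma>\<bar> \<le> 2 * M * (A * (L * \<delta>)) + 2 * (B / a0 * C * sqrt energy)"
proof -
  define J where "J = {1..<n - 1}"
  define G where "G s = \<gamma> s / \<alpha> s" for s
  define S where "S s = (\<Sum>i\<in>J. G (p i) * (\<alpha> s * node_tent i s))" for s
  have B0: "B \<ge> 0" using B[of 0] by force
  have inner: "p i \<in> {0<..<1}" if "i \<in> J" for i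
    using inner_node[of i] that by (auto simp: J_def)
  have Gb: "\<bar>G (p i)\<bar> \<le> B / a0" if "i \<in> J" for i
  proof -
    have "\<bar>\<gamma> (p i)\<bar> \<le> B" using inner[OF that] by (intro B) auto
    moreover have "a0 \<le> \<bar>\<alpha> (p i)\<bar>" using \<alpha>_bounds[OF inner[OF that]] a0 by auto
    ultimately show ?thesis unfolding G_def abs_divide using a0 B0 by (intro frac_le) auto
  qed
  have tcont: "continuous_on {0..1} (\<lambda>s. \<alpha> s * node_tent i s)" if "i \<in> J" for i
    unfolding node_tent_def using inner_node[of i] that by (intro alpha_tent_cont) (auto simp: J_def)
  have Scont: "continuous_on {0..1} S"
    unfolding S_def by (intro continuous_on_sum continuous_on_mult continuous_on_const tcont)
  have dS: "\<bar>defect S\<bar> \<le> 2 * (B / a0 * C * sqrt energy)"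
  proof -
    have "\<bar>defect S\<bar> = \<bar>\<Sum>i\<in>J. G (p i) * defect (\<lambda>s. \<alpha> s * node_tent i s)\<bar>"
      unfolding S_def by (subst defect_sum) (auto simp: J_def[symmetric] defect_cmult J_def
        intro!: continuous_on_mult continuous_on_const tcont[unfolded J_def])
    also have "\<dots> \<le> (\<Sum>i\<in>J. B / a0 * (C * (p (i + 1) - p (i - 1)) * sqrt energy))"
    proof (intro order_trans[OF sum_abs] sum_mono)
      fix i assume i: "i \<in> J"
      then have i': "i \<in> {1..<n - 1}" by (simp add: J_def)
      \<comment> \<open>All three points are nodes, where \<open>resid\<close> vanishes.\<close>
      have "second_diff resid (p (i - 1)) (p i) (p (i + 1)) = 0"
        using i' resid_node[of "i - 1"] resid_node[of i] resid_node[of "i + 1"]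
        by (auto simp: second_diff_def)
      then have "\<bar>defect (\<lambda>s. \<alpha> s * node_tent i s)\<bar> \<le> C * (p (i + 1) - p (i - 1)) * sqrt energy"
        using defect_alpha_tent[OF inner_node[OF i']] by (simp add: node_tent_def)
      then show "\<bar>G (p i) * defect (\<lambda>s. \<alpha> s * node_tent i s)\<bar>
          \<le> B / a0 * (C * (p (i + 1) - p (i - 1)) * sqrt energy)"
        unfolding abs_mult using Gb[OF i] B0 a0 by (intro mult_mono) auto
    qed
    also have "\<dots> = (B / a0 * C * sqrt energy) * (\<Sum>i\<in>J. p (i + 1) - p (i - 1))"
      unfolding sum_distrib_left by (intro sum.cong) (simp_all add: mult_ac)
    also have "\<dots> \<le> (B / a0 * C * sqrt energy) * 2"
      using sum_gaps B0 a0 C_nonneg energy_nonneg by (intro mult_left_mono) (auto simp: J_def)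
    finally show ?thesis by (simp only: mult.commute)
  qed
  have node: "S (p j) = \<gamma> (p j)" if j: "j < n" for j
  proof -
    have "S (p j) = (\<Sum>i\<in>J. if i = j then G (p i) * \<alpha> (p j) else 0)"
      unfolding S_def using node_tent_node[OF _ j] by (intro sum.cong) (auto simp: J_def)
    also have "\<dots> = (if j \<in> J then G (p j) * \<alpha> (p j) else 0)" by (simp add: J_def)
    also have "\<dots> = \<gamma> (p j)"
    proof (cases "j \<in> J")
      case True
      then show ?thesis using \<alpha>_bounds[OF inner[OF True]] a0 by (simp add: G_def)
    next
      case False
      then have "j = 0 \<or> j = n - 1" using j by (auto simp: J_def)
      then show ?thesis using False \<gamma>0 \<gamma>1 p_last by auto
    qed
    finally show ?thesis .
  qed
  have near: "\<bar>\<gamma> s - S s\<bar> \<le> A * (L * \<delta>)" if s: "s \<in> {x - h..x + h}" for s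
  proof -
    have s01: "s \<in> {0<..<1}" and ps: "p 0 \<le> s" using s window \<delta>_nonneg p_first by auto
    then obtain i where i: "Suc i < n" "p i \<le> s" "s < p (Suc i)" using locate[of s] by auto
    have st: "p i < p (Suc i)" "p (Suc i) \<le> p i + \<delta>" using p_step[OF i(1)] by auto
    have pi: "p i \<in> {lo..hi}" "p (Suc i) \<in> {lo..hi}" "s \<in> {lo..hi}"
      using i st s window \<delta>_nonneg by auto
    \<comment> \<open>Both neighbours of \<open>s\<close> lie between \<open>lo\<close> and
      \<open>hi\<close>, hence differ from \<open>p 0 < lo\<close> and from
      \<open>p (n - 1) = 1 > hi\<close>, so both carry a tent.\<close>
    have "i \<noteq> 0" using pi p_first by (cases i) auto
    moreover have "Suc i \<noteq> n - 1" using pi p_last window by (metis atLeastAtMost_iff not_le)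
    ultimately have iJ: "i \<in> J" "Suc i \<in> J" using i by (auto simp: J_def)
    have T1: "node_tent i s = (p (Suc i) - s) / (p (Suc i) - p i)"
      using inner_node[of i] iJ i by (auto simp: node_tent_def tent_def J_def)
    have T2: "node_tent (Suc i) s = (s - p i) / (p (Suc i) - p i)"
      using inner_node[of "Suc i"] iJ i by (auto simp: node_tent_def tent_def J_def)
    have T3: "node_tent j s = 0" if "j \<in> J" "j \<noteq> i" "j \<noteq> Suc i" for j
    proof -
      have "p (j + 1) \<le> p i \<or> p (Suc i) \<le> p (j - 1)"
        using that i by (cases "j < i") (auto intro!: p_le simp: J_def)
      then show ?thesis using i by (auto simp: node_tent_def tent_def)
    qed
    have "S s = (\<Sum>j\<in>{i, Suc i}. G (p j) * (\<alpha> s * node_tent j s))"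
      unfolding S_def using T3 iJ by (intro sum.mono_neutral_right) (auto simp: J_def)
    then have Ss: "S s = \<alpha> s * (G (p i) * node_tent i s + G (p (Suc i)) * node_tent (Suc i) s)"
      by (simp add: algebra_simps)
    \<comment> \<open>The two tents that are active at \<open>s\<close> are barycentric weights, so
      \<open>S s\<close> is \<open>\<alpha> s\<close> times a convex combination of neighbouring
      values of \<open>G\<close>, whereas \<open>\<gamma> s\<close> is
      \<open>\<alpha> s * G s\<close>.\<close>
    have one: "node_tent i s + node_tent (Suc i) s = 1"
      unfolding T1 T2 using st by (simp add: add_divide_distrib[symmetric])
    have pos: "0 \<le> node_tent i s" "0 \<le> node_tent (Suc i) s"
      unfolding T1 T2 using st i by auto
    have "\<gamma> s = \<alpha> s * (G s * (node_tent i s + node_tent (Suc i) s))"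
      using one \<alpha>_bounds[OF s01] a0 by (simp add: G_def)
    then have "\<bar>\<gamma> s - S s\<bar> = \<bar>\<alpha> s * ((G s - G (p i)) * node_tent i s + (G s - G (p (Suc i))) * node_tent (Suc i) s)\<bar>"
      unfolding Ss by (simp add: algebra_simps)
    also have "\<dots> \<le> A * (L * \<delta>)"
      unfolding abs_mult[of "\<alpha> s"]
    proof (rule mult_mono)
      have l: "\<bar>G s - G (p j)\<bar> \<le> L * \<delta>" if "p j \<in> {lo..hi}" "\<bar>s - p j\<bar> \<le> \<delta>" for j
        using L[OF pi(3) that(1)] mult_left_mono[OF that(2) L_nonneg] by (simp add: G_def)
      have "\<bar>(G s - G (p i)) * node_tent i s + (G s - G (p (Suc i))) * node_tent (Suc i) s\<bar>
          \<le> \<bar>G s - G (p i)\<bar> * node_tent i s + \<bar>G s - G (p (Suc i))\<bar> * node_tent (Suc i) s"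
        using pos by (intro order_trans[OF abs_triangle_ineq]) (simp add: abs_mult)
      also have "\<dots> \<le> (L * \<delta>) * node_tent i s + (L * \<delta>) * node_tent (Suc i) s"
        using pos i st by (intro add_mono mult_right_mono l pi) auto
      also have "\<dots> = L * \<delta>" using one by (simp add: distrib_left[symmetric])
      finally show "\<bar>(G s - G (p i)) * node_tent i s + (G s - G (p (Suc i))) * node_tent (Suc i) s\<bar> \<le> L * \<delta>" .
      show "\<bar>\<alpha> s\<bar> \<le> A" using \<alpha>_bounds[OF s01] a0 by auto
    qed (use A_nonneg in auto)
    finally show ?thesis .
  qed
  have "defect \<gamma> = defect (\<lambda>s. S s + (\<gamma> s - S s))" by simp
  also have "\<dots> = defect S + defect (\<lambda>s. \<gamma> s - S s)"
    by (intro defect_add Scont continuous_on_diff \<gamma>)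
  also have "defect (\<lambda>s. \<gamma> s - S s) = integral {0..1} (\<lambda>s. \<phi> s * (\<gamma> s - S s))"
    by (simp add: defect_def node)
  finally have "defect \<gamma> = defect S + integral {0..1} (\<lambda>s. \<phi> s * (\<gamma> s - S s))" .
  moreover have "\<bar>integral {0..1} (\<lambda>s. \<phi> s * (\<gamma> s - S s))\<bar> \<le> 2 * M * (A * (L * \<delta>))"
    by (intro phi_integral_bound continuous_on_diff \<gamma> Scont near)
  ultimately show ?thesis using dS by linarith
qed

end

section \<open>Smoothing kernels, regular designs and projection weights\<close>

lemma C2_on_continuous: "C2_on S f \<Longrightarrow> continuous_on S f"
  unfolding C2_on_def by (metis DERIV_continuous_on)

lemma C2_on_Taylor:
  assumes g: "C2_on {0..1} g" and x: "x \<in> {0..1}"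
  obtains D g1 where "D \<ge> 0" "\<And>s. s \<in> {0..1} \<Longrightarrow> \<bar>g s - g x - g1 * (s - x)\<bar> \<le> D * (s - x)\<^sup>2"
proof -
  obtain g' g'' where g': "\<And>t. t \<in> {0..1} \<Longrightarrow> (g has_real_derivative g' t) (at t within {0..1})"
    and g'': "\<And>t. t \<in> {0..1} \<Longrightarrow> (g' has_real_derivative g'' t) (at t within {0..1})"
    and cont: "continuous_on {0..1} g''" using g unfolding C2_on_def by blast
  obtain D where D: "D > 0" "\<And>s. s \<in> {0..1} \<Longrightarrow> \<bar>g'' s\<bar> \<le> D"
    using compact_bound[OF compact_Icc cont] by blast
  have lip: "norm (g' t - g' x) \<le> D * norm (t - x)" if "t \<in> {0..1}" for t
    by (rule field_differentiable_bound[of "{0..1}" g' g'']) (use that x D g'' in auto)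
  have "\<bar>g s - g x - g' x * (s - x)\<bar> \<le> D * (s - x)\<^sup>2" if s: "s \<in> {0..1}" for s
  proof -
    let ?S = "closed_segment x s"
    have sub: "?S \<subseteq> {0..1}" using s x by (simp add: closed_segment_subset)
    have "norm ((g s - g' x * s) - (g x - g' x * x)) \<le> (D * \<bar>s - x\<bar>) * norm (s - x)"
    proof (rule field_differentiable_bound[of ?S "\<lambda>t. g t - g' x * t" "\<lambda>t. g' t - g' x"])
      fix t assume t: "t \<in> ?S"
      then have t01: "t \<in> {0..1}" using sub by blast
      have "(g has_real_derivative g' t) (at t within ?S)"
        by (rule has_field_derivative_subset[OF g'[OF t01] sub])
      then show "((\<lambda>t. g t - g' x * t) has_real_derivative (g' t - g' x)) (at t within ?S)"
        by (auto intro!: derivative_eq_intros)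
      have "\<bar>t - x\<bar> \<le> \<bar>s - x\<bar>" using t by (auto simp: closed_segment_eq_real_ivl split: if_splits)
      then show "norm (g' t - g' x) \<le> D * \<bar>s - x\<bar>"
        using order_trans[OF lip[OF t01] mult_left_mono[of "\<bar>t - x\<bar>" "\<bar>s - x\<bar>" D, folded real_norm_def]] D(1)
        by simp
    qed auto
    then show ?thesis by (simp add: algebra_simps power2_eq_square)
  qed
  then show ?thesis using that[of D "g' x"] D(1) by simp
qed

lemma smoothing_kernel_props:
  assumes K: "smoothing_kernel K"
  obtains M where "M \<ge> 0" "\<And>u. \<bar>K u\<bar> \<le> M" "\<And>u. u \<notin> {-1..1} \<Longrightarrow> K u = 0" "continuous_on UNIV K"
proof -
  have zero: "K u = 0" if "u \<notin> {-1..1}" for u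
    using K that closure_subset[of "{u. K u \<noteq> 0}"] by (auto simp: smoothing_kernel_def)
  have cont: "continuous_on UNIV K"
    using K by (auto simp: smoothing_kernel_def intro: C1_differentiable_imp_continuous_on)
  obtain M where M: "M > 0" "\<And>s. s \<in> {-1..1} \<Longrightarrow> \<bar>K s\<bar> \<le> M"
    using compact_bound[OF compact_Icc continuous_on_subset[OF cont subset_UNIV]] by blast
  have "\<bar>K u\<bar> \<le> M" for u using M zero[of u] by (cases "u \<in> {-1..1}") auto
  then show ?thesis using that[of M] M(1) zero cont by simp
qed

lemma scaled_kernel_has_integral:
  assumes k: "(k has_integral I) {-1..1}" and zero: "\<And>u. u \<notin> {-1..1} \<Longrightarrow> k u = 0"
    and h: "h > 0" "0 \<le> x - h" "x + h \<le> 1"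
  shows "(scaled_kernel k x h has_integral I) {0..1}"
proof -
  have "((\<lambda>s. k ((-1 / h) *\<^sub>R s + x / h)) has_integral (1 / \<bar>-1 / h\<bar> ^ DIM(real)) *\<^sub>R I)
     ((\<lambda>u. (1 / (-1 / h)) *\<^sub>R u + - ((1 / (-1 / h)) *\<^sub>R (x / h))) ` cbox (-1) 1)"
    using h k by (intro has_integral_affinity) auto
  moreover have "((\<lambda>u. (1 / (-1 / h)) *\<^sub>R u + - ((1 / (-1 / h)) *\<^sub>R (x / h))) ` cbox (-1) 1) = {x - h..x + h}"
  proof -
    have "((\<lambda>u. (1 / (-1 / h)) *\<^sub>R u + - ((1 / (-1 / h)) *\<^sub>R (x / h))) ` cbox (-1) 1) = (\<lambda>u. (- h) * u + x) ` {-1..1}"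
      using h by simp
    also have "\<dots> = {x - h..x + h}"
      using h by (subst image_affinity_atLeastAtMost) auto
    finally show ?thesis .
  qed
  ultimately have "((\<lambda>s. k ((x - s) / h)) has_integral (h * I)) {x - h..x + h}"
    using h by (simp add: diff_divide_distrib)
  from has_integral_mult_right[OF this, of "1 / h"] have "(scaled_kernel k x h has_integral I) {x - h..x + h}"
    using h by (simp add: scaled_kernel_def[abs_def])
  then show ?thesis
  proof (rule has_integral_on_superset)
    fix s assume "s \<notin> {x - h..x + h}"
    then have "(x - s) / h \<notin> {-1..1}" using h by (auto simp: field_simps)
    then show "scaled_kernel k x h s = 0" by (simp add: scaled_kernel_def zero)
  qed (use h in auto)
qed

lemma scaled_kernel_moments:
  assumes K: "smoothing_kernel K" and h: "h > 0" "0 \<le> x - h" "x + h \<le> 1"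
  shows "(scaled_kernel K x h has_integral 1) {0..1}"
    and "((\<lambda>s. scaled_kernel K x h s * (s - x)) has_integral 0) {0..1}"
proof -
  obtain M where zero: "\<And>u. u \<notin> {-1..1} \<Longrightarrow> K u = 0" using smoothing_kernel_props[OF K] by metis
  show "(scaled_kernel K x h has_integral 1) {0..1}"
    using K by (intro scaled_kernel_has_integral zero h) (auto simp: smoothing_kernel_def)
  have "(scaled_kernel (\<lambda>u. u * K u) x h has_integral 0) {0..1}"
    using K by (intro scaled_kernel_has_integral h) (auto simp: smoothing_kernel_def zero)
  \<comment> \<open>With \<open>u = (x - s) / h\<close> one has
    \<open>s - x = - h * u\<close>.\<close>
  from has_integral_mult_right[OF this, of "- h"]
  have "((\<lambda>s. - h * scaled_kernel (\<lambda>u. u * K u) x h s) has_integral 0) {0..1}" by simp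
  moreover have "(\<lambda>s. - h * scaled_kernel (\<lambda>u. u * K u) x h s) = (\<lambda>s. scaled_kernel K x h s * (s - x))"
    using h(1) by (auto simp: scaled_kernel_def fun_eq_iff field_simps)
  ultimately show "((\<lambda>s. scaled_kernel K x h s * (s - x)) has_integral 0) {0..1}" by simp
qed

text \<open>\<open>d\<close> is \<open>1 / c\<close> for a lower bound \<open>c\<close> of the
  density: the distribution function grows at rate at least \<open>c\<close>, so quantiles whose
  levels are \<open>1 / n\<close> apart differ by at most \<open>1 / (c * n)\<close>.\<close>

lemma regular_design_props:
  assumes f: "design_density f"
  obtains d where "d > 0" "\<And>n. n > 0 \<Longrightarrow> length (regular_design f n) = n"
    "\<And>n i. i < n \<Longrightarrow> regular_design f n ! i \<in> {0..1}"
    "\<And>n i. Suc i < n \<Longrightarrow> regular_design f n ! i < regular_design f n ! Suc i"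
    "\<And>n i. Suc i < n \<Longrightarrow> regular_design f n ! Suc i \<le> regular_design f n ! i + d / real n"
    "\<And>n. n > 0 \<Longrightarrow> 0 < regular_design f n ! 0" "\<And>n. n > 0 \<Longrightarrow> regular_design f n ! 0 \<le> d / real n"
    "\<And>n. n > 0 \<Longrightarrow> regular_design f n ! (n - 1) = 1"
proof -
  define F where "F = distribution_fun f"
  have fc: "continuous_on {0..1} f" using f by (auto simp: design_density_def intro: C2_on_continuous)
  obtain c where c: "c > 0" "\<And>t. t \<in> {0<..<1} \<Longrightarrow> c \<le> f t" using f by (auto simp: design_density_def)
  have F0: "F 0 = 0" by (simp add: F_def distribution_fun_def)
  have F1: "F 1 = 1" using f by (auto simp: F_def distribution_fun_def design_density_def)
  have Fd: "(F has_real_derivative f t) (at t within {0..1})" if "t \<in> {0..1}" for t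
    unfolding F_def distribution_fun_def[abs_def] by (rule integral_has_real_derivative[OF fc that])
  have Fc: "continuous_on {0..1} F" using Fd by (rule DERIV_continuous_on)
  have grow: "c * (t - s) \<le> F t - F s" if st: "0 \<le> s" "s < t" "t \<le> 1" for s t
  proof -
    have der: "(F has_real_derivative f u) (at u)" if "s < u" "u < t" for u
    proof -
      have "at u within {0..1} = at u" using st that by (intro at_within_Icc_at) auto
      then show ?thesis using Fd[of u] st that by simp
    qed
    obtain l z where z: "s < z" "z < t" "DERIV F z :> l" "F t - F s = (t - s) * l"
      using MVT[of s t F] st der
      by (metis Fc continuous_on_subset atLeastatMost_subset_iff real_differentiable_def)
    have "l = f z" using DERIV_unique[OF z(3) der[OF z(1,2)]] .
    then have "c \<le> l" using c(2)[of z] z st by auto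
    then have "(t - s) * c \<le> (t - s) * l" using st by (intro mult_left_mono) auto
    then show ?thesis using z(4) by (simp add: mult.commute)
  qed
  have mono: "F s < F t" if "0 \<le> s" "s < t" "t \<le> 1" for s t
  proof -
    have "0 < c * (t - s)" using that c(1) by simp
    then show ?thesis using grow[OF that] by linarith
  qed
  have inj: "inj_on F {0..1}"
  proof (rule inj_onI)
    fix s t assume "s \<in> {0..1}" "t \<in> {0..1}" "F s = F t"
    then show "s = t" using mono[of s t] mono[of t s] by (cases s t rule: linorder_cases) auto
  qed
  have onto: "y \<in> F ` {0..1}" if "0 \<le> y" "y \<le> 1" for y
    using IVT'[of F 0 y 1] that F0 F1 Fc by auto
  \<comment> \<open>List positions start at 0, so position \<open>i\<close> holds the quantile of
    level \<open>(i + 1) / n\<close>; hence the first node is positive and the last one equals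
    1.\<close>
  define q where "q n i = the_inv_into {0..1} F (real (Suc i) / real n)" for n i
  have y: "0 \<le> real (Suc i) / real n" "real (Suc i) / real n \<le> 1" if "i < n" for n i
    using that by (auto simp: field_simps)
  have Fq: "F (q n i) = real (Suc i) / real n" if "i < n" for n i
    unfolding q_def by (rule f_the_inv_into_f[OF inj onto[OF y[OF that]]])
  have qm: "q n i \<in> {0..1}" if "i < n" for n i
    unfolding q_def by (rule the_inv_into_into[OF inj onto[OF y[OF that]]]) simp
  have rq: "regular_design f n ! i = q n i" if "i < n" for n i
    using that by (simp add: regular_design_def q_def F_def del: upt_Suc)
  have step: "q n i < q n (Suc i)" "q n (Suc i) \<le> q n i + (1 / c) / real n" if i: "Suc i < n" for n i
  proof -
    have d: "F (q n (Suc i)) - F (q n i) = 1 / real n"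
      using Fq[of i n] Fq[of "Suc i" n] i by (simp add: diff_divide_distrib[symmetric])
    have "1 / real n > 0" using i by simp
    then have "F (q n i) < F (q n (Suc i))" using d by linarith
    then show lt: "q n i < q n (Suc i)"
      using mono[of "q n (Suc i)" "q n i"] qm[of i n] qm[of "Suc i" n] i
      by (cases "q n i" "q n (Suc i)" rule: linorder_cases) auto
    have "c * (q n (Suc i) - q n i) \<le> 1 / real n"
      using grow[OF _ lt] qm[of i n] qm[of "Suc i" n] i d by simp
    then show "q n (Suc i) \<le> q n i + (1 / c) / real n" using c(1) i by (simp add: field_simps)
  qed
  have first: "0 < q n 0" "q n 0 \<le> (1 / c) / real n" if n: "n > 0" for n
  proof -
    have "F (q n 0) = 1 / real n" using Fq[of 0 n] n by simp
    then have "q n 0 \<noteq> 0" using F0 n by auto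
    then show p: "0 < q n 0" using qm[of 0 n] n by auto
    have "c * q n 0 \<le> 1 / real n"
      using grow[of 0 "q n 0"] p qm[of 0 n] n F0 \<open>F (q n 0) = 1 / real n\<close> by simp
    then show "q n 0 \<le> (1 / c) / real n" using c(1) n by (simp add: field_simps)
  qed
  have last: "q n (n - 1) = 1" if n: "n > 0" for n
  proof -
    have "F (q n (n - 1)) = F 1" using Fq[of "n - 1" n] n F1 by simp
    then show ?thesis using inj qm[of "n - 1" n] n by (auto dest: inj_onD)
  qed
  show ?thesis
  proof (rule that[of "1 / c"])
    show "length (regular_design f n) = n" if "n > 0" for n
      using that by (simp add: regular_design_def del: upt_Suc)
  qed (use c(1) qm step first last rq in \<open>auto simp: Suc_lessD\<close>)
qed

text \<open>\<open>mat_inverse\<close> fails only if the matrix is not a unit of the ring of square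
  matrices, while a two-sided inverse, whose dimensions are forced by the products, makes it a
  unit.\<close>

lemma invertible_mat_inverse:
  assumes G: "G \<in> carrier_mat n n" and inv: "invertible_mat (G :: 'a :: field mat)"
  obtains B where "mat_inverse G = Some B" "B * G = 1\<^sub>m n" "B \<in> carrier_mat n n"
proof (cases "mat_inverse G")
  case None
  obtain B where B: "inverts_mat G B" "inverts_mat B G" using inv by (auto simp: invertible_mat_def)
  have GB: "G * B = 1\<^sub>m n" "B * G = 1\<^sub>m (dim_row B)" using B G by (auto simp: inverts_mat_def)
  have "dim_col B = n" using arg_cong[OF GB(1), of dim_col] by simp
  moreover have "dim_row B = n" using arg_cong[OF GB(2), of dim_col] G by simp
  ultimately have Bc: "B \<in> carrier_mat n n" by auto
  then have "G \<in> Units (ring_mat TYPE('a) n ())"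
    using G GB by (auto simp: Units_def ring_mat_def)
  then show ?thesis using mat_inverse(1)[OF G None, where b = "()"] by blast
next
  case (Some B)
  then show ?thesis using mat_inverse(2)[OF G Some] that by blast
qed

text \<open>Multiplying the row vector of weights by the Gram matrix cancels the inverse. This
  supplies the hypothesis \<open>interp\<close> of the quadrature locale.\<close>

lemma proj_weight_interpolates:
  assumes inv: "invertible_mat (gram R ts)" and i: "i < length ts"
  shows "smoothed_cov R K x h (ts ! i) = (\<Sum>j<length ts. proj_weight R K x h ts j * R (ts ! j) (ts ! i))"
proof -
  let ?n = "length ts" and ?F = "\<lambda>k. smoothed_cov R K x h (ts ! k)"
  have G: "gram R ts \<in> carrier_mat ?n ?n" by (simp add: gram_def)
  obtain B where B: "mat_inverse (gram R ts) = Some B" "B * gram R ts = 1\<^sub>m ?n" "B \<in> carrier_mat ?n ?n"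
    using invertible_mat_inverse[OF G inv] by metis
  have BG: "(\<Sum>j<?n. B $$ (k, j) * R (ts ! j) (ts ! i)) = (if k = i then 1 else 0)" if k: "k < ?n" for k
  proof -
    have "(B * gram R ts) $$ (k, i) = (\<Sum>j<?n. B $$ (k, j) * R (ts ! j) (ts ! i))"
      using B(3) k i by (simp add: gram_def scalar_prod_def atLeast0LessThan)
    then show ?thesis using B(2) k i by simp
  qed
  have "(\<Sum>j<?n. proj_weight R K x h ts j * R (ts ! j) (ts ! i)) =
      (\<Sum>j<?n. \<Sum>k<?n. ?F k * (B $$ (k, j) * R (ts ! j) (ts ! i)))"
    by (simp add: proj_weight_def B(1) sum_distrib_right mult.assoc)
  also have "\<dots> = (\<Sum>k<?n. ?F k * (\<Sum>j<?n. B $$ (k, j) * R (ts ! j) (ts ! i)))"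
    by (subst sum.swap) (simp add: sum_distrib_left)
  also have "\<dots> = (\<Sum>k<?n. if k = i then ?F k else 0)"
    using BG by (intro sum.cong) auto
  also have "\<dots> = ?F i" using i by simp
  finally show ?thesis by simp
qed

section \<open>A perturbed central limit theorem\<close>

text \<open>Serves to renumber the errors, which start at index 1, from 0. Injectivity keeps
  distinct indices distinct, so each product formula is one of the original family.\<close>

lemma (in prob_space) indep_vars_comp_inj:
  assumes X: "indep_vars M' X (f ` I)" and f: "inj_on f I"
  shows "indep_vars (\<lambda>i. M' (f i)) (\<lambda>i. X (f i)) I"
  unfolding indep_vars_def2 indep_sets_def
proof (intro conjI ballI allI impI)
  fix i assume "i \<in> I"
  then show "random_variable (M' (f i)) (X (f i))"
    and "{X (f i) -` A \<inter> space M |A. A \<in> sets (M' (f i))} \<subseteq> events"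
    using X by (auto simp: indep_vars_def2 indep_sets_def)
next
  fix J A assume J: "J \<subseteq> I" "J \<noteq> {}" "finite J"
    and A: "A \<in> (\<Pi> i\<in>J. {X (f i) -` A \<inter> space M |A. A \<in> sets (M' (f i))})"
  have inj: "inj_on f J" using f J(1) by (rule inj_on_subset)
  define B where "B = (\<lambda>j. A (the_inv_into J f j))"
  have BA: "B (f i) = A i" if "i \<in> J" for i using that inj by (simp add: B_def the_inv_into_f_f)
  have "prob (\<Inter>j\<in>f ` J. B j) = (\<Prod>j\<in>f ` J. prob (B j))"
    by (rule indep_setsD[of "\<lambda>i. {X i -` A \<inter> space M |A. A \<in> sets (M' i)}" "f ` I"])
      (use X J A BA in \<open>auto simp: indep_vars_def2\<close>)
  moreover have "(\<Inter>j\<in>f ` J. B j) = (\<Inter>i\<in>J. A i)" using BA by auto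
  moreover have "(\<Prod>j\<in>f ` J. prob (B j)) = (\<Prod>i\<in>J. prob (A i))"
    using BA by (simp add: prod.reindex[OF inj])
  ultimately show "prob (\<Inter>i\<in>J. A i) = (\<Prod>i\<in>J. prob (A i))" by simp
qed

lemma (in prob_space) integrable_of_square:
  fixes X :: "'a \<Rightarrow> real"
  assumes [measurable]: "X \<in> borel_measurable M" and X: "integrable M (\<lambda>\<omega>. (X \<omega>)\<^sup>2)"
  shows "integrable M X"
  using X square_integrable_imp_integrable[of X] by simp

text \<open>Each new summand is independent of the partial sum and centered, so the mixed term has
  mean 0.\<close>

lemma (in prob_space) second_moment_sum_indep:
  fixes X :: "'i \<Rightarrow> 'a \<Rightarrow> real"
  assumes "finite J" "indep_vars (\<lambda>_. borel) X J"
    and "\<And>i. i \<in> J \<Longrightarrow> integrable M (\<lambda>\<omega>. (X i \<omega>)\<^sup>2)" "\<And>i. i \<in> J \<Longrightarrow> expectation (X i) = 0"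
  shows "integrable M (\<lambda>\<omega>. (\<Sum>i\<in>J. X i \<omega>)\<^sup>2) \<and>
    expectation (\<lambda>\<omega>. (\<Sum>i\<in>J. X i \<omega>)\<^sup>2) = (\<Sum>i\<in>J. expectation (\<lambda>\<omega>. (X i \<omega>)\<^sup>2))"
  using assms
proof (induction J rule: finite_induct)
  case (insert a J)
  let ?S = "\<lambda>\<omega>. \<Sum>i\<in>J. X i \<omega>"
  have meas [measurable]: "X i \<in> borel_measurable M" if "i \<in> insert a J" for i
    using insert.prems(1) that by (auto simp: indep_vars_def2)
  have [measurable]: "X a \<in> borel_measurable M" by (rule meas) simp
  have [measurable]: "?S \<in> borel_measurable M" by (intro borel_measurable_sum meas) simp
  have IH: "integrable M (\<lambda>\<omega>. (?S \<omega>)\<^sup>2)" "expectation (\<lambda>\<omega>. (?S \<omega>)\<^sup>2) = (\<Sum>i\<in>J. expectation (\<lambda>\<omega>. (X i \<omega>)\<^sup>2))"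
    using insert.IH insert.prems indep_vars_subset[OF insert.prems(1), of J] by auto
  have ia: "integrable M (X a)" by (rule integrable_of_square) (use insert.prems in auto)
  have iS: "integrable M ?S" by (rule integrable_of_square) (use IH in auto)
  have ind: "indep_var borel (X a) borel ?S" by (rule indep_vars_sum) (use insert in auto)
  have ip: "integrable M (\<lambda>\<omega>. X a \<omega> * ?S \<omega>)" by (rule indep_var_integrable[OF ind ia iS])
  have "expectation (\<lambda>\<omega>. X a \<omega> * ?S \<omega>) = expectation (X a) * expectation ?S"
    by (rule indep_var_lebesgue_integral[OF ind ia iS])
  then have e0: "expectation (\<lambda>\<omega>. X a \<omega> * ?S \<omega>) = 0" using insert.prems by simp
  have eq: "(\<Sum>i\<in>insert a J. X i \<omega>)\<^sup>2 = (X a \<omega>)\<^sup>2 + 2 * (X a \<omega> * ?S \<omega>) + (?S \<omega>)\<^sup>2" for \<omega>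
    using insert by (simp add: power2_sum algebra_simps)
  have i2: "integrable M (\<lambda>\<omega>. (X a \<omega>)\<^sup>2)" using insert.prems by auto
  have "integrable M (\<lambda>\<omega>. (\<Sum>i\<in>insert a J. X i \<omega>)\<^sup>2)"
    unfolding eq by (intro Bochner_Integration.integrable_add integrable_mult_right i2 ip IH)
  moreover have "expectation (\<lambda>\<omega>. (\<Sum>i\<in>insert a J. X i \<omega>)\<^sup>2) =
      expectation (\<lambda>\<omega>. (X a \<omega>)\<^sup>2) + 2 * expectation (\<lambda>\<omega>. X a \<omega> * ?S \<omega>) + expectation (\<lambda>\<omega>. (?S \<omega>)\<^sup>2)"
    unfolding eq using i2 ip IH(1) by simp
  ultimately show ?case using e0 IH insert by simp
qed simp

lemma cmod_iexp_diff: "cmod (iexp a - iexp b) \<le> \<bar>a - b\<bar>"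
proof -
  have "iexp a - iexp b = iexp b * (iexp (a - b) - 1)"
    by (simp add: right_diff_distrib exp_add[symmetric] algebra_simps)
  then have "cmod (iexp a - iexp b) = cmod (iexp (a - b) - 1)" by (simp add: norm_mult)
  also have "\<dots> \<le> \<bar>a - b\<bar>" using iexp_approx1[of "a - b" 0] by simp
  finally show ?thesis .
qed

text \<open>The exponential on the imaginary axis is 1-Lipschitz, which gives a bound by the mean of
  \<open>\<bar>X - Y\<bar>\<close>; nonnegativity of a variance passes from the mean to the root
  mean square.\<close>

lemma (in prob_space) char_diff_bound:
  fixes X Y :: "'a \<Rightarrow> real"
  assumes [measurable]: "X \<in> borel_measurable M" "Y \<in> borel_measurable M"
    and int: "integrable M (\<lambda>\<omega>. (X \<omega> - Y \<omega>)\<^sup>2)"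
  shows "cmod (char (distr M borel X) t - char (distr M borel Y) t)
    \<le> \<bar>t\<bar> * sqrt (expectation (\<lambda>\<omega>. (X \<omega> - Y \<omega>)\<^sup>2))"
proof -
  have i1: "integrable M (\<lambda>\<omega>. X \<omega> - Y \<omega>)" by (rule integrable_of_square[OF _ int]) simp
  have abs: "expectation (\<lambda>\<omega>. \<bar>X \<omega> - Y \<omega>\<bar>) \<le> sqrt (expectation (\<lambda>\<omega>. (X \<omega> - Y \<omega>)\<^sup>2))"
  proof (rule real_le_rsqrt)
    have "0 \<le> variance (\<lambda>\<omega>. \<bar>X \<omega> - Y \<omega>\<bar>)" by (rule variance_positive)
    also have "\<dots> = expectation (\<lambda>\<omega>. \<bar>X \<omega> - Y \<omega>\<bar>\<^sup>2) - (expectation (\<lambda>\<omega>. \<bar>X \<omega> - Y \<omega>\<bar>))\<^sup>2"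
      using i1 int by (intro variance_eq) auto
    finally show "(expectation (\<lambda>\<omega>. \<bar>X \<omega> - Y \<omega>\<bar>))\<^sup>2 \<le> expectation (\<lambda>\<omega>. (X \<omega> - Y \<omega>)\<^sup>2)" by simp
  qed
  have iX: "integrable M (\<lambda>\<omega>. iexp (t * Z \<omega>))" if [measurable]: "Z \<in> borel_measurable M" for Z
    using integrable_iexp[of "\<lambda>\<omega>. complex_of_real (t * Z \<omega>)"] by simp
  have "char (distr M borel X) t - char (distr M borel Y) t = (CLINT \<omega>|M. iexp (t * X \<omega>) - iexp (t * Y \<omega>))"
    unfolding char_def using iX[of X] iX[of Y] by (simp add: integral_distr)
  then have "cmod (char (distr M borel X) t - char (distr M borel Y) t) \<le>
      (LINT \<omega>|M. cmod (iexp (t * X \<omega>) - iexp (t * Y \<omega>)))"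
    by (simp add: integral_norm_bound)
  also have "\<dots> \<le> (LINT \<omega>|M. \<bar>t\<bar> * \<bar>X \<omega> - Y \<omega>\<bar>)"
  proof (rule integral_mono)
    show "integrable M (\<lambda>\<omega>. cmod (iexp (t * X \<omega>) - iexp (t * Y \<omega>)))"
      using iX[of X] iX[of Y] by (intro integrable_norm Bochner_Integration.integrable_diff) auto
    show "integrable M (\<lambda>\<omega>. \<bar>t\<bar> * \<bar>X \<omega> - Y \<omega>\<bar>)" using i1 by simp
    show "cmod (iexp (t * X \<omega>) - iexp (t * Y \<omega>)) \<le> \<bar>t\<bar> * \<bar>X \<omega> - Y \<omega>\<bar>" for \<omega>
      using cmod_iexp_diff[of "t * X \<omega>" "t * Y \<omega>"] by (simp add: right_diff_distrib[symmetric] abs_mult del: of_real_mult)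
  qed
  also have "\<dots> = \<bar>t\<bar> * expectation (\<lambda>\<omega>. \<bar>X \<omega> - Y \<omega>\<bar>)" by simp
  also have "\<dots> \<le> \<bar>t\<bar> * sqrt (expectation (\<lambda>\<omega>. (X \<omega> - Y \<omega>)\<^sup>2))" by (intro mult_left_mono abs) simp
  finally show ?thesis .
qed

lemma char_normal_density:
  assumes \<sigma>: "\<sigma> > 0"
  shows "real_distribution (density lborel (normal_density 0 \<sigma>))"
    and "char (density lborel (normal_density 0 \<sigma>)) t = char std_normal_distribution (\<sigma> * t)"
proof -
  interpret S: prob_space std_normal_distribution
    using real_dist_normal_dist by (simp add: real_distribution_def)
  have "distributed std_normal_distribution lborel (\<lambda>z. z) std_normal_density"
    by (auto simp: distributed_def distr_id2)
  from S.normal_density_affine[OF this, of \<sigma> 0] \<sigma>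
  have "distributed std_normal_distribution lborel (\<lambda>z. \<sigma> * z) (normal_density 0 \<sigma>)" by simp
  then have "distr std_normal_distribution lborel (\<lambda>z. \<sigma> * z) = density lborel (normal_density 0 \<sigma>)"
    by (simp add: distributed_def)
  moreover have "distr std_normal_distribution lborel (\<lambda>z. \<sigma> * z) = distr std_normal_distribution borel (\<lambda>z. \<sigma> * z)"
    by (intro distr_cong) auto
  ultimately have eq: "density lborel (normal_density 0 \<sigma>) = distr std_normal_distribution borel (\<lambda>z. \<sigma> * z)" by simp
  show "real_distribution (density lborel (normal_density 0 \<sigma>))"
    unfolding eq by (rule S.real_distribution_distr) simp
  show "char (density lborel (normal_density 0 \<sigma>)) t = char std_normal_distribution (\<sigma> * t)"
    unfolding eq char_def by (subst integral_distr) (auto simp: mult_ac)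
qed

text \<open>Levy's theorem turns the classical limit theorem into convergence of characteristic
  functions. This can be composed with any \<open>m k\<close> that tends to infinity, absorbs a
  perturbation vanishing in mean square by \<open>char_diff_bound\<close>, and is then turned back
  into weak convergence.\<close>

lemma (in prob_space) clt_perturbed:
  fixes X :: "nat \<Rightarrow> 'a \<Rightarrow> real" and T :: "nat \<Rightarrow> 'a \<Rightarrow> real" and m :: "nat \<Rightarrow> nat"
  assumes indep: "indep_vars (\<lambda>_. borel) X {1..}"
    and mean: "\<And>j. j \<ge> 1 \<Longrightarrow> expectation (X j) = 0"
    and sq: "\<And>j. j \<ge> 1 \<Longrightarrow> integrable M (\<lambda>\<omega>. (X j \<omega>)\<^sup>2)"
    and var: "\<And>j. j \<ge> 1 \<Longrightarrow> expectation (\<lambda>\<omega>. (X j \<omega>)\<^sup>2) = \<sigma>\<^sup>2" and \<sigma>: "\<sigma> > 0"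
    and distr: "\<And>j. j \<ge> 1 \<Longrightarrow> distr M borel (X j) = \<mu>"
    and m: "filterlim m at_top sequentially"
    and T: "\<And>k. T k \<in> borel_measurable M"
    and int: "\<And>k. integrable M (\<lambda>\<omega>. (T k \<omega> - 1 / sqrt (real (m k)) * (\<Sum>j=1..m k. X j \<omega>))\<^sup>2)"
    and lim: "(\<lambda>k. expectation (\<lambda>\<omega>. (T k \<omega> - 1 / sqrt (real (m k)) * (\<Sum>j=1..m k. X j \<omega>))\<^sup>2)) \<longlonglongrightarrow> 0"
  shows "weak_conv_m (\<lambda>k. distr M borel (T k)) (density lborel (normal_density 0 \<sigma>))"
proof (rule levy_continuity)
  define Z where "Z k \<omega> = (\<Sum>i<k. X (Suc i) \<omega>) / sqrt (real k * \<sigma>\<^sup>2)" for k \<omega>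
  define S where "S k \<omega> = 1 / sqrt (real (m k)) * (\<Sum>j=1..m k. X j \<omega>)" for k \<omega>
  have X[measurable]: "X j \<in> borel_measurable M" if "j \<ge> 1" for j
    using indep that by (auto simp: indep_vars_def2)
  have Zm[measurable]: "Z k \<in> borel_measurable M" for k
    unfolding Z_def by (intro borel_measurable_divide borel_measurable_sum X) auto
  have Sm[measurable]: "S k \<in> borel_measurable M" for k
    unfolding S_def by (intro borel_measurable_times borel_measurable_sum X) auto
  have S_Z: "S k \<omega> = \<sigma> * Z (m k) \<omega>" for k \<omega>
  proof -
    have "(\<Sum>j=1..m k. X j \<omega>) = (\<Sum>i<m k. X (Suc i) \<omega>)"
      using sum.atLeast1_atMost_eq[of "\<lambda>j. X j \<omega>" "m k"] by simp
    then show ?thesis using \<sigma> by (simp add: S_def Z_def real_sqrt_mult)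
  qed
  \<comment> \<open>The sequence is numbered from 1, whereas the central limit theorem sums from
    0.\<close>
  have "range Suc = {1..}" by (auto simp: image_iff) (metis Suc_pred' not0_implies_Suc not_less_eq_eq le_zero_eq One_nat_def Suc_le_D)
  then have ind: "indep_vars (\<lambda>_. borel) (\<lambda>i. X (Suc i)) UNIV"
    using indep_vars_comp_inj[of "\<lambda>_. borel" X Suc UNIV] indep by simp
  have "weak_conv_m (\<lambda>k. distr M borel (Z k)) std_normal_distribution"
    unfolding Z_def
    by (rule central_limit_theorem_zero_mean[OF ind _ \<sigma>]) (auto simp: mean sq var distr)
  then have "(\<lambda>k. char (distr M borel (Z k)) t) \<longlonglongrightarrow> char std_normal_distribution t" for t
    by (intro levy_continuity1 real_distribution_distr real_dist_normal_dist) auto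
  then have lZ: "(\<lambda>k. char (distr M borel (Z (m k))) t) \<longlonglongrightarrow> char std_normal_distribution t" for t
    by (rule filterlim_compose[OF _ m])
  fix t
  have "char (distr M borel (S k)) t = char (distr M borel (Z (m k))) (\<sigma> * t)" for k
    unfolding char_def S_Z by (simp add: integral_distr mult_ac)
  then have lS: "(\<lambda>k. char (distr M borel (S k)) t) \<longlonglongrightarrow> char (density lborel (normal_density 0 \<sigma>)) t"
    using lZ[of "\<sigma> * t"] char_normal_density(2)[OF \<sigma>] by simp
  have "(\<lambda>k. char (distr M borel (T k)) t - char (distr M borel (S k)) t) \<longlonglongrightarrow> 0"
  proof (rule Lim_null_comparison)
    show "\<forall>\<^sub>F k in sequentially. norm (char (distr M borel (T k)) t - char (distr M borel (S k)) t)
        \<le> \<bar>t\<bar> * sqrt (expectation (\<lambda>\<omega>. (T k \<omega> - S k \<omega>)\<^sup>2))"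
      using int by (intro always_eventually allI char_diff_bound T Sm) (simp add: S_def)
    have "(\<lambda>k. \<bar>t\<bar> * sqrt (expectation (\<lambda>\<omega>. (T k \<omega> - S k \<omega>)\<^sup>2))) \<longlonglongrightarrow> \<bar>t\<bar> * sqrt 0"
      unfolding S_def by (intro tendsto_intros lim)
    then show "(\<lambda>k. \<bar>t\<bar> * sqrt (expectation (\<lambda>\<omega>. (T k \<omega> - S k \<omega>)\<^sup>2))) \<longlonglongrightarrow> 0" by simp
  qed
  from tendsto_add[OF this lS]
  show "(\<lambda>k. char (distr M borel (T k)) t) \<longlonglongrightarrow> char (density lborel (normal_density 0 \<sigma>)) t" by simp
qed (use T char_normal_density(1)[OF \<sigma>] in \<open>auto intro: real_distribution_distr\<close>)

section \<open>Finite combinations of the process and of its copies\<close>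

lemma process_combination:
  fixes s c :: "'i \<Rightarrow> real"
  assumes N: "prob_space N" and so: "second_order_process N \<epsilon>" and ce: "centered_process N \<epsilon>"
    and cov: "\<And>s t. s \<in> {0..1} \<Longrightarrow> t \<in> {0..1} \<Longrightarrow> R s t = autocovariance N \<epsilon> s t"
    and I: "finite I" and s: "s ` I \<subseteq> {0..1}"
  shows "(\<lambda>\<omega>. \<Sum>i\<in>I. c i * \<epsilon> (s i) \<omega>) \<in> borel_measurable N"
    and "(LINT \<omega>|N. (\<Sum>i\<in>I. c i * \<epsilon> (s i) \<omega>)) = 0"
    and "integrable N (\<lambda>\<omega>. (\<Sum>i\<in>I. c i * \<epsilon> (s i) \<omega>)\<^sup>2)"
    and "(LINT \<omega>|N. (\<Sum>i\<in>I. c i * \<epsilon> (s i) \<omega>)\<^sup>2) = quad_form I c s R"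
proof -
  interpret N: prob_space N by fact
  have m[measurable]: "\<epsilon> t \<in> borel_measurable N" and sq: "integrable N (\<lambda>\<omega>. (\<epsilon> t \<omega>)\<^sup>2)"
    if "t \<in> {0..1}" for t using so that by (auto simp: second_order_process_def)
  have i1: "integrable N (\<epsilon> t)" if "t \<in> {0..1}" for t
    by (rule N.integrable_of_square[OF m[OF that] sq[OF that]])
  have i2: "integrable N (\<lambda>\<omega>. \<epsilon> t \<omega> * \<epsilon> u \<omega>)" if t: "t \<in> {0..1}" and u: "u \<in> {0..1}" for t u
  proof (rule Bochner_Integration.integrable_bound)
    show "integrable N (\<lambda>\<omega>. (\<epsilon> t \<omega>)\<^sup>2 + (\<epsilon> u \<omega>)\<^sup>2)" using sq[OF t] sq[OF u] by simp
    show "(\<lambda>\<omega>. \<epsilon> t \<omega> * \<epsilon> u \<omega>) \<in> borel_measurable N" using m[OF t] m[OF u] by simp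
    have "\<bar>a * b\<bar> \<le> a\<^sup>2 + b\<^sup>2" for a b :: real
    proof -
      have "0 \<le> (\<bar>a\<bar> - \<bar>b\<bar>)\<^sup>2" by simp
      then have "2 * (\<bar>a\<bar> * \<bar>b\<bar>) \<le> a\<^sup>2 + b\<^sup>2" by (simp add: power2_diff)
      moreover have "0 \<le> \<bar>a\<bar> * \<bar>b\<bar>" by simp
      ultimately show ?thesis unfolding abs_mult by linarith
    qed
    then show "AE \<omega> in N. norm (\<epsilon> t \<omega> * \<epsilon> u \<omega>) \<le> norm ((\<epsilon> t \<omega>)\<^sup>2 + (\<epsilon> u \<omega>)\<^sup>2)" by simp
  qed
  \<comment> \<open>Centering makes the autocovariance a plain mixed moment.\<close>
  have e2: "(LINT \<omega>|N. \<epsilon> t \<omega> * \<epsilon> u \<omega>) = R t u" if "t \<in> {0..1}" "u \<in> {0..1}" for t u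
    using cov[OF that] ce that by (simp add: autocovariance_def centered_process_def)
  have si: "s i \<in> {0..1}" if "i \<in> I" for i using s that by auto
  show "(\<lambda>\<omega>. \<Sum>i\<in>I. c i * \<epsilon> (s i) \<omega>) \<in> borel_measurable N"
    by (intro borel_measurable_sum borel_measurable_times borel_measurable_const m si)
  have "(LINT \<omega>|N. (\<Sum>i\<in>I. c i * \<epsilon> (s i) \<omega>)) = (\<Sum>i\<in>I. LINT \<omega>|N. c i * \<epsilon> (s i) \<omega>)"
    by (intro Bochner_Integration.integral_sum integrable_mult_right i1 si)
  also have "\<dots> = 0"
    using ce si by (intro sum.neutral ballI) (simp add: centered_process_def)
  finally show "(LINT \<omega>|N. (\<Sum>i\<in>I. c i * \<epsilon> (s i) \<omega>)) = 0" .
  have eq: "(\<Sum>i\<in>I. c i * \<epsilon> (s i) \<omega>)\<^sup>2 = (\<Sum>i\<in>I. \<Sum>j\<in>I. c i * c j * (\<epsilon> (s i) \<omega> * \<epsilon> (s j) \<omega>))" for \<omega>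
    by (simp add: power2_eq_square sum_product mult_ac)
  show "integrable N (\<lambda>\<omega>. (\<Sum>i\<in>I. c i * \<epsilon> (s i) \<omega>)\<^sup>2)"
    unfolding eq by (intro Bochner_Integration.integrable_sum integrable_mult_right i2 si)
  have "(LINT \<omega>|N. (\<Sum>i\<in>I. c i * \<epsilon> (s i) \<omega>)\<^sup>2) =
      (\<Sum>i\<in>I. \<Sum>j\<in>I. LINT \<omega>|N. c i * c j * (\<epsilon> (s i) \<omega> * \<epsilon> (s j) \<omega>))"
    unfolding eq by (subst Bochner_Integration.integral_sum Bochner_Integration.integral_sum;
        intro Bochner_Integration.integrable_sum integrable_mult_right i2 si sum.cong refl
          Bochner_Integration.integral_sum)
  also have "\<dots> = quad_form I c s R"
    unfolding quad_form_def using e2 si by (intro sum.cong refl) simp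
  finally show "(LINT \<omega>|N. (\<Sum>i\<in>I. c i * \<epsilon> (s i) \<omega>)\<^sup>2) = quad_form I c s R" .
qed

text \<open>A finite combination of values is a measurable function \<open>\<Psi>\<close> of the
  sample path, and both independence and equality of laws are given at the level of sample
  paths.\<close>

lemma iid_copies_combination:
  fixes s c :: "'i \<Rightarrow> real"
  assumes M: "prob_space M" and iid: "iid_copies M E N \<epsilon>"
    and so: "second_order_process N \<epsilon>"
    and I: "finite I" and s: "s ` I \<subseteq> {0..1}"
  shows "prob_space.indep_vars M (\<lambda>_. borel) (\<lambda>j \<omega>. \<Sum>i\<in>I. c i * E j (s i) \<omega>) {1..}"
    and "j \<ge> 1 \<Longrightarrow> distr M borel (\<lambda>\<omega>. \<Sum>i\<in>I. c i * E j (s i) \<omega>) =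
      distr N borel (\<lambda>\<omega>. \<Sum>i\<in>I. c i * \<epsilon> (s i) \<omega>)"
proof -
  interpret prob_space M by fact
  define \<Psi> where "\<Psi> = (\<lambda>q :: real \<Rightarrow> real. \<Sum>i\<in>I. c i * q (s i))"
  have si: "s i \<in> {0..1}" if "i \<in> I" for i using s that by auto
  have \<Psi>m: "\<Psi> \<in> measurable path_space borel"
    unfolding \<Psi>_def
    by (intro borel_measurable_sum borel_measurable_times borel_measurable_const
        measurable_component_singleton si)
  have eq: "(\<Sum>i\<in>I. c i * X (s i) \<omega>) = \<Psi> (sample_path X \<omega>)" for X :: "real \<Rightarrow> 'z \<Rightarrow> real" and \<omega>
    unfolding \<Psi>_def sample_path_def using si by (intro sum.cong) auto
  have ind: "indep_vars (\<lambda>_. path_space) (\<lambda>j. sample_path (E j)) {1..}"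
    using iid by (simp add: iid_copies_def)
  show "indep_vars (\<lambda>_. borel) (\<lambda>j \<omega>. \<Sum>i\<in>I. c i * E j (s i) \<omega>) {1..}"
    unfolding eq by (rule indep_vars_compose2[OF ind \<Psi>m])
  assume j: "j \<ge> 1"
  have sE: "sample_path (E j) \<in> measurable M path_space"
    using ind j by (auto simp: indep_vars_def2)
  have se: "sample_path \<epsilon> \<in> measurable N path_space"
    unfolding sample_path_def using so by (intro measurable_restrict) (auto simp: second_order_process_def)
  have "distr M borel (\<lambda>\<omega>. \<Psi> (sample_path (E j) \<omega>)) = distr (distr M path_space (sample_path (E j))) borel \<Psi>"
    using distr_distr[OF \<Psi>m sE] by (simp add: o_def)
  also have "\<dots> = distr (distr N path_space (sample_path \<epsilon>)) borel \<Psi>"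
    using iid j by (simp add: iid_copies_def)
  also have "\<dots> = distr N borel (\<lambda>\<omega>. \<Psi> (sample_path \<epsilon> \<omega>))"
    using distr_distr[OF \<Psi>m se] by (simp add: o_def)
  finally show "distr M borel (\<lambda>\<omega>. \<Sum>i\<in>I. c i * E j (s i) \<omega>) = distr N borel (\<lambda>\<omega>. \<Sum>i\<in>I. c i * \<epsilon> (s i) \<omega>)"
    unfolding eq .
qed

text \<open>The copies are known only through their law, so moments and integrability are carried
  over from \<open>\<epsilon>\<close> by integrating against the common distribution.\<close>

lemma iid_copies_moments:
  fixes s c :: "'i \<Rightarrow> real"
  assumes M: "prob_space M" and N: "prob_space N" and iid: "iid_copies M E N \<epsilon>"
    and so: "second_order_process N \<epsilon>" and ce: "centered_process N \<epsilon>"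
    and cov: "\<And>s t. s \<in> {0..1} \<Longrightarrow> t \<in> {0..1} \<Longrightarrow> R s t = autocovariance N \<epsilon> s t"
    and I: "finite I" and s: "s ` I \<subseteq> {0..1}" and j: "j \<ge> 1"
  shows "(LINT \<omega>|M. (\<Sum>i\<in>I. c i * E j (s i) \<omega>)) = 0"
    and "integrable M (\<lambda>\<omega>. (\<Sum>i\<in>I. c i * E j (s i) \<omega>)\<^sup>2)"
    and "(LINT \<omega>|M. (\<Sum>i\<in>I. c i * E j (s i) \<omega>)\<^sup>2) = quad_form I c s R"
proof -
  let ?X = "\<lambda>\<omega>. \<Sum>i\<in>I. c i * E j (s i) \<omega>" and ?Y = "\<lambda>\<omega>. \<Sum>i\<in>I. c i * \<epsilon> (s i) \<omega>"
  note pc = process_combination[OF N so ce cov I s, of c]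
  have d: "distr M borel ?X = distr N borel ?Y" by (rule iid_copies_combination(2)[OF M iid so I s j])
  have X[measurable]: "?X \<in> borel_measurable M"
    using iid_copies_combination(1)[OF M iid so I s, of c] j
    by (auto simp: prob_space.indep_vars_def2[OF M])
  note Y[measurable] = pc(1)
  have "(LINT \<omega>|M. ?X \<omega>) = (LINT z|distr M borel ?X. z)" by (rule integral_distr[symmetric]) simp_all
  also have "\<dots> = (LINT \<omega>|N. ?Y \<omega>)" unfolding d by (rule integral_distr) simp_all
  finally show "(LINT \<omega>|M. ?X \<omega>) = 0" using pc(2) by simp
  have "(LINT \<omega>|M. (?X \<omega>)\<^sup>2) = (LINT z|distr M borel ?X. z\<^sup>2)" by (rule integral_distr[symmetric]) simp_all
  also have "\<dots> = (LINT \<omega>|N. (?Y \<omega>)\<^sup>2)" unfolding d by (rule integral_distr) simp_all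
  finally show "(LINT \<omega>|M. (?X \<omega>)\<^sup>2) = quad_form I c s R" using pc(4) by simp
  have "integrable (distr N borel ?Y) (\<lambda>z. z\<^sup>2)" using pc(3) by (subst integrable_distr_eq) simp_all
  then have "integrable (distr M borel ?X) (\<lambda>z. z\<^sup>2)" unfolding d .
  then show "integrable M (\<lambda>\<omega>. (?X \<omega>)\<^sup>2)" by (subst (asm) integrable_distr_eq) simp_all
qed

section \<open>Explicit bounds for the bias functional, the energy and the noise\<close>

context kinked_quadrature
begin

text \<open>Subtracting kernel sections at the first and last node leaves the defect of
  \<open>g\<close> unchanged, since \<open>resid\<close> vanishes at nodes, and makes
  \<open>defect_bound\<close> applicable. \<open>Ba\<close> bounds the two coefficients,
  \<open>B\<close> the corrected function \<open>\<gamma>\<close>, and \<open>L\<close> is a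
  Lipschitz constant of \<open>\<gamma> / \<alpha>\<close> on the window.\<close>

lemma defect_bound_smooth:
  fixes g :: "real \<Rightarrow> real"
  assumes g: "continuous_on {0..1} g" and Bg: "\<And>s. s \<in> {0..1} \<Longrightarrow> \<bar>g s\<bar> \<le> Bg"
    and BR: "\<And>s t. s \<in> {0..1} \<Longrightarrow> t \<in> {0..1} \<Longrightarrow> \<bar>R s t\<bar> \<le> BR"
    and c0: "c0 > 0" "c0 \<le> \<bar>R (p 0) (p 0) * R 1 1 - (R (p 0) 1)\<^sup>2\<bar>"
    and Lg: "\<And>s t. s \<in> {lo..hi} \<Longrightarrow> t \<in> {lo..hi} \<Longrightarrow> \<bar>g s - g t\<bar> \<le> Lg * \<bar>s - t\<bar>"
    and LR: "\<And>s t u. s \<in> {lo..hi} \<Longrightarrow> t \<in> {lo..hi} \<Longrightarrow> u \<in> {p 0, 1} \<Longrightarrow> \<bar>R s u - R t u\<bar> \<le> LR * \<bar>s - t\<bar>"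
    and La: "\<And>s t. s \<in> {lo..hi} \<Longrightarrow> t \<in> {lo..hi} \<Longrightarrow> \<bar>\<alpha> s - \<alpha> t\<bar> \<le> La * \<bar>s - t\<bar>"
    and nonneg: "Lg \<ge> 0" "LR \<ge> 0" "La \<ge> 0"
    and defs: "Ba = 2 * Bg * BR / c0" "B = Bg + 2 * (Ba * BR)" "L = (Lg + 2 * (Ba * LR)) / a0 + B * La / a0\<^sup>2"
  shows "\<bar>defect g\<bar> \<le> 2 * M * (A * (L * \<delta>)) + 2 * (B / a0 * C * sqrt energy)"
proof -
  have p0: "p 0 \<in> {0..1}" using p_mem n_pos by simp
  have Bg0: "Bg \<ge> 0" using Bg[of 0] by force
  have BR0: "BR \<ge> 0" using BR[of 0 0] by force
  have Ba0: "Ba \<ge> 0" using Bg0 BR0 c0 by (simp add: defs)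
  have B0: "B \<ge> 0" using Bg0 BR0 Ba0 by (simp add: defs(2))
  define D where "D = R (p 0) (p 0) * R 1 1 - (R (p 0) 1)\<^sup>2"
  have D: "D \<noteq> 0" "c0 \<le> \<bar>D\<bar>" using c0 by (auto simp: D_def)
  \<comment> \<open>Cramer's rule for the two-by-two system that makes \<open>\<gamma>\<close>
    vanish at \<open>p 0\<close> and at 1; the lower bound \<open>c0\<close> on the determinant
    keeps both coefficients below \<open>Ba\<close>.\<close>
  define a where "a = (g (p 0) * R 1 1 - g 1 * R (p 0) 1) / D"
  define b where "b = (g 1 * R (p 0) (p 0) - g (p 0) * R (p 0) 1) / D"
  define \<gamma> where "\<gamma> s = g s + (- a * R s (p 0) + - b * R s 1)" for s
  have num: "\<bar>u * v - u' * v'\<bar> \<le> 2 * Bg * BR" if "\<bar>u\<bar> \<le> Bg" "\<bar>v\<bar> \<le> BR" "\<bar>u'\<bar> \<le> Bg" "\<bar>v'\<bar> \<le> BR" for u v u' v'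
  proof -
    have "\<bar>u * v\<bar> \<le> Bg * BR" "\<bar>u' * v'\<bar> \<le> Bg * BR"
      unfolding abs_mult using that Bg0 by (auto intro: mult_mono)
    then show ?thesis by linarith
  qed
  have ab: "\<bar>a\<bar> \<le> Ba" "\<bar>b\<bar> \<le> Ba"
    unfolding a_def b_def defs abs_divide
    using p0 D c0(1) Bg0 BR0 by (auto intro!: frac_le num Bg BR)
  have sym: "R 1 (p 0) = R (p 0) 1" using p0 by (intro R_sym) auto
  have "a * R (p 0) (p 0) + b * R (p 0) 1 = g (p 0) * D / D"
    unfolding a_def b_def D_def by (simp add: add_divide_distrib[symmetric] algebra_simps power2_eq_square)
  then have \<gamma>0: "\<gamma> (p 0) = 0" using D by (simp add: \<gamma>_def)
  have "a * R 1 (p 0) + b * R 1 1 = g 1 * D / D"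
    unfolding a_def b_def D_def sym by (simp add: add_divide_distrib[symmetric] algebra_simps power2_eq_square)
  then have \<gamma>1: "\<gamma> 1 = 0" using D by (simp add: \<gamma>_def)
  have cont: "continuous_on {0..1} (\<lambda>s. - a * R s (p 0))" "continuous_on {0..1} (\<lambda>s. - b * R s 1)"
    using p0 by (auto intro!: continuous_intros R_slice)
  have \<gamma>c: "continuous_on {0..1} \<gamma>"
    unfolding \<gamma>_def by (intro continuous_on_add g cont)
  have "defect \<gamma> = defect g + (- a * resid (p 0) + - b * resid 1)"
    unfolding \<gamma>_def
    by (subst defect_add[OF g continuous_on_add[OF cont]], subst defect_add[OF cont], simp only: defect_cmult resid_def)
  moreover have "resid (p 0) = 0" "resid 1 = 0"
    using resid_node[of 0] resid_node[of "n - 1"] n_pos p_last by auto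
  ultimately have dg: "defect \<gamma> = defect g" by simp
  have ml: "\<bar>k * r\<bar> \<le> Ba * Y" if "\<bar>k\<bar> \<le> Ba" "\<bar>r\<bar> \<le> Y" for k r Y
    unfolding abs_mult using that Ba0 by (intro mult_mono) auto
  have \<gamma>B: "\<bar>\<gamma> s\<bar> \<le> B" if "s \<in> {0..1}" for s
    using Bg[OF that] ml[OF ab(1) BR[OF that p0]] ml[OF ab(2) BR[OF that, of 1]]
    unfolding \<gamma>_def defs(2) by auto
  have sub: "{lo..hi} \<subseteq> {0<..<1}" using window by auto
  have \<gamma>L: "\<bar>\<gamma> s - \<gamma> t\<bar> \<le> (Lg + 2 * (Ba * LR)) * \<bar>s - t\<bar>" if st: "s \<in> {lo..hi}" "t \<in> {lo..hi}" for s t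
  proof -
    have "\<gamma> s - \<gamma> t = (g s - g t) - a * (R s (p 0) - R t (p 0)) - b * (R s 1 - R t 1)"
      by (simp add: \<gamma>_def algebra_simps)
    moreover have "\<bar>a * (R s (p 0) - R t (p 0))\<bar> \<le> Ba * (LR * \<bar>s - t\<bar>)" "\<bar>b * (R s 1 - R t 1)\<bar> \<le> Ba * (LR * \<bar>s - t\<bar>)"
      using st by (auto intro!: ml ab LR)
    moreover have "(Lg + 2 * (Ba * LR)) * \<bar>s - t\<bar> = Lg * \<bar>s - t\<bar> + Ba * (LR * \<bar>s - t\<bar>) + Ba * (LR * \<bar>s - t\<bar>)"
      by (simp add: algebra_simps)
    ultimately show ?thesis using Lg[OF st] by linarith
  qed
  have quotL: "\<bar>\<gamma> s / \<alpha> s - \<gamma> t / \<alpha> t\<bar> \<le> L * \<bar>s - t\<bar>" if st: "s \<in> {lo..hi}" "t \<in> {lo..hi}" for s t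
  proof -
    have al: "a0 \<le> \<alpha> s" "a0 \<le> \<alpha> t" using \<alpha>_bounds[of s] \<alpha>_bounds[of t] st sub by auto
    then have pos: "\<alpha> s > 0" "\<alpha> t > 0" using a0 by auto
    have tb: "\<bar>\<gamma> t\<bar> \<le> B" using \<gamma>B[of t] st(2) sub by auto
    have eq: "\<gamma> s / \<alpha> s - \<gamma> t / \<alpha> t = (\<gamma> s - \<gamma> t) / \<alpha> s + \<gamma> t * (\<alpha> t - \<alpha> s) / (\<alpha> s * \<alpha> t)"
      using pos by (simp add: field_simps)
    have t1: "\<bar>(\<gamma> s - \<gamma> t) / \<alpha> s\<bar> \<le> (Lg + 2 * (Ba * LR)) * \<bar>s - t\<bar> / a0"
      unfolding abs_divide using \<gamma>L[OF st] al pos a0 by (intro frac_le) auto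
    have t2: "\<bar>\<gamma> t * (\<alpha> t - \<alpha> s) / (\<alpha> s * \<alpha> t)\<bar> \<le> B * (La * \<bar>s - t\<bar>) / (a0 * a0)"
    proof -
      have "\<bar>\<gamma> t * (\<alpha> t - \<alpha> s)\<bar> \<le> B * (La * \<bar>s - t\<bar>)"
        unfolding abs_mult using tb La[OF st(2,1)] B0 by (intro mult_mono) (auto simp: abs_minus_commute)
      moreover have "a0 * a0 \<le> \<bar>\<alpha> s * \<alpha> t\<bar>"
        using mult_mono[OF al] a0 pos by (simp add: abs_mult)
      ultimately show ?thesis unfolding abs_divide[of _ "\<alpha> s * \<alpha> t"] using a0 by (intro frac_le) auto
    qed
    have t3: "L * \<bar>s - t\<bar> = (Lg + 2 * (Ba * LR)) * \<bar>s - t\<bar> / a0 + B * (La * \<bar>s - t\<bar>) / (a0 * a0)"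
      unfolding defs(3) by (simp add: power2_eq_square distrib_right)
    show ?thesis unfolding eq t3 by (rule order_trans[OF abs_triangle_ineq add_mono[OF t1 t2]])
  qed
  have "L \<ge> 0" unfolding defs(3) using nonneg Ba0 B0 a0 by simp
  from defect_bound[OF \<gamma>c \<gamma>0 \<gamma>1 \<gamma>B quotL this] show ?thesis by (simp add: dg)
qed

text \<open>The square root is linearised by \<open>sqrt energy \<le> 1 + energy\<close>; for a
  small mesh the resulting energy term on the right is at most half the energy and is absorbed on
  the left.\<close>

lemma energy_le:
  assumes small: "4 * M * C * \<delta>\<^sup>2 \<le> 1" and h: "h \<le> 1"
  shows "energy \<le> 4 * M * (M * A + C) * (\<delta>\<^sup>2 / h)"
proof -
  have "sqrt energy \<le> 1 + energy"
  proof (rule real_le_lsqrt)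
    show "energy \<le> (1 + energy)\<^sup>2" using energy_nonneg by (simp add: power2_eq_square algebra_simps)
  qed (use energy_nonneg in auto)
  then have "C * sqrt energy \<le> C * (1 + energy)" using C_nonneg by (rule mult_left_mono)
  also have "\<dots> \<le> C / h + C * energy"
  proof -
    have "C * h \<le> C" using h C_nonneg by (simp add: mult_left_le)
    then have "C \<le> C / h" using h_pos by (simp add: le_divide_eq)
    then show ?thesis by (simp add: distrib_left)
  qed
  finally have "M * A / h + C * sqrt energy \<le> (M * A + C) / h + C * energy"
    by (simp add: add_divide_distrib)
  then have "2 * M * (\<delta>\<^sup>2 * (M * A / h + C * sqrt energy)) \<le> 2 * M * (\<delta>\<^sup>2 * ((M * A + C) / h + C * energy))"
    using M_nonneg by (intro mult_left_mono) auto
  then have "energy \<le> 2 * M * (\<delta>\<^sup>2 * ((M * A + C) / h + C * energy))" using energy_bound by linarith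
  also have "\<dots> = 2 * M * (M * A + C) * (\<delta>\<^sup>2 / h) + (4 * M * C * \<delta>\<^sup>2) * (energy / 2)"
    by (simp add: algebra_simps add_divide_distrib)
  also have "(4 * M * C * \<delta>\<^sup>2) * (energy / 2) \<le> 1 * (energy / 2)"
    using small energy_nonneg by (intro mult_right_mono) auto
  finally show ?thesis by simp
qed

text \<open>The extra index \<open>n\<close> carries the point \<open>x\<close> with coefficient -1,
  so the form is the variance of the weighted noise minus the noise at \<open>x\<close>.
  \<open>energy_eq\<close> and \<open>resid_eq\<close> rewrite the square and the mixed
  term.\<close>

lemma noise_quad:
  "quad_form {..<Suc n} (\<lambda>i. if i < n then w i else -1) (\<lambda>i. if i < n then p i else x) R =
    integral {0..1} (\<lambda>s. \<phi> s * smooth s) - energy - 2 * smooth x + 2 * resid x + R x x"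
proof -
  have x: "x \<in> {0..1}" using window h_pos \<delta>_nonneg by auto
  have "(\<Sum>i<n. w i * R x (p i)) = (\<Sum>i<n. w i * R (p i) x)"
    using p_mem x R_sym by (intro sum.cong) auto
  then have "quad_form {..<Suc n} (\<lambda>i. if i < n then w i else -1) (\<lambda>i. if i < n then p i else x) R =
     quad_form {..<n} w p R - 2 * (\<Sum>i<n. w i * R (p i) x) + R x x"
    unfolding quad_form_def by (simp add: sum.distrib sum_negf sum_subtractf)
  then show ?thesis by (simp add: energy_eq resid_eq)
qed

text \<open>As \<open>\<phi>\<close> has mass 1, the double integral and \<open>smooth x\<close> are
  both close to \<open>R x x\<close>, and the coefficients 1, -2 and 1 cancel. The energy enters
  with a minus sign and may be dropped.\<close>

lemma noise_quad_bound:
  assumes one: "(\<phi> has_integral 1) {0..1}"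
    and e: "\<And>s t. s \<in> {x - h..x + h} \<Longrightarrow> t \<in> {0..1} \<Longrightarrow> \<bar>R s t - R x t\<bar> \<le> e"
  shows "quad_form {..<Suc n} (\<lambda>i. if i < n then w i else -1) (\<lambda>i. if i < n then p i else x) R
    \<le> 2 * M * (2 * M * e) + 6 * M * e + 2 * \<bar>resid x\<bar>"
proof -
  have x: "x \<in> {0..1}" using window h_pos \<delta>_nonneg by auto
  have ic: "integral {0..1} (\<lambda>s. \<phi> s * c) = c" for c
    using integral_unique[OF has_integral_mult_left[OF one, of c]] by (simp only: mult_1)
  have diff: "\<bar>integral {0..1} (\<lambda>s. \<phi> s * k s) - c\<bar> \<le> 2 * M * Y"
    if k: "continuous_on {0..1} k" and Y: "\<And>s. s \<in> {x - h..x + h} \<Longrightarrow> \<bar>k s - c\<bar> \<le> Y" for k c Y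
  proof -
    have "integral {0..1} (\<lambda>s. \<phi> s * k s) - c = integral {0..1} (\<lambda>s. \<phi> s * (k s - c))"
      using Henstock_Kurzweil_Integration.integral_diff[OF integrable_phi_mult[OF k]
          integrable_phi_mult[OF continuous_on_const[of _ c]]] ic[of c]
      by (simp add: right_diff_distrib)
    then show ?thesis using phi_integral_bound[of "\<lambda>s. k s - c" Y] k Y by (simp add: continuous_on_diff)
  qed
  have sm: "\<bar>smooth t - R x t\<bar> \<le> 2 * M * e" if t: "t \<in> {0..1}" for t
    unfolding smooth_def using t by (intro diff R_slice e)
  have win: "{x - h..x + h} \<subseteq> {0..1}" using window \<delta>_nonneg by auto
  have "\<bar>integral {0..1} (\<lambda>s. \<phi> s * smooth s) - R x x\<bar> \<le> 2 * M * (2 * M * e + e)"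
  proof (intro diff smooth_cont)
    fix s assume s: "s \<in> {x - h..x + h}"
    then have s': "s \<in> {0..1}" using win by blast
    show "\<bar>smooth s - R x x\<bar> \<le> 2 * M * e + e"
      using sm[OF s'] e[OF s x] R_sym[OF x s'] by linarith
  qed
  then show ?thesis unfolding noise_quad using sm[OF x] energy_nonneg by (simp add: algebra_simps)
qed

end

section \<open>Asymptotics\<close>

lemma gram_single_nonzero:
  assumes "invertible_mat (gram R [x])"
  shows "R x x \<noteq> 0"
proof -
  have "gram R [x] \<in> carrier_mat 1 1" by (simp add: gram_def)
  then obtain B where B: "B * gram R [x] = 1\<^sub>m 1" "B \<in> carrier_mat 1 1"
    using invertible_mat_inverse[OF _ assms] by blast
  have "(B * gram R [x]) $$ (0, 0) = B $$ (0, 0) * R x x"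
    using B(2) by (simp add: gram_def scalar_prod_def)
  then show ?thesis using B(1) by auto
qed

text \<open>If the determinant vanished, the first row of the inverse would force
  \<open>R t t = 0\<close> and then \<open>R s t = 0\<close>, contradicting the last diagonal entry
  of the identity.\<close>

lemma gram_pair_nonzero:
  assumes inv: "invertible_mat (gram R [s, t])" and sym: "R t s = R s t"
  shows "R s s * R t t - (R s t)\<^sup>2 \<noteq> 0"
proof
  assume z: "R s s * R t t - (R s t)\<^sup>2 = 0"
  have "gram R [s, t] \<in> carrier_mat 2 2" by (simp add: gram_def numeral_2_eq_2)
  then obtain B where B: "B * gram R [s, t] = 1\<^sub>m 2" "B \<in> carrier_mat 2 2"
    using invertible_mat_inverse[OF _ inv] by blast
  have e: "(B * gram R [s, t]) $$ (i, j) = B $$ (i, 0) * R s ([s, t] ! j) + B $$ (i, 1) * R t ([s, t] ! j)"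
    if "i < 2" "j < 2" for i j
    using B(2) that by (simp add: gram_def scalar_prod_def numeral_2_eq_2)
  have r: "B $$ (0, 0) * R s s + B $$ (0, 1) * R s t = 1" "B $$ (0, 0) * R s t + B $$ (0, 1) * R t t = 0"
      "B $$ (1, 0) * R s s + B $$ (1, 1) * R s t = 0" "B $$ (1, 0) * R s t + B $$ (1, 1) * R t t = 1"
    using e[of 0 0] e[of 0 1] e[of 1 0] e[of 1 1] sym by (simp_all add: B(1))
  have "R t t = R t t * (B $$ (0, 0) * R s s + B $$ (0, 1) * R s t)" using r(1) by simp
  also have "\<dots> = B $$ (0, 0) * (R s s * R t t - (R s t)\<^sup>2) + R s t * (B $$ (0, 0) * R s t + B $$ (0, 1) * R t t)"
    by (simp add: algebra_simps power2_eq_square)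
  finally have tt: "R t t = 0" unfolding z r(2) by simp
  then have "R s t = 0" using z by simp
  then show False using r(4) tt by simp
qed

lemma C2_on_Lipschitz:
  assumes "C2_on {0..1} g"
  obtains L where "L \<ge> 0" "\<And>s t. s \<in> {0..1} \<Longrightarrow> t \<in> {0..1} \<Longrightarrow> \<bar>g s - g t\<bar> \<le> L * \<bar>s - t\<bar>"
proof -
  obtain g' g'' where g': "\<And>t. t \<in> {0..1} \<Longrightarrow> (g has_real_derivative g' t) (at t within {0..1})"
    and g'': "\<And>t. t \<in> {0..1} \<Longrightarrow> (g' has_real_derivative g'' t) (at t within {0..1})"
    using assms unfolding C2_on_def by blast
  have "continuous_on {0..1} g'" using g'' by (rule DERIV_continuous_on)
  then obtain D where D: "D > 0" "\<And>s. s \<in> {0..1} \<Longrightarrow> \<bar>g' s\<bar> \<le> D"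
    using compact_bound[OF compact_Icc] by blast
  have "norm (g s - g t) \<le> D * norm (s - t)" if "s \<in> {0..1}" "t \<in> {0..1}" for s t
    by (rule field_differentiable_bound[of "{0..1}" g g']) (use that D g' in auto)
  then show ?thesis using that[of D] D(1) by simp
qed

text \<open>The first node will lie in \<open>{0..lo / 2}\<close> and the last one is 1. Both stay
  away from the window, so the relevant pairs form a compact set off the diagonal, where the
  derivative is bounded; the constant does not depend on the design.\<close>

lemma off_diag_Lipschitz:
  assumes A: "assumption_A R" and lo: "0 < lo" and hi: "hi < 1"
  obtains L where "L \<ge> 0" "\<And>u s t. u \<in> {0..lo / 2} \<union> {1} \<Longrightarrow> s \<in> {lo..hi} \<Longrightarrow> t \<in> {lo..hi} \<Longrightarrow>
    \<bar>R u s - R u t\<bar> \<le> L * \<bar>s - t\<bar>"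
proof -
  have "Ck_off_diag 2 R" using A by (simp add: assumption_A_def)
  then have C1: "continuous_on off_diag (\<lambda>(s, t). dsnd R s t)"
    and R1: "\<And>u t. (u, t) \<in> off_diag \<Longrightarrow> (\<lambda>v. R u v) differentiable (at t within {0..1})"
    by (auto simp: numeral_2_eq_2)
  define S where "S = ({0..lo / 2} \<union> {1}) \<times> {lo..hi}"
  have S: "(u, t) \<in> off_diag" if "u \<in> {0..lo / 2} \<union> {1}" "t \<in> {lo..hi}" for u t
    using that lo hi by (auto simp: off_diag_def)
  then have "S \<subseteq> off_diag" by (auto simp: S_def)
  then have "continuous_on S (\<lambda>(s, t). dsnd R s t)" by (rule continuous_on_subset[OF C1])
  moreover have "compact S" by (auto simp: S_def intro!: compact_Times compact_Un)
  ultimately obtain D where D: "D > 0" "\<And>z. z \<in> S \<Longrightarrow> \<bar>(\<lambda>(s, t). dsnd R s t) z\<bar> \<le> D"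
    using compact_bound by blast
  have "norm (R u s - R u t) \<le> D * norm (s - t)"
    if u: "u \<in> {0..lo / 2} \<union> {1}" and st: "s \<in> {lo..hi}" "t \<in> {lo..hi}" for u s t
  proof (rule field_differentiable_bound[of "{lo..hi}" "R u" "dsnd R u"])
    fix v assume v: "v \<in> {lo..hi}"
    have "((\<lambda>v. R u v) has_real_derivative dsnd R u v) (at v within {0..1})"
      using dsnd_has_derivative[of R u v] R1[OF S[OF u v]] by simp
    then show "(R u has_real_derivative dsnd R u v) (at v within {lo..hi})"
      using lo hi by (auto intro: has_field_derivative_subset)
    show "norm (dsnd R u v) \<le> D" using D(2)[of "(u, v)"] u v by (auto simp: S_def)
  qed (use st in auto)
  then show ?thesis using that[of D] D(1) by simp
qed

text \<open>The deterministic half of the argument: the quadrature constants are chosen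
  independently of \<open>k\<close>, so the explicit bounds become rates in \<open>h\<close> and in
  the mesh \<open>\<delta> = d / n\<close>.\<close>

lemma projection_asymptotics:
  fixes R :: "real \<Rightarrow> real \<Rightarrow> real" and K f g :: "real \<Rightarrow> real" and x :: real
    and n m :: "nat \<Rightarrow> nat" and h :: "nat \<Rightarrow> real"
  assumes R_cont: "continuous_on ({0..1} \<times> {0..1}) (\<lambda>(s, t). R s t)"
    and R_sym: "\<And>s t. s \<in> {0..1} \<Longrightarrow> t \<in> {0..1} \<Longrightarrow> R s t = R t s"
    and psd: "\<And>(I :: (nat + nat) set) c s. finite I \<Longrightarrow> s ` I \<subseteq> {0..1} \<Longrightarrow> 0 \<le> quad_form I c s R"
    and psd': "\<And>(I :: nat set) c s. finite I \<Longrightarrow> s ` I \<subseteq> {0..1} \<Longrightarrow> 0 \<le> quad_form I c s R"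
    and nonsingular: "\<And>ts. distinct ts \<Longrightarrow> set ts \<subseteq> {0..1} \<Longrightarrow> invertible_mat (gram R ts)"
    and g: "C2_on {0..1} g" and kernel: "smoothing_kernel K" and rkhs: "is_rkhs {0..1} R H ip"
    and A: "assumption_A R" and B: "assumption_B R" and C: "assumption_C R H ip"
    and density: "design_density f" and x: "x \<in> {0<..<1}" and h: "\<And>k. h k \<in> {0<..<1}"
    and n_pos: "\<And>k. n k > 0"
    and n_lim: "filterlim n at_top sequentially" and h_lim: "h \<longlonglongrightarrow> 0"
    and nh_lim: "filterlim (\<lambda>k. real (n k) * h k) at_top sequentially"
    and m_n: "(\<lambda>k. real (m k) / real (n k)) \<in> O(\<lambda>_. 1)"
    and mh2_lim: "(\<lambda>k. sqrt (real (m k)) * (h k)\<^sup>2) \<longlonglongrightarrow> 0"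
  defines "p \<equiv> \<lambda>k i. regular_design f (n k) ! i"
    and "w \<equiv> \<lambda>k. proj_weight R K x (h k) (regular_design f (n k))"
  shows "(\<lambda>k. sqrt (real (m k)) * ((\<Sum>i<n k. w k i * g (p k i)) - g x)) \<longlonglongrightarrow> 0"
    and "(\<lambda>k. quad_form {..<Suc (n k)} (\<lambda>i. if i < n k then w k i else -1)
      (\<lambda>i. if i < n k then p k i else x) R) \<longlonglongrightarrow> 0"
proof -
  obtain M where M: "M \<ge> 0" "\<And>u. \<bar>K u\<bar> \<le> M" "\<And>u. u \<notin> {-1..1} \<Longrightarrow> K u = 0" "continuous_on UNIV K"
    using smoothing_kernel_props[OF kernel] by metis
  obtain d where d: "d > 0" "\<And>n. n > 0 \<Longrightarrow> length (regular_design f n) = n"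
    "\<And>n i. i < n \<Longrightarrow> regular_design f n ! i \<in> {0..1}"
    "\<And>n i. Suc i < n \<Longrightarrow> regular_design f n ! i < regular_design f n ! Suc i"
    "\<And>n i. Suc i < n \<Longrightarrow> regular_design f n ! Suc i \<le> regular_design f n ! i + d / real n"
    "\<And>n. n > 0 \<Longrightarrow> 0 < regular_design f n ! 0" "\<And>n. n > 0 \<Longrightarrow> regular_design f n ! 0 \<le> d / real n"
    "\<And>n. n > 0 \<Longrightarrow> regular_design f n ! (n - 1) = 1"
    using regular_design_props[OF density] by blast
  define \<phi> where "\<phi> k = scaled_kernel K x (h k)" for k
  define \<delta> where "\<delta> k = d / real (n k)" for k
  \<comment> \<open>Halfway between \<open>x\<close> and the end points, hence a window that is
    fixed while \<open>h\<close> and the mesh shrink.\<close>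
  define lo hi where "lo = x / 2" and "hi = (1 + x) / 2"
  have lohi: "0 < lo" "hi < 1" "lo < x" "x < hi" using x by (auto simp: lo_def hi_def)
  obtain a0 where a0: "a0 > 0" "\<And>t. t \<in> {0<..<1} \<Longrightarrow> a0 \<le> jump R t"
    using B unfolding assumption_B_def by blast
  obtain Al where Al: "\<And>t. t \<in> {0<..<1} \<Longrightarrow> jump R t \<le> Al"
    using B unfolding assumption_B_def bdd_above_def by blast
  obtain La where La: "La-lipschitz_on {0<..<1} (jump R)" using B unfolding assumption_B_def by blast
  obtain C1 where C1: "\<And>t. t \<in> {0..1} \<Longrightarrow> ip_norm ip (dsnd2_right R t) \<le> C1"
    using C unfolding assumption_C_def bdd_above_def by blast
  define Cc where "Cc = max 0 C1"
  have Cc: "Cc \<ge> 0" "\<And>t. t \<in> {0..1} \<Longrightarrow> in_rk_ball R Cc (dsnd2_right R t)"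
    using C C1 by (auto simp: Cc_def assumption_C_def le_max_iff_disj intro!: rkhs_in_rk_ball[OF rkhs])
  have R_cont': "continuous_on {0..1} (\<lambda>s. R s t)" if "t \<in> {0..1}" for t
    using continuous_on_slice(1)[OF R_cont that] .
  have g_cont: "continuous_on {0..1} g" by (rule C2_on_continuous[OF g])
  obtain Bg where Bg: "Bg > 0" "\<And>s. s \<in> {0..1} \<Longrightarrow> \<bar>g s\<bar> \<le> Bg"
    using compact_bound[OF compact_Icc g_cont] by blast
  obtain BR where BR: "BR > 0" "\<And>z. z \<in> {0..1} \<times> {0..1} \<Longrightarrow> \<bar>(\<lambda>(s, t). R s t) z\<bar> \<le> BR"
    using compact_bound[OF compact_Times[OF compact_Icc compact_Icc] R_cont] by blast
  obtain Lg where Lg: "Lg \<ge> 0" "\<And>s t. s \<in> {0..1} \<Longrightarrow> t \<in> {0..1} \<Longrightarrow> \<bar>g s - g t\<bar> \<le> Lg * \<bar>s - t\<bar>"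
    using C2_on_Lipschitz[OF g] by blast
  obtain LR where LR: "LR \<ge> 0" "\<And>u s t. u \<in> {0..lo / 2} \<union> {1} \<Longrightarrow> s \<in> {lo..hi} \<Longrightarrow> t \<in> {lo..hi} \<Longrightarrow>
    \<bar>R u s - R u t\<bar> \<le> LR * \<bar>s - t\<bar>"
    using off_diag_Lipschitz[OF A lohi(1,2)] by blast
  obtain D g1 where D: "D \<ge> 0" "\<And>s. s \<in> {0..1} \<Longrightarrow> \<bar>g s - g x - g1 * (s - x)\<bar> \<le> D * (s - x)\<^sup>2"
    using C2_on_Taylor[OF g, of x] x by (auto simp: less_imp_le)
  define det where "det = (\<lambda>t. R t t * R 1 1 - (R t 1)\<^sup>2)"
  have det0: "det 0 \<noteq> 0"
    unfolding det_def using nonsingular[of "[0, 1]"] R_sym by (intro gram_pair_nonzero) auto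
  \<comment> \<open>Half of the limiting determinant: the first node tends to 0 and the last one is
    1, so by continuity the determinant of the two extreme nodes eventually exceeds
    \<open>c0\<close> in absolute value.\<close>
  define c0 where "c0 = \<bar>det 0\<bar> / 2"
  have c0: "c0 > 0" using det0 by (simp add: c0_def)
  have nr: "filterlim (\<lambda>k. real (n k)) at_top sequentially"
    by (rule filterlim_compose[OF filterlim_real_sequentially n_lim])
  have \<delta>_lim: "\<delta> \<longlonglongrightarrow> 0" unfolding \<delta>_def by (rule tendsto_divide_0[OF tendsto_const filterlim_at_top_imp_at_infinity[OF nr]])
  have p0: "0 < p k 0" "p k 0 \<le> \<delta> k" "p k 0 \<in> {0..1}" for k
    using d(6,7)[OF n_pos[of k]] d(3)[OF n_pos[of k]] by (auto simp: p_def \<delta>_def)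
  have p0_lim: "(\<lambda>k. p k 0) \<longlonglongrightarrow> 0"
    by (rule tendsto_sandwich[OF _ _ tendsto_const \<delta>_lim]) (use p0 in \<open>auto intro!: always_eventually simp: less_imp_le\<close>)
  have det_cont: "continuous_on {0..1} det"
  proof -
    have "continuous_on {0..1} ((\<lambda>(s, t). R s t) \<circ> (\<lambda>t. (t, t)))"
      by (intro continuous_on_compose continuous_intros continuous_on_subset[OF R_cont]) auto
    then have "continuous_on {0..1} (\<lambda>t. R t t)" by (simp add: o_def)
    then show ?thesis unfolding det_def by (intro continuous_intros R_cont') auto
  qed
  have "(\<lambda>k. det (p k 0)) \<longlonglongrightarrow> det 0"
    by (rule continuous_on_tendsto_compose[OF det_cont p0_lim]) (use p0 in auto)
  then have "(\<lambda>k. \<bar>det (p k 0)\<bar>) \<longlonglongrightarrow> \<bar>det 0\<bar>" by (rule tendsto_rabs)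
  then have ev_det: "\<forall>\<^sub>F k in sequentially. c0 < \<bar>det (p k 0)\<bar>"
    using det0 by (intro order_tendstoD(1)) (auto simp: c0_def)
  have "(\<lambda>k. 4 * M * Cc * (\<delta> k)\<^sup>2) \<longlonglongrightarrow> 4 * M * Cc * 0\<^sup>2" by (intro tendsto_intros \<delta>_lim)
  then have ev_small: "\<forall>\<^sub>F k in sequentially. 4 * M * Cc * (\<delta> k)\<^sup>2 < 1" by (intro order_tendstoD(2)) auto
  have "(\<lambda>k. h k + \<delta> k) \<longlonglongrightarrow> 0 + 0" by (intro tendsto_intros h_lim \<delta>_lim)
  \<comment> \<open>The bound \<open>lo / 2\<close> places the first node in the range of
    \<open>off_diag_Lipschitz\<close> and is below \<open>x - lo\<close>; the bound
    \<open>1 - hi\<close> equals \<open>hi - x\<close>. Together they keep the support and one mesh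
    inside the window.\<close>
  then have ev_win: "\<forall>\<^sub>F k in sequentially. h k + \<delta> k < min (lo / 2) (1 - hi)"
    using lohi by (intro order_tendstoD(2)) auto
  have kq: "kinked_quadrature R (\<phi> k) (n k) (p k) (w k) (\<lambda>s t. dsnd2_right R t s) (jump R) a0 Al Cc M (h k) x lo hi (\<delta> k)"
    if win: "h k + \<delta> k < min (lo / 2) (1 - hi)" for k
  proof
    have hk: "h k > 0" "h k < 1" using h[of k] by auto
    have dk: "\<delta> k > 0" using d(1) n_pos[of k] by (simp add: \<delta>_def)
    show "continuous_on {0..1} (\<phi> k)"
      unfolding \<phi>_def scaled_kernel_def using hk
      by (intro continuous_intros continuous_on_compose2[OF M(4)]) auto
    show "p k i \<in> {0..1}" if "i < n k" for i using d(3)[OF that] by (simp add: p_def)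
    have dist: "distinct (regular_design f (n k))"
    proof -
      have "regular_design f (n k) ! i < regular_design f (n k) ! j" if "i < j" "j < n k" for i j
        using that
      proof (induction j)
        case (Suc j)
        then show ?case using d(4)[of j "n k"] by (cases "i = j") auto
      qed simp
      then show ?thesis unfolding distinct_conv_nth d(2)[OF n_pos] by (metis less_irrefl linorder_neqE_nat)
    qed
    have "set (regular_design f (n k)) \<subseteq> {0..1}"
      using d(3)[of _ "n k"] d(2)[OF n_pos[of k]] by (auto simp: in_set_conv_nth)
    note inv = nonsingular[OF dist this]
    show "integral {0..1} (\<lambda>s. \<phi> k s * R s (p k i)) = (\<Sum>j<n k. w k j * R (p k j) (p k i))" if "i < n k" for i
      using proj_weight_interpolates[OF inv, of i K x "h k"] that d(2)[OF n_pos[of k]]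
      by (simp add: smoothed_cov_def \<phi>_def w_def p_def mult.commute)
    show "\<bar>\<phi> k s\<bar> \<le> M / h k" for s
      unfolding \<phi>_def scaled_kernel_def using hk M(2)[of "(x - s) / h k"]
      by (simp add: abs_mult divide_right_mono)
    show "\<phi> k s = 0" if "s \<notin> {x - h k..x + h k}" for s
    proof -
      have "(x - s) / h k \<notin> {-1..1}" using that hk by (auto simp: field_simps)
      then show ?thesis by (simp add: \<phi>_def scaled_kernel_def M(3))
    qed
    show "((\<lambda>t. dsnd2_right R t s * tent a b c t) has_integral (second_diff (R s) a b c + jump R s * tent a b c s)) {a..c}"
      if "s \<in> {0..1}" "0 \<le> a" "a < b" "b < c" "c \<le> 1" for s a b c
      by (rule assumption_A_tent_integral[OF A that])
    show "p k i < p k (Suc i) \<and> p k (Suc i) \<le> p k i + \<delta> k" if "Suc i < n k" for i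
      using d(4,5)[OF that] by (simp add: p_def \<delta>_def)
    show "0 < p k 0" "p k 0 < lo" using p0[of k] win hk lohi by auto
    show "p k (n k - 1) = 1" using d(8)[OF n_pos] by (simp add: p_def)
    have wd: "h k + \<delta> k < x / 4" "h k + \<delta> k < (1 - x) / 2"
      using win by (auto simp: lo_def hi_def field_simps)
    show "0 < lo" "lo \<le> x - h k - \<delta> k" "x + h k + \<delta> k \<le> hi" "hi < 1"
      using wd lohi x by (auto simp: lo_def hi_def field_simps)
    show "0 \<le> \<delta> k" using dk by simp
    show "in_rk_ball R Cc (\<lambda>s. dsnd2_right R t s)" if "t \<in> {0..1}" for t using Cc(2)[OF that] by simp
    show "0 \<le> Cc" by (rule Cc(1))
    show "0 < a0" by (rule a0)
    show "a0 \<le> jump R s \<and> jump R s \<le> Al" if "s \<in> {0<..<1}" for s using a0(2)[OF that] Al[OF that] by simp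
    show "0 < h k" "0 < n k" using hk n_pos by auto
  qed (use R_cont R_sym psd in auto)
  define Ba where "Ba = 2 * Bg * BR / c0"
  define Bb where "Bb = Bg + 2 * (Ba * BR)"
  define L where "L = (Lg + 2 * (Ba * LR)) / a0 + Bb * La / a0\<^sup>2"
  define Q where "Q = 4 * M * (M * Al + Cc)"
  define good where "good k \<longleftrightarrow> c0 < \<bar>det (p k 0)\<bar> \<and> 4 * M * Cc * (\<delta> k)\<^sup>2 < 1 \<and> h k + \<delta> k < min (lo / 2) (1 - hi)" for k
  have ev_good: "\<forall>\<^sub>F k in sequentially. good k"
    unfolding good_def using ev_det ev_small ev_win by eventually_elim auto
  have energy: "projection_quadrature.energy R (\<phi> k) (n k) (p k) (w k) \<le> Q * ((\<delta> k)\<^sup>2 / h k)" if "good k" for k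
  proof -
    interpret kinked_quadrature R "\<phi> k" "n k" "p k" "w k" "\<lambda>s t. dsnd2_right R t s" "jump R" a0 Al Cc M "h k" x lo hi "\<delta> k"
      by (rule kq) (use that in \<open>auto simp: good_def\<close>)
    show ?thesis unfolding Q_def by (rule energy_le) (use that h[of k] in \<open>auto simp: good_def\<close>)
  qed
  \<comment> \<open>Three sources: smoothing of \<open>g\<close> at order \<open>h\<close> squared,
    tent interpolation at order \<open>\<delta>\<close>, and the dual norm of the quadrature error,
    controlled by the energy.\<close>
  have bias: "\<bar>(\<Sum>i<n k. w k i * g (p k i)) - g x\<bar> \<le>
      2 * M * (D * (h k)\<^sup>2) + (2 * M * (Al * (L * \<delta> k)) + 2 * (Bb / a0 * Cc * sqrt (Q * ((\<delta> k)\<^sup>2 / h k))))"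
    if gk: "good k" for k
  proof -
    interpret kinked_quadrature R "\<phi> k" "n k" "p k" "w k" "\<lambda>s t. dsnd2_right R t s" "jump R" a0 Al Cc M "h k" x lo hi "\<delta> k"
      by (rule kq) (use gk in \<open>auto simp: good_def\<close>)
    have sub: "{lo..hi} \<subseteq> {0<..<1}" using window by auto
    have p0': "p k 0 \<in> {0..lo / 2} \<union> {1}" using p0[of k] gk h[of k] by (auto simp: good_def)
    have "\<bar>defect g\<bar> \<le> 2 * M * (Al * (L * \<delta> k)) + 2 * (Bb / a0 * Cc * sqrt energy)"
    proof (rule defect_bound_smooth[OF g_cont Bg(2) _ c0 _ _ _ _ Lg(1) LR(1) _ Ba_def Bb_def L_def])
      show "\<bar>R s t\<bar> \<le> BR" if "s \<in> {0..1}" "t \<in> {0..1}" for s t using BR(2)[of "(s, t)"] that by simp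
      show "c0 \<le> \<bar>R (p k 0) (p k 0) * R 1 1 - (R (p k 0) 1)\<^sup>2\<bar>" using gk by (simp add: good_def det_def)
      show "\<bar>g s - g t\<bar> \<le> Lg * \<bar>s - t\<bar>" if "s \<in> {lo..hi}" "t \<in> {lo..hi}" for s t
        using that sub by (intro Lg(2)) auto
      show "\<bar>R s u - R t u\<bar> \<le> LR * \<bar>s - t\<bar>" if "s \<in> {lo..hi}" "t \<in> {lo..hi}" "u \<in> {p k 0, 1}" for s t u
      proof -
        have "R s u = R u s" "R t u = R u t" using that sub p0[of k] by (auto intro!: R_sym)
        moreover have "u \<in> {0..lo / 2} \<union> {1}" using that(3) p0' by auto
        ultimately show ?thesis using LR(2)[of u s t] that by simp
      qed
      show "\<bar>jump R s - jump R t\<bar> \<le> La * \<bar>s - t\<bar>" if "s \<in> {lo..hi}" "t \<in> {lo..hi}" for s t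
        using lipschitz_onD[OF La, of s t] subsetD[OF sub that(1)] subsetD[OF sub that(2)] by (simp add: dist_real_def)
      show "0 \<le> La" using La by (rule lipschitz_on_nonneg)
    qed
    moreover have "Bb / a0 * Cc * sqrt energy \<le> Bb / a0 * Cc * sqrt (Q * ((\<delta> k)\<^sup>2 / h k))"
    proof (rule mult_left_mono)
      show "sqrt energy \<le> sqrt (Q * ((\<delta> k)\<^sup>2 / h k))" using energy[OF gk] by simp
      show "0 \<le> Bb / a0 * Cc" using Bg BR Ba_def Bb_def c0 a0 Cc by simp
    qed
    moreover have "\<bar>integral {0..1} (\<lambda>s. \<phi> k s * g s) - g x\<bar> \<le> 2 * M * (D * (h k)\<^sup>2)"
    proof -
      have hw: "h k > 0" "0 \<le> x - h k" "x + h k \<le> 1" using h_pos window \<delta>_nonneg by auto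
      note mom = scaled_kernel_moments[OF kernel hw, folded \<phi>_def]
      \<comment> \<open>Mass 1 reproduces \<open>g x\<close> and the vanishing first moment removes
        the linear term, which leaves the quadratic Taylor remainder.\<close>
      have "((\<lambda>s. \<phi> k s * g s - (g x * \<phi> k s + g1 * (\<phi> k s * (s - x)))) has_integral
          (integral {0..1} (\<lambda>s. \<phi> k s * g s) - (g x * 1 + g1 * 0))) {0..1}"
        by (intro has_integral_diff has_integral_add has_integral_mult_right mom
            integrable_integral integrable_phi_mult g_cont)
      moreover have "(\<lambda>s. \<phi> k s * g s - (g x * \<phi> k s + g1 * (\<phi> k s * (s - x)))) =
          (\<lambda>s. \<phi> k s * (g s - g x - g1 * (s - x)))" by (simp add: fun_eq_iff algebra_simps)
      ultimately have "integral {0..1} (\<lambda>s. \<phi> k s * (g s - g x - g1 * (s - x))) = integral {0..1} (\<lambda>s. \<phi> k s * g s) - g x"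
        by (simp add: integral_unique)
      moreover have "\<bar>integral {0..1} (\<lambda>s. \<phi> k s * (g s - g x - g1 * (s - x)))\<bar> \<le> 2 * M * (D * (h k)\<^sup>2)"
      proof (rule phi_integral_bound)
        show "continuous_on {0..1} (\<lambda>s. g s - g x - g1 * (s - x))" by (intro continuous_intros g_cont)
        fix s assume s: "s \<in> {x - h k..x + h k}"
        have "\<bar>g s - g x - g1 * (s - x)\<bar> \<le> D * (s - x)\<^sup>2" using s hw by (intro D(2)) auto
        also have "\<dots> \<le> D * (h k)\<^sup>2"
          using s D(1) by (intro mult_left_mono power2_le_iff_abs_le[THEN iffD2]) auto
        finally show "\<bar>g s - g x - g1 * (s - x)\<bar> \<le> D * (h k)\<^sup>2" .
      qed
      ultimately show ?thesis by simp
    qed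
    moreover have "(\<Sum>i<n k. w k i * g (p k i)) - g x = (integral {0..1} (\<lambda>s. \<phi> k s * g s) - g x) - defect g"
      by (simp add: defect_def)
    ultimately show ?thesis by linarith
  qed
  obtain c1 where c1: "c1 > 0" "\<forall>\<^sub>F k in sequentially. real (m k) / real (n k) \<le> c1"
  proof -
    from m_n obtain c where "c > 0" "\<forall>\<^sub>F k in sequentially. norm (real (m k) / real (n k)) \<le> c * norm (1::real)"
      by (auto elim!: landau_o.bigE)
    then show ?thesis using that[of c] by simp
  qed
  have hnh: "(\<lambda>k. 1 / (real (n k) * h k)) \<longlonglongrightarrow> 0"
    by (rule tendsto_divide_0[OF tendsto_const filterlim_at_top_imp_at_infinity[OF nh_lim]])
  have \<delta>h: "(\<delta> k)\<^sup>2 / h k = d\<^sup>2 * (1 / real (n k)) * (1 / (real (n k) * h k))" for k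
    unfolding \<delta>_def using h[of k] by (simp add: power2_eq_square)
  \<comment> \<open>Up to the factor \<open>d\<close> squared this is \<open>m / n\<close> times
    \<open>1 / (n * h)\<close>: a bounded factor times one that tends to 0.\<close>
  have z: "(\<lambda>k. real (m k) * ((\<delta> k)\<^sup>2 / h k)) \<longlonglongrightarrow> 0"
  proof (rule tendsto_sandwich[OF _ _ tendsto_const])
    have "(\<lambda>k. d\<^sup>2 * c1 * (1 / (real (n k) * h k))) \<longlonglongrightarrow> d\<^sup>2 * c1 * 0" by (intro tendsto_intros hnh)
    then show "(\<lambda>k. d\<^sup>2 * c1 * (1 / (real (n k) * h k))) \<longlonglongrightarrow> 0" by simp
    show "\<forall>\<^sub>F k in sequentially. 0 \<le> real (m k) * ((\<delta> k)\<^sup>2 / h k)"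
      using h by (intro always_eventually allI mult_nonneg_nonneg divide_nonneg_nonneg) (auto simp: less_imp_le)
    show "\<forall>\<^sub>F k in sequentially. real (m k) * ((\<delta> k)\<^sup>2 / h k) \<le> d\<^sup>2 * c1 * (1 / (real (n k) * h k))"
      using c1(2)
    proof eventually_elim
      case (elim k)
      have "real (m k) * ((\<delta> k)\<^sup>2 / h k) = d\<^sup>2 * (real (m k) / real (n k)) * (1 / (real (n k) * h k))"
        by (simp add: \<delta>h)
      also have "\<dots> \<le> d\<^sup>2 * c1 * (1 / (real (n k) * h k))"
        using elim h[of k] by (intro mult_right_mono mult_left_mono) auto
      finally show ?case .
    qed
  qed
  have z': "(\<lambda>k. sqrt (real (m k)) * sqrt ((\<delta> k)\<^sup>2 / h k)) \<longlonglongrightarrow> 0"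
    using tendsto_real_sqrt[OF z] unfolding real_sqrt_mult real_sqrt_zero .
  have v: "(\<lambda>k. sqrt (real (m k)) * \<delta> k) \<longlonglongrightarrow> 0"
  proof (rule tendsto_sandwich[OF _ _ tendsto_const z'])
    have dp: "0 \<le> \<delta> k" for k using d(1) by (simp add: \<delta>_def)
    then show "\<forall>\<^sub>F k in sequentially. 0 \<le> sqrt (real (m k)) * \<delta> k" by (intro always_eventually allI) simp
    \<comment> \<open>As \<open>h k < 1\<close>, the interpolation rate is dominated by the energy
      rate.\<close>
    have "\<delta> k \<le> sqrt ((\<delta> k)\<^sup>2 / h k)" for k
    proof (rule real_le_rsqrt)
      have "(\<delta> k)\<^sup>2 * h k \<le> (\<delta> k)\<^sup>2" using h[of k] by (intro mult_left_le) auto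
      then show "(\<delta> k)\<^sup>2 \<le> (\<delta> k)\<^sup>2 / h k" using h[of k] by (simp add: le_divide_eq)
    qed
    then show "\<forall>\<^sub>F k in sequentially. sqrt (real (m k)) * \<delta> k \<le> sqrt (real (m k)) * sqrt ((\<delta> k)\<^sup>2 / h k)"
      by (intro always_eventually allI mult_left_mono) auto
  qed
  show "(\<lambda>k. sqrt (real (m k)) * ((\<Sum>i<n k. w k i * g (p k i)) - g x)) \<longlonglongrightarrow> 0"
  proof (rule Lim_null_comparison)
    let ?u = "\<lambda>k. 2 * M * D * (sqrt (real (m k)) * (h k)\<^sup>2) + (2 * M * Al * L * (sqrt (real (m k)) * \<delta> k)
      + 2 * (Bb / a0 * Cc * sqrt Q) * (sqrt (real (m k)) * sqrt ((\<delta> k)\<^sup>2 / h k)))"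
    have "?u \<longlonglongrightarrow> 2 * M * D * 0 + (2 * M * Al * L * 0 + 2 * (Bb / a0 * Cc * sqrt Q) * 0)"
      by (intro tendsto_intros mh2_lim v z')
    then show "?u \<longlonglongrightarrow> 0" by simp
    show "\<forall>\<^sub>F k in sequentially. norm (sqrt (real (m k)) * ((\<Sum>i<n k. w k i * g (p k i)) - g x)) \<le> ?u k"
      using ev_good
    proof eventually_elim
      case (elim k)
      have "norm (sqrt (real (m k)) * ((\<Sum>i<n k. w k i * g (p k i)) - g x)) =
          sqrt (real (m k)) * \<bar>(\<Sum>i<n k. w k i * g (p k i)) - g x\<bar>" by (simp add: abs_mult)
      also have "\<dots> \<le> sqrt (real (m k)) * (2 * M * (D * (h k)\<^sup>2) + (2 * M * (Al * (L * \<delta> k))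
          + 2 * (Bb / a0 * Cc * sqrt (Q * ((\<delta> k)\<^sup>2 / h k)))))"
        by (intro mult_left_mono bias elim) simp
      also have "\<dots> = ?u k" unfolding real_sqrt_mult[of Q] by (simp add: distrib_left mult_ac)
      finally show ?case .
    qed
  qed
  have \<delta>h_lim: "(\<lambda>k. (\<delta> k)\<^sup>2 / h k) \<longlonglongrightarrow> 0"
  proof -
    have "(\<lambda>k. 1 / real (n k)) \<longlonglongrightarrow> 0"
      by (rule tendsto_divide_0[OF tendsto_const filterlim_at_top_imp_at_infinity[OF nr]])
    then have "(\<lambda>k. d\<^sup>2 * (1 / real (n k)) * (1 / (real (n k) * h k))) \<longlonglongrightarrow> d\<^sup>2 * 0 * 0"
      by (intro tendsto_intros hnh)
    then show ?thesis by (simp add: \<delta>h)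
  qed
  let ?N = "\<lambda>k. quad_form {..<Suc (n k)} (\<lambda>i. if i < n k then w k i else -1) (\<lambda>i. if i < n k then p k i else x) R"
  have noise: "?N k \<le> 2 * M * (2 * M * e) + 6 * M * e + 2 * ((\<delta> k)\<^sup>2 / h k * (M * Al + Cc * sqrt (Q * ((\<delta> k)\<^sup>2 / h k))))"
    if gk: "good k" and e: "\<And>s t. s \<in> {x - h k..x + h k} \<Longrightarrow> t \<in> {0..1} \<Longrightarrow> \<bar>R s t - R x t\<bar> \<le> e" for k e
  proof -
    interpret kinked_quadrature R "\<phi> k" "n k" "p k" "w k" "\<lambda>s t. dsnd2_right R t s" "jump R" a0 Al Cc M "h k" x lo hi "\<delta> k"
      by (rule kq) (use gk in \<open>auto simp: good_def\<close>)
    have hw: "h k > 0" "0 \<le> x - h k" "x + h k \<le> 1" using h_pos window \<delta>_nonneg by auto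
    have "?N k \<le> 2 * M * (2 * M * e) + 6 * M * e + 2 * \<bar>resid x\<bar>"
      using noise_quad_bound[OF _ e] scaled_kernel_moments(1)[OF kernel hw] by (simp add: \<phi>_def)
    moreover have "\<bar>resid x\<bar> \<le> (\<delta> k)\<^sup>2 * (M * Al / h k + Cc * sqrt energy)"
      using window p_first \<delta>_nonneg hw by (intro resid_bound) auto
    \<comment> \<open>As \<open>h k < 1\<close>, the energy term may also be divided by
      \<open>h k\<close>; the whole bound then depends only on the vanishing ratio of
      \<open>\<delta>\<close> squared to \<open>h\<close>.\<close>
    moreover have "(\<delta> k)\<^sup>2 * (M * Al / h k + Cc * sqrt energy) \<le> (\<delta> k)\<^sup>2 * ((M * Al + Cc * sqrt (Q * ((\<delta> k)\<^sup>2 / h k))) / h k)"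
    proof (rule mult_left_mono)
      have "sqrt energy \<le> sqrt (Q * ((\<delta> k)\<^sup>2 / h k))" using energy[OF gk] by simp
      then have "Cc * sqrt energy \<le> Cc * sqrt (Q * ((\<delta> k)\<^sup>2 / h k))" by (intro mult_left_mono Cc)
      also have "\<dots> \<le> Cc * sqrt (Q * ((\<delta> k)\<^sup>2 / h k)) / h k"
      proof -
        have "0 \<le> Cc * sqrt (Q * ((\<delta> k)\<^sup>2 / h k))" using calculation Cc(1) energy_nonneg
          by (meson mult_nonneg_nonneg order_trans real_sqrt_ge_zero)
        then have "Cc * sqrt (Q * ((\<delta> k)\<^sup>2 / h k)) * h k \<le> Cc * sqrt (Q * ((\<delta> k)\<^sup>2 / h k))"
          using h[of k] by (intro mult_left_le) auto
        then show ?thesis using hw by (simp add: le_divide_eq)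
      qed
      finally show "M * Al / h k + Cc * sqrt energy \<le> (M * Al + Cc * sqrt (Q * ((\<delta> k)\<^sup>2 / h k))) / h k"
        by (simp add: add_divide_distrib)
    qed simp
    ultimately show ?thesis by simp
  qed
  have N0: "0 \<le> ?N k" for k
    using d(3)[of _ "n k"] x by (intro psd') (auto simp: p_def)
  have rl: "(\<lambda>k. 2 * ((\<delta> k)\<^sup>2 / h k * (M * Al + Cc * sqrt (Q * ((\<delta> k)\<^sup>2 / h k))))) \<longlonglongrightarrow> 0"
  proof -
    have "(\<lambda>k. 2 * ((\<delta> k)\<^sup>2 / h k * (M * Al + Cc * sqrt (Q * ((\<delta> k)\<^sup>2 / h k))))) \<longlonglongrightarrow> 2 * (0 * (M * Al + Cc * sqrt (Q * 0)))"
      by (intro tendsto_intros \<delta>h_lim)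
    then show ?thesis by simp
  qed
  show "?N \<longlonglongrightarrow> 0"
  proof (rule tendstoI)
    fix \<eta> :: real assume \<eta>: "\<eta> > 0"
    \<comment> \<open>The summand 1 makes \<open>W\<close> positive even for \<open>M = 0\<close>,
      so that \<open>e\<close> is well defined and positive.\<close>
    define W where "W = 2 * M * (2 * M) + 6 * M + 1"
    have W: "W > 0" using M(1) by (simp add: W_def add_nonneg_pos)
    define e where "e = \<eta> / (2 * W)"
    have e: "e > 0" using \<eta> W by (simp add: e_def)
    have "uniformly_continuous_on ({0..1} \<times> {0..1}) (\<lambda>(s, t). R s t)"
      using R_cont by (intro compact_uniformly_continuous compact_Times) auto
    then obtain r where r: "r > 0" and r': "\<And>q q'. q \<in> {0..1} \<times> {0..1} \<Longrightarrow> q' \<in> {0..1} \<times> {0..1} \<Longrightarrow>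
        dist q' q < r \<Longrightarrow> dist ((\<lambda>(s, t). R s t) q') ((\<lambda>(s, t). R s t) q) < e"
      unfolding uniformly_continuous_on_def using e by meson
    have "\<forall>\<^sub>F k in sequentially. h k < r" using h_lim r by (rule order_tendstoD(2))
    moreover have "\<forall>\<^sub>F k in sequentially. 2 * ((\<delta> k)\<^sup>2 / h k * (M * Al + Cc * sqrt (Q * ((\<delta> k)\<^sup>2 / h k)))) < \<eta> / 2"
      using rl by (rule order_tendstoD(2)) (use \<eta> in simp)
    ultimately show "\<forall>\<^sub>F k in sequentially. dist (?N k) 0 < \<eta>"
      using ev_good
    proof eventually_elim
      case (elim k)
      have wn: "{x - h k..x + h k} \<subseteq> {0..1}"
      proof -
        have "\<delta> k \<ge> 0" using d(1) by (simp add: \<delta>_def)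
        then show ?thesis using elim(3) x by (auto simp: good_def lo_def hi_def field_simps)
      qed
      have "?N k \<le> 2 * M * (2 * M * e) + 6 * M * e + 2 * ((\<delta> k)\<^sup>2 / h k * (M * Al + Cc * sqrt (Q * ((\<delta> k)\<^sup>2 / h k))))"
      proof (rule noise[OF elim(3)])
        fix s t :: real assume s: "s \<in> {x - h k..x + h k}" and t: "t \<in> {0..1}"
        then have "dist s x < r" using elim(1) by (auto simp: dist_real_def)
        then show "\<bar>R s t - R x t\<bar> \<le> e"
          using r'[of "(x, t)" "(s, t)"] s t wn x by (auto simp: dist_Pair_Pair dist_real_def)
      qed
      also have "2 * M * (2 * M * e) + 6 * M * e = W * e - e" by (simp add: W_def algebra_simps)
      also have "W * e = \<eta> / 2" using W by (simp add: e_def)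
      finally have "?N k < \<eta>" using elim(2) e by linarith
      then show ?case using N0[of k] by simp
    qed
  qed
qed

section \<open>From vanishing bias and noise difference to the normal limit\<close>

theorem theorem3:
  fixes M :: "'a measure" and N :: "'b measure"
    and \<epsilon> :: "real \<Rightarrow> 'b \<Rightarrow> real" and E Y :: "nat \<Rightarrow> real \<Rightarrow> 'a \<Rightarrow> real"
    and g :: "real \<Rightarrow> real" and R :: "real \<Rightarrow> real \<Rightarrow> real"
    and H :: "(real \<Rightarrow> real) set" and ip :: "(real \<Rightarrow> real) \<Rightarrow> (real \<Rightarrow> real) \<Rightarrow> real"
    and K f :: "real \<Rightarrow> real" and x :: real
    and n m :: "nat \<Rightarrow> nat" and h :: "nat \<Rightarrow> real"
  assumes prob: "prob_space M" "prob_space N"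
    and process: "second_order_process N \<epsilon>" "centered_process N \<epsilon>"
    and cov: "\<And>s t. s \<in> {0..1} \<Longrightarrow> t \<in> {0..1} \<Longrightarrow> R s t = autocovariance N \<epsilon> s t"
    and cov_cont: "continuous_on ({0..1} \<times> {0..1}) (\<lambda>(s, t). R s t)"
    and nonsingular: "\<And>ts. distinct ts \<Longrightarrow> set ts \<subseteq> {0..1} \<Longrightarrow> invertible_mat (gram R ts)"
    and errors: "iid_copies M E N \<epsilon>"
    and g: "C2_on {0..1} g"
    and model: "\<And>j t \<omega>. j \<ge> 1 \<Longrightarrow> t \<in> {0..1} \<Longrightarrow> \<omega> \<in> space M \<Longrightarrow> Y j t \<omega> = g t + E j t \<omega>"
    and kernel: "smoothing_kernel K"
    and rkhs: "is_rkhs {0..1} R H ip"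
    and A: "assumption_A R" and B: "assumption_B R"
    and C: "assumption_C R H ip" and D: "assumption_D K"
    and density: "design_density f"
    and x: "x \<in> {0<..<1}"
    and h: "\<And>k. h k \<in> {0<..<1}"
    and design_near_x: "\<And>k. set (regular_design f (n k)) \<inter> {x - h k<..<x + h k} \<noteq> {}"
    and nh_ge_1: "\<And>k. real (n k) * h k \<ge> 1"
    and n_lim: "filterlim n at_top sequentially" and m_lim: "filterlim m at_top sequentially"
    and h_lim: "h \<longlonglongrightarrow> 0"
    and nh_lim: "filterlim (\<lambda>k. real (n k) * h k) at_top sequentially"
    and m_n: "(\<lambda>k. real (m k) / real (n k)) \<in> O(\<lambda>_. 1)"
    and nh2_lim: "filterlim (\<lambda>k. real (n k) * (h k)\<^sup>2) at_top sequentially"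
    and mh2_lim: "(\<lambda>k. sqrt (real (m k)) * (h k)\<^sup>2) \<longlonglongrightarrow> 0"
  shows "weak_conv_m
    (\<lambda>k. distr M borel (\<lambda>\<omega>. sqrt (real (m k)) *
       (proj_estimator R K (h k) (regular_design f (n k)) (m k) Y x \<omega> - g x)))
    (density lborel (normal_density 0 (sqrt (R x x))))"
proof -
  interpret M: prob_space M by fact
  interpret N: prob_space N by fact
  have R_sym: "R s t = R t s" if "s \<in> {0..1}" "t \<in> {0..1}" for s t
    using cov[OF that] cov[OF that(2,1)] by (simp add: autocovariance_def mult.commute)
  \<comment> \<open>The form is a second moment of the process. The index type stays general because
    the ball test needs \<open>nat + nat\<close> and the noise form needs
    \<open>nat\<close>.\<close>
  have psd: "0 \<le> quad_form I c s R" if "finite I" "s ` I \<subseteq> {0..1}" for I :: "'i set" and c s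
    using process_combination(4)[OF prob(2) process cov that, of c, symmetric] by simp
  have n_pos: "n k > 0" for k using nh_ge_1[of k] by (cases "n k") auto
  have x01: "x \<in> {0..1}" using x by auto
  \<comment> \<open>The one-point Gram matrix is nonsingular; with nonnegativity this gives the
    positive standard deviation that \<open>clt_perturbed\<close> asks for.\<close>
  have "R x x \<noteq> 0" using gram_single_nonzero[of R x] nonsingular[of "[x]"] x01 by auto
  moreover have "0 \<le> R x x" using psd[of "{()}" "\<lambda>_. x" "\<lambda>_. 1"] x01 by (simp add: quad_form_def)
  ultimately have Rx: "R x x > 0" by simp
  define p where "p k i = regular_design f (n k) ! i" for k i
  define w where "w k = proj_weight R K x (h k) (regular_design f (n k))" for k
  define b where "b k = (\<Sum>i<n k. w k i * g (p k i)) - g x" for k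
  \<comment> \<open>Index \<open>n k\<close> appends the point \<open>x\<close> with coefficient -1,
    so \<open>D k j\<close> is the weighted noise of copy \<open>j\<close> minus
    \<open>E j x\<close>.\<close>
  define c where "c k i = (if i < n k then w k i else -1)" for k i
  define s where "s k i = (if i < n k then p k i else x)" for k i
  define D where "D k j \<omega> = (\<Sum>i<Suc (n k). c k i * E j (s k i) \<omega>)" for k j \<omega>
  define Q where "Q k = quad_form {..<Suc (n k)} (c k) (s k) R" for k
  define T where "T k \<omega> = sqrt (real (m k)) *
       (proj_estimator R K (h k) (regular_design f (n k)) (m k) Y x \<omega> - g x)" for k \<omega>
  note asym = projection_asymptotics[OF cov_cont R_sym psd psd nonsingular g kernel rkhs A B C
      density x h n_pos n_lim h_lim nh_lim m_n mh2_lim]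
  have b_lim: "(\<lambda>k. sqrt (real (m k)) * b k) \<longlonglongrightarrow> 0"
    using asym(1) by (simp add: b_def w_def p_def)
  have Q_lim: "Q \<longlonglongrightarrow> 0"
    using asym(2) unfolding Q_def[abs_def] c_def[abs_def] s_def[abs_def] w_def p_def .
  obtain d where len: "\<And>n. n > 0 \<Longrightarrow> length (regular_design f n) = n"
    and mem: "\<And>n i. i < n \<Longrightarrow> regular_design f n ! i \<in> {0..1}"
    using regular_design_props[OF density] by metis
  have p01: "p k i \<in> {0..1}" if "i < n k" for k i using mem[OF that] by (simp add: p_def)
  have s01: "s k ` {..<Suc (n k)} \<subseteq> {0..1}" for k using p01 x01 by (auto simp: s_def)
  \<comment> \<open>After removal of the classical normalised sum there remain the scaled bias and
    the normalised sum of the \<open>D k j\<close>; for \<open>m k = 0\<close> every term is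
    0.\<close>
  have split: "T k \<omega> - 1 / sqrt (real (m k)) * (\<Sum>j=1..m k. E j x \<omega>) =
      sqrt (real (m k)) * b k + 1 / sqrt (real (m k)) * (\<Sum>j=1..m k. D k j \<omega>)"
    if \<omega>: "\<omega> \<in> space M" for k \<omega>
  proof (cases "m k = 0")
    case True
    then show ?thesis by (simp add: T_def)
  next
    case False
    have "proj_estimator R K (h k) (regular_design f (n k)) (m k) Y x \<omega> =
        (\<Sum>i<n k. w k i * sample_mean Y (m k) (p k i) \<omega>)"
      unfolding proj_estimator_def len[OF n_pos] w_def p_def ..
    also have "\<dots> = (\<Sum>i<n k. w k i * g (p k i) + 1 / real (m k) * (\<Sum>j=1..m k. w k i * E j (p k i) \<omega>))"
    proof (intro sum.cong refl)
      fix i assume "i \<in> {..<n k}"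
      then have "(\<Sum>j=1..m k. Y j (p k i) \<omega>) = (\<Sum>j=1..m k. g (p k i) + E j (p k i) \<omega>)"
        using \<omega> p01 by (intro sum.cong refl model) auto
      then have "sample_mean Y (m k) (p k i) \<omega> = g (p k i) + 1 / real (m k) * (\<Sum>j=1..m k. E j (p k i) \<omega>)"
        using False by (simp add: sample_mean_def sum.distrib field_simps)
      then show "w k i * sample_mean Y (m k) (p k i) \<omega> =
          w k i * g (p k i) + 1 / real (m k) * (\<Sum>j=1..m k. w k i * E j (p k i) \<omega>)"
        by (simp add: distrib_left sum_distrib_left)
    qed
    also have "\<dots> = (\<Sum>i<n k. w k i * g (p k i)) + 1 / real (m k) * (\<Sum>j=1..m k. \<Sum>i<n k. w k i * E j (p k i) \<omega>)"
      unfolding sum.distrib sum_distrib_left[symmetric]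
      by (subst sum.swap) (simp add: sum_distrib_left)
    finally have pe: "proj_estimator R K (h k) (regular_design f (n k)) (m k) Y x \<omega> - g x =
        b k + 1 / real (m k) * (\<Sum>j=1..m k. \<Sum>i<n k. w k i * E j (p k i) \<omega>)" by (simp add: b_def)
    have r: "sqrt (real (m k)) * (1 / real (m k)) = 1 / sqrt (real (m k))"
      using False by (simp add: real_div_sqrt field_simps)
    have "D k j \<omega> = (\<Sum>i<n k. w k i * E j (p k i) \<omega>) - E j x \<omega>" for j
      by (simp add: D_def c_def s_def)
    then have DD: "(\<Sum>j=1..m k. D k j \<omega>) = (\<Sum>j=1..m k. \<Sum>i<n k. w k i * E j (p k i) \<omega>) - (\<Sum>j=1..m k. E j x \<omega>)"
      by (simp add: sum_subtractf)
    show ?thesis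
      unfolding T_def pe DD distrib_left mult.assoc[symmetric] r by (simp add: diff_divide_distrib)
  qed
  have fin: "finite {..<Suc (n k)}" for k by simp
  note comb = iid_copies_combination[OF prob(1) errors process(1) fin s01]
  have Dmom: "M.expectation (D k j) = 0" "integrable M (\<lambda>\<omega>. (D k j \<omega>)\<^sup>2)"
    "M.expectation (\<lambda>\<omega>. (D k j \<omega>)\<^sup>2) = Q k" if "j \<ge> 1" for k j
  proof -
    note X = iid_copies_moments[OF prob(1) prob(2) errors process cov fin[of k] s01[of k] that, where c = "c k"]
    show "M.expectation (D k j) = 0" unfolding D_def by (rule X(1))
    show "integrable M (\<lambda>\<omega>. (D k j \<omega>)\<^sup>2)" unfolding D_def by (rule X(2))
    show "M.expectation (\<lambda>\<omega>. (D k j \<omega>)\<^sup>2) = Q k" unfolding D_def Q_def by (rule X(3))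
  qed
  have x01': "(\<lambda>_. x) ` {()} \<subseteq> {0..1}" using x01 by auto
  note comb1 = iid_copies_combination[OF prob(1) errors process(1) finite.insertI[OF finite.emptyI] x01', where c = "\<lambda>_. 1", simplified]
  note mom1 = iid_copies_moments[OF prob(1) prob(2) errors process cov finite.insertI[OF finite.emptyI] x01', where c = "\<lambda>_. 1", simplified]
  have Dindep: "M.indep_vars (\<lambda>_. borel) (D k) {1..}" for k
    unfolding D_def by (rule comb(1))
  have DS: "integrable M (\<lambda>\<omega>. (\<Sum>j=1..m k. D k j \<omega>)\<^sup>2)"
    "M.expectation (\<lambda>\<omega>. (\<Sum>j=1..m k. D k j \<omega>)\<^sup>2) = real (m k) * Q k" for k
  proof -
    have "M.indep_vars (\<lambda>_. borel) (D k) {1..m k}" by (rule M.indep_vars_subset[OF Dindep]) auto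
    from M.second_moment_sum_indep[OF _ this] Dmom
    show "integrable M (\<lambda>\<omega>. (\<Sum>j=1..m k. D k j \<omega>)\<^sup>2)"
      "M.expectation (\<lambda>\<omega>. (\<Sum>j=1..m k. D k j \<omega>)\<^sup>2) = real (m k) * Q k"
      by simp_all
  qed
  have Dm: "D k j \<in> borel_measurable M" if "j \<ge> 1" for k j
    using Dindep[of k] that by (auto simp: M.indep_vars_def2)
  have Em: "E j x \<in> borel_measurable M" if "j \<ge> 1" for j
    using comb1(1) that by (auto simp: M.indep_vars_def2)
  have Sm: "(\<lambda>\<omega>. \<Sum>j=1..m k. D k j \<omega>) \<in> borel_measurable M" for k
    by (intro borel_measurable_sum Dm) auto
  have D1: "integrable M (\<lambda>\<omega>. \<Sum>j=1..m k. D k j \<omega>)" for k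
    by (rule M.integrable_of_square[OF Sm DS(1)])
  have D0: "M.expectation (\<lambda>\<omega>. \<Sum>j=1..m k. D k j \<omega>) = 0" for k
  proof -
    have "integrable M (D k j)" if "j \<in> {1..m k}" for j
      using that by (intro M.integrable_of_square[OF Dm Dmom(2)]) auto
    then have "M.expectation (\<lambda>\<omega>. \<Sum>j=1..m k. D k j \<omega>) = (\<Sum>j=1..m k. M.expectation (D k j))"
      by (rule Bochner_Integration.integral_sum)
    also have "\<dots> = 0" using Dmom(1) by (intro sum.neutral) auto
    finally show ?thesis .
  qed
  define U where "U k \<omega> = sqrt (real (m k)) * b k + 1 / sqrt (real (m k)) * (\<Sum>j=1..m k. D k j \<omega>)" for k \<omega>
  \<comment> \<open>The sum of the \<open>D k j\<close> has mean 0 and second moment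
    \<open>m k * Q k\<close>, so in expectation only the squared bias and at most \<open>Q k\<close>
    remain.\<close>
  have Usq: "(U k \<omega>)\<^sup>2 = (sqrt (real (m k)) * b k)\<^sup>2
      + 2 * (sqrt (real (m k)) * b k) * (1 / sqrt (real (m k))) * (\<Sum>j=1..m k. D k j \<omega>)
      + (1 / sqrt (real (m k)))\<^sup>2 * (\<Sum>j=1..m k. D k j \<omega>)\<^sup>2" for k \<omega>
    unfolding U_def power2_sum power_mult_distrib by (simp only: mult.assoc add.assoc add.commute)
  have Uint: "integrable M (\<lambda>\<omega>. (U k \<omega>)\<^sup>2)" for k
    unfolding Usq
    by (intro Bochner_Integration.integrable_add integrable_mult_right M.integrable_const D1 DS(1))
  have UE: "M.expectation (\<lambda>\<omega>. (U k \<omega>)\<^sup>2) \<le> (sqrt (real (m k)) * b k)\<^sup>2 + Q k" for k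
  proof -
    have "M.expectation (\<lambda>\<omega>. (U k \<omega>)\<^sup>2) = (sqrt (real (m k)) * b k)\<^sup>2 + (1 / sqrt (real (m k)))\<^sup>2 * (real (m k) * Q k)"
      unfolding Usq using D1[of k] DS[of k] D0[of k] by (simp add: M.prob_space)
    \<comment> \<open>Equality for \<open>m k > 0\<close>; for \<open>m k = 0\<close> the left side
      is 0 and \<open>Q k\<close> is nonnegative.\<close>
    also have "(1 / sqrt (real (m k)))\<^sup>2 * (real (m k) * Q k) \<le> Q k"
      using psd[OF fin s01, of k "c k"] by (cases "m k = 0") (auto simp: Q_def power_divide)
    finally show ?thesis by simp
  qed
  have Uext: "T k \<omega> - 1 / sqrt (real (m k)) * (\<Sum>j=1..m k. E j x \<omega>) = U k \<omega>" if "\<omega> \<in> space M" for k \<omega>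
    unfolding U_def by (rule split[OF that])
  have "weak_conv_m (\<lambda>k. distr M borel (T k)) (density lborel (normal_density 0 (sqrt (R x x))))"
  proof (rule M.clt_perturbed)
    show "M.indep_vars (\<lambda>_. borel) (\<lambda>j. E j x) {1..}" using comb1(1) by simp
    show "M.expectation (E j x) = 0" if "j \<ge> 1" for j using mom1(1) that by simp
    show "integrable M (\<lambda>\<omega>. (E j x \<omega>)\<^sup>2)" if "j \<ge> 1" for j using mom1(2) that by simp
    show "M.expectation (\<lambda>\<omega>. (E j x \<omega>)\<^sup>2) = (sqrt (R x x))\<^sup>2" if "j \<ge> 1" for j
      using mom1(3) that Rx by (simp add: quad_form_def)
    show "sqrt (R x x) > 0" using Rx by simp
    show "distr M borel (E j x) = distr N borel (\<epsilon> x)" if "j \<ge> 1" for j using comb1(2) that by simp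
    show "filterlim m at_top sequentially" by fact
    \<comment> \<open>The model determines \<open>Y\<close> only on \<open>space M\<close>, so
      measurability is transferred from an expression in the \<open>D k j\<close> and
      \<open>E j x\<close> that agrees with \<open>T k\<close> there.\<close>
    show "T k \<in> borel_measurable M" for k
    proof -
      have "(\<lambda>\<omega>. U k \<omega> + 1 / sqrt (real (m k)) * (\<Sum>j=1..m k. E j x \<omega>)) \<in> borel_measurable M"
        unfolding U_def
        by (intro borel_measurable_add borel_measurable_times borel_measurable_const Sm borel_measurable_sum Em) auto
      moreover have "T k \<omega> = U k \<omega> + 1 / sqrt (real (m k)) * (\<Sum>j=1..m k. E j x \<omega>)" if "\<omega> \<in> space M" for \<omega>
        using Uext[OF that, of k] by simp
      ultimately show ?thesis by (simp cong: measurable_cong)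
    qed
    have cong: "integrable M (\<lambda>\<omega>. (T k \<omega> - 1 / sqrt (real (m k)) * (\<Sum>j=1..m k. E j x \<omega>))\<^sup>2) \<longleftrightarrow>
        integrable M (\<lambda>\<omega>. (U k \<omega>)\<^sup>2)"
      "M.expectation (\<lambda>\<omega>. (T k \<omega> - 1 / sqrt (real (m k)) * (\<Sum>j=1..m k. E j x \<omega>))\<^sup>2) =
        M.expectation (\<lambda>\<omega>. (U k \<omega>)\<^sup>2)" for k
      by (intro Bochner_Integration.integrable_cong Bochner_Integration.integral_cong; simp only: Uext)+
    show "integrable M (\<lambda>\<omega>. (T k \<omega> - 1 / sqrt (real (m k)) * (\<Sum>j=1..m k. E j x \<omega>))\<^sup>2)" for k
      unfolding cong by (rule Uint)
    show "(\<lambda>k. M.expectation (\<lambda>\<omega>. (T k \<omega> - 1 / sqrt (real (m k)) * (\<Sum>j=1..m k. E j x \<omega>))\<^sup>2)) \<longlonglongrightarrow> 0"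
      unfolding cong
    proof (rule tendsto_sandwich[OF _ _ tendsto_const])
      have "(\<lambda>k. (sqrt (real (m k)) * b k)\<^sup>2 + Q k) \<longlonglongrightarrow> 0\<^sup>2 + 0" by (intro tendsto_intros b_lim Q_lim)
      then show "(\<lambda>k. (sqrt (real (m k)) * b k)\<^sup>2 + Q k) \<longlonglongrightarrow> 0" by simp
    qed (use UE in \<open>auto intro!: always_eventually Bochner_Integration.integral_nonneg\<close>)
  qed
  then show ?thesis by (simp add: T_def[abs_def])
qed

end
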